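(* Let $n\ge1$, let $\lambda$ be a partition into no more than $n$ parts, let $\delta=(n,n-1,\ldots,1)$, and let $m=\lambda_1+n$. Then $$D_{sp(2n)}(x;t)\; sp_\lambda(x;t)=\sum_{UA\in\mathcal{UA}^{\lambda+\delta}(2n)} t^{\mathrm{ssi}(UA)+\mathrm{bar}(UA)}\,(1+t)^{\mathrm{neg}(UA)}\,x^{\mathrm{wgt}(UA)},$$ where the sum is over all $2n\times m$ $\mu$-alternating sign matrices with a U-turn boundary, with $\mu=\lambda+\delta$ (so that the column sums are $1$ or $0$ according as the column number is or is not a part of $\mu$).
   Context: Here $x=(x_1,\ldots,x_n)$ and $t$ are indeterminates, $\lambda$ is padded with zeros to length $n$, and $\lambda+\delta=(\lambda_1+n,\lambda_2+n-1,\ldots,\lambda_n+1)$. $\displaystyle D_{sp(2n)}(x;t)=\prod_{i=1}^n x_i^{n-i+1}\prod_{i=1}^n(1+tx_i^{-2})\prod_{1\le i<j\le n}(1+tx_i^{-1}x_j)(1+tx_i^{-1}x_j^{-1})$. Symplectic tableaux: let $[n,\overline n]=\{1,\ldots,n\}\cup\{\overline1,\ldots,\overline n\}$ be ordered by $\overline1<1<\overline2<2<\cdots<\overline n<n$. $\mathcal T^\lambda(sp(2n))$ is the set of fillings $T$ of the Young diagram of $\lambda$ (left-adjusted rows of lengths $\lambda_i$) with entries in $[n,\overline n]$ that are weakly increasing from left to right along rows, strictly increasing down columns, and whose first-column entry in row $i$ is $\ge\overline i$ for each $i$. If $m_k(T)$, $m_{\overline k}(T)$ are the numbers of entries $k$,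 $\overline k$ in $T$, then $x^{\mathrm{wgt}(T)}=\prod_{k=1}^n x_k^{m_k(T)-m_{\overline k}(T)}$, $\mathrm{bar}(T)=\sum_{k=1}^n m_{\overline k}(T)$, and $sp_\lambda(x;t)=\sum_{T\in\mathcal T^\lambda(sp(2n))}t^{2\,\mathrm{bar}(T)}x^{\mathrm{wgt}(T)}$. U-turn matrices: for a partition $\mu$ with $n$ distinct positive parts and $m=\mu_1$, $\mathcal{UA}^\mu(2n)$ is the set of $2n\times m$ matrices $UA=(a_{iq})$ with: $a_{iq}\in\{-1,0,1\}$; $\sum_{q=p}^m a_{iq}\in\{0,1\}$ for $1\le i\le 2n$, $1\le p\le m$; $\sum_{i=j}^{2n}a_{iq}\in\{0,1\}$ for $1\le j\le 2n$, $1\le q\le m$; $\sum_{q=1}^m(a_{2i-1,q}+a_{2i,q})=1$ for $1\le i\le n$; and, for $1\le q\le m$, $\sum_{i=1}^{2n}a_{iq}=1$ if $q$ is a part of $\mu$ and $=0$ otherwise. Rows are numbered from the top. Statistics of $UA$: a zero entry is positive if the nearest non-zero entry to its right in the same row exists and equals $1$. - $m_k(UA)$ and $m_{\overline k}(UA)$ are the numbers of entries that are $1$'s or positive zeros in row $2n+1-2k$ and in row $2n+2-2k$, respectively, and $x^{\mathrm{wgt}(UA)}=\prod_{k=1}^n x_k^{m_k(UA)-m_{\overline k}(UA)}$. - $\mathrm{neg}(UA)$ is the number of entries $-1$. - $\mathrm{bar}(UA)$ is the total number of $1$'s and positive zeros in the even-numbered rows. - $\mathrm{ssi}(UA)$ is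 the number of positions $(i,q)$ with $a_{iq}=0$ a positive zero such that either $i$ is odd and the nearest non-zero entry below $(i,q)$ in column $q$ exists and equals $1$, or $i$ is even and the nearest non-zero entry below $(i,q)$ in column $q$ either equals $-1$ or does not exist. *)

theory Defs
  imports Complex_Main "HOL-Library.Poly_Mapping" "HOL-Library.FuncSet"
    "HOL-Computational_Algebra.Polynomial"
begin

(* Laurent polynomials in x_1, x_2, ... over Z[t]: an exponent vector is a finitely supported
   family of integers, and the coefficient of each Laurent monomial is an element of int poly,
   whose polynomial variable is t. *)

type_synonym laurent = "(nat \<Rightarrow>\<^sub>0 int) \<Rightarrow>\<^sub>0 int poly"

definition X :: "nat \<Rightarrow> int \<Rightarrow> laurent"  (* X i k is x_i^k *)
  where "X i k = Poly_Mapping.single (Poly_Mapping.single i k) 1"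

definition t :: laurent
  where "t = Poly_Mapping.single 0 (monom 1 1)"

definition D_sp :: "nat \<Rightarrow> laurent" where
  "D_sp n =
     (\<Prod>i = 1..n. X i (int n - int i + 1)) *
     (\<Prod>i = 1..n. 1 + t * X i (- 2)) *
     (\<Prod>i = 1..n. \<Prod>j = i+1..n. (1 + t * X i (- 1) * X j 1) * (1 + t * X i (- 1) * X j (- 1)))"

(* A partition into at most n parts, padded with zeros. The parts are lam 1, ..., lam n, and
   the value lam 0 is never used. *)
definition partition_at_most :: "nat \<Rightarrow> (nat \<Rightarrow> nat) \<Rightarrow> bool" where
  "partition_at_most n lam \<longleftrightarrow> (\<forall>i\<ge>1. lam (Suc i) \<le> lam i) \<and> (\<forall>i>n. lam i = 0)"

definition add_delta :: "nat \<Rightarrow> (nat \<Rightarrow> nat) \<Rightarrow> nat \<Rightarrow> nat" where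
  "add_delta n lam i = (if 1 \<le> i \<and> i \<le> n then lam i + (n + 1 - i) else 0)"

datatype letter = Bar nat | Plain nat

fun letter_rank :: "letter \<Rightarrow> nat" where
  "letter_rank (Bar k) = 2 * k"
| "letter_rank (Plain k) = 2 * k + 1"

lemma letter_rank_inject: "letter_rank a = letter_rank b \<longleftrightarrow> a = b"
  by (cases a; cases b; simp; presburger)

instantiation letter :: linorder
begin

(* Bar 1 < Plain 1 < Bar 2 < Plain 2 < ... *)
definition less_eq_letter :: "letter \<Rightarrow> letter \<Rightarrow> bool"
  where "a \<le> b \<longleftrightarrow> letter_rank a \<le> letter_rank b"

definition less_letter :: "letter \<Rightarrow> letter \<Rightarrow> bool"
  where "a < b \<longleftrightarrow> letter_rank a < letter_rank b"

instance
  by standard (auto simp: less_eq_letter_def less_letter_def letter_rank_inject[symmetric])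

end

definition letters :: "nat \<Rightarrow> letter set"
  where "letters n = Bar ` {1..n} \<union> Plain ` {1..n}"

definition diagram :: "nat \<Rightarrow> (nat \<Rightarrow> nat) \<Rightarrow> (nat \<times> nat) set" where
  "diagram n lam = {(i, j). 1 \<le> i \<and> i \<le> n \<and> 1 \<le> j \<and> j \<le> lam i}"

(* Fillings, and matrices below, are extensional functions (PiE) on their index sets, so that
   each of them is represented by exactly one function. *)
definition sp_tableaux :: "nat \<Rightarrow> (nat \<Rightarrow> nat) \<Rightarrow> (nat \<times> nat \<Rightarrow> letter) set" where
  "sp_tableaux n lam = {T \<in> diagram n lam \<rightarrow>\<^sub>E letters n.
     (\<forall>i j j'. (i, j) \<in> diagram n lam \<and> (i, j') \<in> diagram n lam \<and> j < j'
        \<longrightarrow> T (i, j) \<le> T (i, j')) \<and>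
     (\<forall>i i' j. (i, j) \<in> diagram n lam \<and> (i', j) \<in> diagram n lam \<and> i < i'
        \<longrightarrow> T (i, j) < T (i', j)) \<and>
     (\<forall>i. (i, 1) \<in> diagram n lam \<longrightarrow> Bar i \<le> T (i, 1))}"

definition tab_count ::
  "nat \<Rightarrow> (nat \<Rightarrow> nat) \<Rightarrow> (nat \<times> nat \<Rightarrow> letter) \<Rightarrow> letter \<Rightarrow> nat" where
  "tab_count n lam T a = card {c \<in> diagram n lam. T c = a}"

definition tab_wgt :: "nat \<Rightarrow> (nat \<Rightarrow> nat) \<Rightarrow> (nat \<times> nat \<Rightarrow> letter) \<Rightarrow> laurent" where
  "tab_wgt n lam T =
     (\<Prod>k = 1..n. X k (int (tab_count n lam T (Plain k)) - int (tab_count n lam T (Bar k))))"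

definition tab_bar :: "nat \<Rightarrow> (nat \<Rightarrow> nat) \<Rightarrow> (nat \<times> nat \<Rightarrow> letter) \<Rightarrow> nat" where
  "tab_bar n lam T = (\<Sum>k = 1..n. tab_count n lam T (Bar k))"

definition sp_char :: "nat \<Rightarrow> (nat \<Rightarrow> nat) \<Rightarrow> laurent" where
  "sp_char n lam = (\<Sum>T \<in> sp_tableaux n lam. t ^ (2 * tab_bar n lam T) * tab_wgt n lam T)"

(* The matrices have 2n rows and m = mu 1 columns, and A (i, q) is the entry in row i and
   column q. *)
definition UA :: "nat \<Rightarrow> (nat \<Rightarrow> nat) \<Rightarrow> (nat \<times> nat \<Rightarrow> int) set" where
  "UA n mu = (let m = mu 1 in {A \<in> {1..2*n} \<times> {1..m} \<rightarrow>\<^sub>E {-1, 0, 1}.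
     (\<forall>i\<in>{1..2*n}. \<forall>p\<in>{1..m}. (\<Sum>q = p..m. A (i, q)) \<in> {0, 1}) \<and>
     (\<forall>j\<in>{1..2*n}. \<forall>q\<in>{1..m}. (\<Sum>i = j..2*n. A (i, q)) \<in> {0, 1}) \<and>
     (\<forall>i\<in>{1..n}. (\<Sum>q = 1..m. A (2*i-1, q) + A (2*i, q)) = 1) \<and>
     (\<forall>q\<in>{1..m}. (\<Sum>i = 1..2*n. A (i, q)) = (if q \<in> mu ` {1..n} then 1 else 0))})"

definition next_right ::
  "nat \<Rightarrow> (nat \<times> nat \<Rightarrow> int) \<Rightarrow> nat \<Rightarrow> nat \<Rightarrow> int \<Rightarrow> bool" where
  "next_right m A i q v \<longleftrightarrow>
     v \<noteq> 0 \<and> (\<exists>r. q < r \<and> r \<le> m \<and> A (i, r) = v \<and> (\<forall>s. q < s \<and> s < r \<longrightarrow> A (i, s) = 0))"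

definition next_below ::
  "nat \<Rightarrow> (nat \<times> nat \<Rightarrow> int) \<Rightarrow> nat \<Rightarrow> nat \<Rightarrow> int \<Rightarrow> bool" where
  "next_below n A i q v \<longleftrightarrow>
     v \<noteq> 0 \<and> (\<exists>r. i < r \<and> r \<le> 2*n \<and> A (r, q) = v \<and> (\<forall>s. i < s \<and> s < r \<longrightarrow> A (s, q) = 0))"

definition none_below :: "nat \<Rightarrow> (nat \<times> nat \<Rightarrow> int) \<Rightarrow> nat \<Rightarrow> nat \<Rightarrow> bool" where
  "none_below n A i q \<longleftrightarrow> (\<forall>s. i < s \<and> s \<le> 2*n \<longrightarrow> A (s, q) = 0)"

definition positive_zero :: "nat \<Rightarrow> (nat \<times> nat \<Rightarrow> int) \<Rightarrow> nat \<Rightarrow> nat \<Rightarrow> bool" where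
  "positive_zero m A i q \<longleftrightarrow> A (i, q) = 0 \<and> next_right m A i q 1"

definition row_count :: "nat \<Rightarrow> (nat \<times> nat \<Rightarrow> int) \<Rightarrow> nat \<Rightarrow> nat" where
  "row_count m A i = card {q \<in> {1..m}. A (i, q) = 1 \<or> positive_zero m A i q}"

(* Rows 2n+1-2k and 2n+2-2k of the matrix belong to the letters k and bar k. *)
definition ua_wgt :: "nat \<Rightarrow> nat \<Rightarrow> (nat \<times> nat \<Rightarrow> int) \<Rightarrow> laurent" where
  "ua_wgt n m A =
     (\<Prod>k = 1..n. X k (int (row_count m A (2*n + 1 - 2*k)) - int (row_count m A (2*n + 2 - 2*k))))"

definition ua_neg :: "nat \<Rightarrow> nat \<Rightarrow> (nat \<times> nat \<Rightarrow> int) \<Rightarrow> nat" where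
  "ua_neg n m A = card {(i, q). i \<in> {1..2*n} \<and> q \<in> {1..m} \<and> A (i, q) = -1}"

definition ua_bar :: "nat \<Rightarrow> nat \<Rightarrow> (nat \<times> nat \<Rightarrow> int) \<Rightarrow> nat" where
  "ua_bar n m A = card {(i, q). i \<in> {1..2*n} \<and> even i \<and> q \<in> {1..m} \<and>
     (A (i, q) = 1 \<or> positive_zero m A i q)}"

definition ua_ssi :: "nat \<Rightarrow> nat \<Rightarrow> (nat \<times> nat \<Rightarrow> int) \<Rightarrow> nat" where
  "ua_ssi n m A = card {(i, q). i \<in> {1..2*n} \<and> q \<in> {1..m} \<and> positive_zero m A i q \<and>
     (odd i \<and> next_below n A i q 1 \<or>
      even i \<and> (next_below n A i q (-1) \<or> none_below n A i q))}"

lemma finite_diagram: "finite (diagram n lam)"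
proof -
  have "diagram n lam = (SIGMA i:{1..n}. {1..lam i})"
    by (auto simp: diagram_def)
  then show ?thesis by simp
qed

lemma finite_sp_tableaux: "finite (sp_tableaux n lam)"
  by (rule finite_subset[of _ "diagram n lam \<rightarrow>\<^sub>E letters n"])
     (auto simp: sp_tableaux_def letters_def intro!: finite_PiE finite_diagram)

lemma finite_UA: "finite (UA n mu)"
  by (rule finite_subset[of _ "{1..2*n} \<times> {1..mu 1} \<rightarrow>\<^sub>E {-1, 0, 1}"])
     (auto simp: UA_def Let_def intro!: finite_PiE)

end

theory Submission
  imports Defs "Jordan_Normal_Form.Determinant"
begin

text \<open>Let \<open>c\<^sub>i = x\<^sub>i + t\<^sup>2/x\<^sub>i\<close>, let \<open>u\<^sub>q(x\<^sub>i)\<close> be the complete homogeneous polynomial of degree \<open>q - 1\<close> in \<open>x\<^sub>i\<close> and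
  \<open>t\<^sup>2/x\<^sub>i\<close>, let \<open>a\<^sub>\<mu>\<close> be the determinant of the \<open>u\<close> with index \<open>\<mu>\<^sub>i\<close> at \<open>x\<^sub>j\<close>, and let \<open>V\<close> be the product of
  the \<open>c\<^sub>i - c\<^sub>j\<close> over \<open>i < j\<close>. Both \<open>V sp\<^sub>\<lambda>(x;t)\<close> and the right-hand side times \<open>V\<close> divided by \<open>D\<close> equal \<open>a\<^sub>\<mu>\<close>;
  as \<open>V\<close> is not a zero divisor, the theorem follows.

  Recording for each \<open>j\<close> the columns in which the lowest \<open>j\<close> rows have sum \<open>1\<close> turns a matrix into a
  chain of interlacing sets, and the statistics become products of local weights satisfying the
  free-fermion condition. A tableau is likewise a chain of partitions that differ by horizontal
  strips. In both cases a row acts on a determinant \<open>det \<psi>\<^sub>j(\<nu>\<^sub>i)\<close> through multilinearity: the sum over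
  all interlacing \<open>\<nu>\<close> is a product of interval sums, and after row operations it becomes
  \<open>det K\<psi>\<^sub>j(\<mu>\<^sub>i)\<close> for a linear operator \<open>K\<close> on sequences. For the two rows belonging to \<open>x\<^sub>n\<close> a linear recurrence gives
  \<open>(c\<^sub>j - c\<^sub>n) KK'u(x\<^sub>j)\<close> as a combination of \<open>u(x\<^sub>j)\<close> and \<open>u(x\<^sub>n)\<close>, in which the coefficient of \<open>u(x\<^sub>j)\<close> is the factor
  \<open>c\<^sub>j + t x\<^sub>n + t/x\<^sub>n\<close> of \<open>D\<close> for the matrices and \<open>1\<close> for the tableaux.\<close>

section \<open>Determinants and interlacing sums\<close>

text \<open>Parts index the rows and functions the columns, so that sums over parts act by row
  operations and relations between the functions by column operations.\<close>

definition seqdet :: "nat \<Rightarrow> (nat \<Rightarrow> nat \<Rightarrow> 'a::comm_ring_1) \<Rightarrow> (nat \<Rightarrow> nat) \<Rightarrow> 'a" where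
  "seqdet k \<psi> f = det (mat k k (\<lambda>(i, j). \<psi> j (f i)))"

lemma det_mat_Leibniz:
  "det (mat k k (\<lambda>(i, j). M i j)) =
     (\<Sum>p | p permutes {0..<k}. signof p * (\<Prod>i<k. M i (p i)))"
proof -
  have "det (mat k k (\<lambda>(i, j). M i j)) =
     (\<Sum>p | p permutes {0..<k}. signof p * (\<Prod>i = 0..<k. mat k k (\<lambda>(i, j). M i j) $$ (i, p i)))"
    by (rule det_def') auto
  also have "\<dots> = (\<Sum>p | p permutes {0..<k}. signof p * (\<Prod>i<k. M i (p i)))"
  proof (rule sum.cong)
    fix p assume "p \<in> {p. p permutes {0..<k}}"
    then have "p i < k" if "i < k" for i
      using permutes_in_image[of p "{0..<k}" i] that by auto
    then show "signof p * (\<Prod>i = 0..<k. mat k k (\<lambda>(i, j). M i j) $$ (i, p i)) =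
        signof p * (\<Prod>i<k. M i (p i))"
      by (simp add: lessThan_atLeast0)
  qed simp
  finally show ?thesis .
qed

text \<open>Each Leibniz term takes exactly one factor from every row, so a sum over independent
  choices of the parts \<open>g i\<close> can be carried out inside the determinant, row by
  row.\<close>

lemma det_sum_PiE:
  fixes w :: "nat \<Rightarrow> nat \<Rightarrow> 'a::comm_ring_1"
  assumes "\<And>i. finite (I i)"
  shows "(\<Sum>g\<in>PiE {..<k} I. (\<Prod>i<k. w i (g i)) * seqdet k \<psi> g) =
    det (mat k k (\<lambda>(i, j). \<Sum>r\<in>I i. w i r * \<psi> j r))"
proof -
  have "(\<Sum>g\<in>PiE {..<k} I. (\<Prod>i<k. w i (g i)) * seqdet k \<psi> g) =
     (\<Sum>g\<in>PiE {..<k} I. \<Sum>p | p permutes {0..<k}.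
        signof p * (\<Prod>i<k. w i (g i) * \<psi> (p i) (g i)))"
    by (simp add: seqdet_def det_mat_Leibniz sum_distrib_left prod.distrib mult_ac)
  also have "\<dots> = (\<Sum>p | p permutes {0..<k}. \<Sum>g\<in>PiE {..<k} I.
        signof p * (\<Prod>i<k. w i (g i) * \<psi> (p i) (g i)))"
    by (rule sum.swap)
  also have "\<dots> = (\<Sum>p | p permutes {0..<k}.
        signof p * (\<Prod>i<k. \<Sum>r\<in>I i. w i r * \<psi> (p i) r))"
    by (simp add: sum_distrib_left[symmetric] prod_sum_PiE assms)
  also have "\<dots> = det (mat k k (\<lambda>(i, j). \<Sum>r\<in>I i. w i r * \<psi> j r))"
    by (simp add: det_mat_Leibniz)
  finally show ?thesis .
qed

lemma seqdet_eq_0: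
  assumes "i < k" "i' < k" "i \<noteq> i'" "g i = g i'"
  shows "seqdet k \<psi> g = 0"
proof -
  have "row (mat k k (\<lambda>(i, j). \<psi> j (g i))) i = row (mat k k (\<lambda>(i, j). \<psi> j (g i))) i'"
    using assms by (intro eq_vecI) auto
  then show ?thesis
    unfolding seqdet_def by (rule det_identical_rows[OF _ assms(3,1,2), rotated]) simp
qed

lemma seqdet_cong:
  assumes "\<And>i j. i < k \<Longrightarrow> j < k \<Longrightarrow> \<psi> j (f i) = \<psi>' j (f' i)"
  shows "seqdet k \<psi> f = seqdet k \<psi>' f'"
proof -
  have "mat k k (\<lambda>(i, j). \<psi> j (f i)) = mat k k (\<lambda>(i, j). \<psi>' j (f' i))"
    using assms by (intro cong_mat) auto
  then show ?thesis by (simp only: seqdet_def)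
qed

text \<open>The change of all rows at once is left multiplication by an upper triangular matrix with
  ones on the diagonal.\<close>

lemma det_rows_sub:
  "det (mat k k (\<lambda>(i, j). M i j - \<alpha> i * (if Suc i < k then M (Suc i) j else 0))) =
   det (mat k k (\<lambda>(i, j). M i j))" (is "det ?L = det ?R")
proof -
  define U where "U = mat k k (\<lambda>(i, j). if j = i then 1 else if j = Suc i then - \<alpha> i else 0)"
  have U: "U \<in> carrier_mat k k" by (simp add: U_def)
  have "?L = U * ?R"
  proof (rule eq_matI)
    fix i j assume "i < dim_row (U * ?R)" "j < dim_col (U * ?R)"
    then have ij: "i < k" "j < k" by (auto simp: U_def)
    have "(U * ?R) $$ (i, j) =
       (\<Sum>l<k. (if l = i then 1 else if l = Suc i then - \<alpha> i else 0) * M l j)"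
      using ij by (simp add: U_def scalar_prod_def lessThan_atLeast0)
    also have "\<dots> = (\<Sum>l<k. (if l = i then M l j else 0) + (if l = Suc i then - \<alpha> i * M l j else 0))"
      by (intro sum.cong) auto
    also have "\<dots> = M i j - \<alpha> i * (if Suc i < k then M (Suc i) j else 0)"
      using ij by (simp add: sum.distrib)
    finally show "?L $$ (i, j) = (U * ?R) $$ (i, j)" using ij by simp
  qed (auto simp: U_def)
  moreover have "det U = 1"
  proof -
    have "upper_triangular U" by (auto simp: U_def)
    then have "det U = prod_list (diag_mat U)" using U by (rule det_upper_triangular)
    also have "diag_mat U = map (\<lambda>_. 1) [0..<k]" by (simp add: diag_mat_def U_def)
    finally show ?thesis by (simp add: map_replicate_const)
  qed
  ultimately show ?thesis using det_mult[OF U, of ?R] by simp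
qed

text \<open>Right multiplication by a lower triangular matrix with diagonal
  \<open>\<alpha> j\<close>, \<open>\<gamma>\<close> and last row \<open>\<beta> j\<close>. Nothing
  is divided, so the scalars may be arbitrary ring elements.\<close>

lemma det_cols_last:
  fixes M :: "nat \<Rightarrow> nat \<Rightarrow> 'a::comm_ring_1"
  shows "det (mat (Suc k) (Suc k) (\<lambda>(i, j). if j < k then \<alpha> j * M i j + \<beta> j * M i k else \<gamma> * M i k)) =
   (\<Prod>j<k. \<alpha> j) * \<gamma> * det (mat (Suc k) (Suc k) (\<lambda>(i, j). M i j))" (is "det ?L = _ * det ?R")
proof -
  define C where "C = mat (Suc k) (Suc k) (\<lambda>(i, j).
    if j = i then (if i < k then \<alpha> i else \<gamma>) else if i = k then \<beta> j else 0)"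
  have C: "C \<in> carrier_mat (Suc k) (Suc k)" by (simp add: C_def)
  have "?L = ?R * C"
  proof (rule eq_matI)
    fix i j assume "i < dim_row (?R * C)" "j < dim_col (?R * C)"
    then have ij: "i < Suc k" "j < Suc k" by (auto simp: C_def)
    have "(?R * C) $$ (i, j) = (\<Sum>l<Suc k. M i l *
        (if j = l then (if l < k then \<alpha> l else \<gamma>) else if l = k then \<beta> j else 0))"
      using ij by (simp add: C_def scalar_prod_def lessThan_atLeast0)
    also have "\<dots> = (\<Sum>l<k. (if j = l then M i l * \<alpha> l else 0)) +
        M i k * (if j = k then \<gamma> else \<beta> j)"
    proof -
      have "(\<Sum>l<k. M i l * (if j = l then (if l < k then \<alpha> l else \<gamma>) else if l = k then \<beta> j else 0)) =
          (\<Sum>l<k. (if j = l then M i l * \<alpha> l else 0))"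
        by (intro sum.cong) auto
      then show ?thesis by (simp add: lessThan_Suc)
    qed
    also have "\<dots> = (if j < k then \<alpha> j * M i j + \<beta> j * M i k else \<gamma> * M i k)"
      using ij by (auto simp: sum.delta' mult.commute)
    finally show "?L $$ (i, j) = (?R * C) $$ (i, j)" using ij by simp
  qed (auto simp: C_def)
  moreover have "det C = (\<Prod>j<k. \<alpha> j) * \<gamma>"
  proof -
    have "det C = prod_list (diag_mat C)"
      using C by (intro det_lower_triangular[of "Suc k"]) (auto simp: C_def)
    also have "diag_mat C = map (\<lambda>i. if i < k then \<alpha> i else \<gamma>) [0..<Suc k]"
      by (auto simp: diag_mat_def C_def)
    also have "prod_list \<dots> = (\<Prod>j<k. \<alpha> j) * \<gamma>"
      by (simp add: prod.distinct_set_conv_list[symmetric] atLeast0LessThan)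
    finally show ?thesis .
  qed
  ultimately show ?thesis using det_mult[OF _ C, of ?R] by (simp add: mult.commute)
qed

lemma det_last_col_unit:
  fixes M :: "nat \<Rightarrow> nat \<Rightarrow> 'a::comm_ring_1"
  assumes "\<And>i. i < k \<Longrightarrow> M i k = 0" "M k k = 1"
  shows "det (mat (Suc k) (Suc k) (\<lambda>(i, j). M i j)) = det (mat k k (\<lambda>(i, j). M i j))"
proof -
  let ?A = "mat (Suc k) (Suc k) (\<lambda>(i, j). M i j)"
  have "det ?A = (\<Sum>i<Suc k. ?A $$ (i, k) * cofactor ?A i k)"
    by (rule laplace_expansion_column) auto
  also have "\<dots> = cofactor ?A k k"
    using assms by (simp add: lessThan_Suc)
  also have "\<dots> = det (mat_delete ?A k k)"
    by (simp add: cofactor_def)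
  also have "mat_delete ?A k k = mat k k (\<lambda>(i, j). M i j)"
    by (rule eq_matI) (auto simp: mat_delete_def)
  finally show ?thesis .
qed

text \<open>Appending the indicator of the part \<open>0\<close> as last column lets a determinant
  for \<open>k\<close> parts be read as one for \<open>k + 1\<close> parts with one part
  \<open>0\<close>. A part can then leave through the left boundary while the size stays
  fixed.\<close>

definition extend_unit :: "nat \<Rightarrow> (nat \<Rightarrow> nat \<Rightarrow> 'a::comm_ring_1) \<Rightarrow> nat \<Rightarrow> nat \<Rightarrow> 'a" where
  "extend_unit k \<phi> j = (if j < k then \<phi> j else (\<lambda>q. if q = 0 then 1 else 0))"

lemma seqdet_last_unit:
  assumes "f k = 0" "\<And>i. i < k \<Longrightarrow> f i > 0"
  shows "seqdet (Suc k) (extend_unit k \<phi>) f = seqdet k \<phi> f"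
proof -
  have "seqdet (Suc k) (extend_unit k \<phi>) f = det (mat k k (\<lambda>(i, j). extend_unit k \<phi> j (f i)))"
    unfolding seqdet_def using assms by (intro det_last_col_unit) (auto simp: extend_unit_def)
  also have "\<dots> = seqdet k \<phi> f"
    unfolding seqdet_def by (intro arg_cong[of _ _ det] eq_matI) (auto simp: extend_unit_def)
  finally show ?thesis .
qed

lemma seqdet_last_zero:
  assumes "\<And>i. i \<le> k \<Longrightarrow> \<psi> k (f i) = 0"
  shows "seqdet (Suc k) \<psi> f = 0"
proof -
  have "seqdet (Suc k) \<psi> f = (\<Sum>i<Suc k. mat (Suc k) (Suc k) (\<lambda>(i, j). \<psi> j (f i)) $$ (i, k) *
      cofactor (mat (Suc k) (Suc k) (\<lambda>(i, j). \<psi> j (f i))) i k)"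
    unfolding seqdet_def by (rule laplace_expansion_column) auto
  also have "\<dots> = 0"
    using assms by (intro sum.neutral) auto
  finally show ?thesis .
qed

section \<open>Local weights of one row and their interval sums\<close>

text \<open>The weight of a part \<open>r\<close> lying between consecutive parts \<open>l \<le> q\<close> of the row above: \<open>b\<close> for
  staying at \<open>q\<close>, \<open>d\<close> for leaving through the left boundary (encoded by the part \<open>0\<close>). The value
  \<open>c - a * b\<close> at \<open>r = l\<close> is the free-fermion condition: it makes the interval sum of the weights
  equal to \<open>kern\<close> at \<open>q\<close> minus a multiple of \<open>kern\<close> at \<open>l\<close>, that is, a row operation.\<close>

definition stepw :: "'a::comm_ring_1 \<Rightarrow> 'a \<Rightarrow> 'a \<Rightarrow> 'a \<Rightarrow> nat \<Rightarrow> nat \<Rightarrow> nat \<Rightarrow> 'a" where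
  "stepw a b c d q l r =
     (if r = q then (if q = 0 then 1 else b)
      else if r = 0 then d * a ^ (q - 1)
      else if r = l then (c - a * b) * a ^ (q - r - 1)
      else c * a ^ (q - r - 1))"

text \<open>This is the sum of \<open>stepw a b c d q 0 r * \<psi> r\<close> over all
  \<open>r\<close> from \<open>0\<close> to \<open>q\<close>, a linear operator on sequences
  attached to one row.\<close>

definition kern :: "'a::comm_ring_1 \<Rightarrow> 'a \<Rightarrow> 'a \<Rightarrow> 'a \<Rightarrow> (nat \<Rightarrow> 'a) \<Rightarrow> nat \<Rightarrow> 'a" where
  "kern a b c d \<psi> q =
     (if q = 0 then \<psi> 0
      else b * \<psi> q + c * (\<Sum>p\<in>{1..<q}. a ^ (q - p - 1) * \<psi> p) + d * a ^ (q - 1) * \<psi> 0)"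

lemma kern_0 [simp]: "kern a b c d \<psi> 0 = \<psi> 0"
  by (simp add: kern_def)

lemma kern_1: "kern a b c d \<psi> (Suc 0) = b * \<psi> 1 + d * \<psi> 0"
  by (simp add: kern_def)

text \<open>Passing to \<open>Suc q\<close> multiplies the geometric and boundary terms by
  \<open>a\<close>. At \<open>0\<close> there is no boundary factor to multiply, and
  \<open>kern_1\<close> takes over.\<close>

lemma kern_Suc:
  assumes "q > 0"
  shows "kern a b c d \<psi> (Suc q) = a * kern a b c d \<psi> q + b * \<psi> (Suc q) + (c - a * b) * \<psi> q"
proof -
  obtain q' where q': "q = Suc q'" using assms by (cases q) auto
  have "(\<Sum>p\<in>{1..<Suc q}. a ^ (Suc q - p - 1) * \<psi> p) = (\<Sum>p\<in>{1..<q}. a ^ (Suc q - p - 1) * \<psi> p) + \<psi> q"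
    using assms by simp
  also have "(\<Sum>p\<in>{1..<q}. a ^ (Suc q - p - 1) * \<psi> p) = a * (\<Sum>p\<in>{1..<q}. a ^ (q - p - 1) * \<psi> p)"
    unfolding sum_distrib_left
  proof (rule sum.cong)
    fix p assume "p \<in> {1..<q}"
    then have "Suc q - p - 1 = Suc (q - p - 1)" by auto
    then show "a ^ (Suc q - p - 1) * \<psi> p = a * (a ^ (q - p - 1) * \<psi> p)" by (simp add: mult.assoc)
  qed simp
  finally have sm: "(\<Sum>p\<in>{1..<Suc q}. a ^ (Suc q - p - 1) * \<psi> p) =
      a * (\<Sum>p\<in>{1..<q}. a ^ (q - p - 1) * \<psi> p) + \<psi> q" .
  show ?thesis
    unfolding kern_def sm by (simp add: q' algebra_simps)
qed

text \<open>The terms of \<open>kern\<close> at \<open>q\<close> below index \<open>l\<close>,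
  including the boundary term, are \<open>a ^ (q - l)\<close> times those at \<open>l\<close>, so
  the subtraction removes them; at index \<open>l\<close> it turns the coefficient \<open>c\<close>
  into \<open>c - a * b\<close>.\<close>

lemma sum_stepw:
  assumes "l < q \<or> l = 0"
  shows "(\<Sum>r = l..q. stepw a b c d q l r * \<psi> r) =
    kern a b c d \<psi> q - (if l = 0 then 0 else a ^ (q - l)) * kern a b c d \<psi> l"
proof (cases "q = 0")
  case True
  then show ?thesis using assms by (simp add: stepw_def)
next
  case q: False
  then have lq: "l < q" using assms by auto
  have "{l..q} = insert q (insert l {Suc l..<q})" using lq by auto
  then have "(\<Sum>r = l..q. stepw a b c d q l r * \<psi> r) =
     b * \<psi> q + stepw a b c d q l l * \<psi> l + (\<Sum>r = Suc l..<q. stepw a b c d q l r * \<psi> r)"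
    using lq by (simp add: stepw_def)
  also have "(\<Sum>r = Suc l..<q. stepw a b c d q l r * \<psi> r) =
      c * (\<Sum>r = Suc l..<q. a ^ (q - r - 1) * \<psi> r)"
    unfolding sum_distrib_left by (intro sum.cong) (auto simp: stepw_def mult.assoc)
  finally have 1: "(\<Sum>r = l..q. stepw a b c d q l r * \<psi> r) = b * \<psi> q + stepw a b c d q l l * \<psi> l +
      c * (\<Sum>r = Suc l..<q. a ^ (q - r - 1) * \<psi> r)" .
  show ?thesis
  proof (cases "l = 0")
    case True
    then show ?thesis unfolding 1 using q by (simp add: stepw_def kern_def)
  next
    case l: False
    have "{1..<q} = {1..<l} \<union> insert l {Suc l..<q}" using l lq by auto
    then have "(\<Sum>p\<in>{1..<q}. a ^ (q - p - 1) * \<psi> p) = (\<Sum>p\<in>{1..<l}. a ^ (q - p - 1) * \<psi> p) +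
        (a ^ (q - l - 1) * \<psi> l + (\<Sum>r = Suc l..<q. a ^ (q - r - 1) * \<psi> r))"
      by (simp add: sum.union_disjoint)
    also have "(\<Sum>p\<in>{1..<l}. a ^ (q - p - 1) * \<psi> p) =
        a ^ (q - l) * (\<Sum>p\<in>{1..<l}. a ^ (l - p - 1) * \<psi> p)"
      unfolding sum_distrib_left
    proof (rule sum.cong)
      fix p assume "p \<in> {1..<l}"
      then have "q - p - 1 = (q - l) + (l - p - 1)" using lq by auto
      then show "a ^ (q - p - 1) * \<psi> p = a ^ (q - l) * (a ^ (l - p - 1) * \<psi> p)"
        by (simp add: power_add mult.assoc)
    qed simp
    finally have 2: "(\<Sum>p\<in>{1..<q}. a ^ (q - p - 1) * \<psi> p) =
        a ^ (q - l) * (\<Sum>p\<in>{1..<l}. a ^ (l - p - 1) * \<psi> p) +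
        (a ^ (q - l - 1) * \<psi> l + (\<Sum>r = Suc l..<q. a ^ (q - r - 1) * \<psi> r))" .
    have 3: "a ^ (q - 1) = a ^ (q - l) * a ^ (l - 1)"
      using l lq by (simp flip: power_add)
    define P where "P = a ^ (q - l - 1)"
    have 4: "a ^ (q - l) = a * P"
      using lq by (simp add: P_def flip: power_Suc) (simp add: Suc_diff_Suc)
    have w: "stepw a b c d q l l = (c - a * b) * P"
      using l lq by (simp add: stepw_def P_def)
    show ?thesis unfolding 1 w
      using l q unfolding kern_def 2[folded P_def] 3 4 by (simp add: algebra_simps)
  qed
qed

text \<open>Zeros may repeat at the end, so sets with fewer than \<open>k\<close> elements are
  covered; the value \<open>0\<close> at index \<open>k\<close> closes the last interval.\<close>

definition dec_seq :: "nat \<Rightarrow> (nat \<Rightarrow> nat) \<Rightarrow> bool" where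
  "dec_seq k f \<longleftrightarrow> (\<forall>i<k. f (Suc i) < f i \<or> f (Suc i) = 0) \<and> f k = 0"

text \<open>The terms of an interlacing sum with a repeated part vanish with the determinant, so that
  the summation range may be taken to be a product of intervals.\<close>
theorem interlacing_sum:
  assumes "dec_seq k f"
  shows "(\<Sum>g\<in>PiE {..<k} (\<lambda>i. {f (Suc i)..f i}).
      (\<Prod>i<k. stepw a b c d (f i) (f (Suc i)) (g i)) * seqdet k \<psi> g) =
    seqdet k (\<lambda>j. kern a b c d (\<psi> j)) f"
proof -
  \<comment> \<open>The multiplier from \<open>sum_stepw\<close>; it is \<open>0\<close> when the
    interval reaches down to \<open>0\<close>, where nothing is subtracted.\<close>
  define \<alpha> where "\<alpha> i = (if f (Suc i) = 0 then 0 else a ^ (f i - f (Suc i)))" for i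
  have "(\<Sum>g\<in>PiE {..<k} (\<lambda>i. {f (Suc i)..f i}).
      (\<Prod>i<k. stepw a b c d (f i) (f (Suc i)) (g i)) * seqdet k \<psi> g) =
     det (mat k k (\<lambda>(i, j). \<Sum>r = f (Suc i)..f i. stepw a b c d (f i) (f (Suc i)) r * \<psi> j r))"
    by (rule det_sum_PiE) simp
  also have "\<dots> = det (mat k k (\<lambda>(i, j). kern a b c d (\<psi> j) (f i) -
      \<alpha> i * (if Suc i < k then kern a b c d (\<psi> j) (f (Suc i)) else 0)))"
  proof (intro arg_cong[of _ _ det] cong_mat refl, unfold split_conv)
    fix i j assume ij: "i < k" "j < k"
    have "f (Suc i) < f i \<or> f (Suc i) = 0" using assms ij by (auto simp: dec_seq_def)
    note sum_stepw[OF this, of a b c d "\<psi> j"]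
    \<comment> \<open>The last row has no successor, in agreement with its interval ending at
      \<open>f k = 0\<close>.\<close>
    moreover have "f (Suc i) = 0" if "\<not> Suc i < k"
      using assms ij that by (auto simp: dec_seq_def not_less dest: le_antisym)
    ultimately show "(\<Sum>r = f (Suc i)..f i. stepw a b c d (f i) (f (Suc i)) r * \<psi> j r) =
       kern a b c d (\<psi> j) (f i) - \<alpha> i * (if Suc i < k then kern a b c d (\<psi> j) (f (Suc i)) else 0)"
      by (auto simp: \<alpha>_def)
  qed
  also have "\<dots> = seqdet k (\<lambda>j. kern a b c d (\<psi> j)) f"
    unfolding seqdet_def by (rule det_rows_sub)
  finally show ?thesis .
qed

section \<open>The symplectic alternants\<close>

text \<open>The quotient of \<open>x ^ q - y ^ q\<close> by \<open>x - y\<close>, written without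
  division.\<close>

definition usum :: "'a::comm_ring_1 \<Rightarrow> 'a \<Rightarrow> nat \<Rightarrow> 'a" where
  "usum x y q = (\<Sum>i<q. x ^ i * y ^ (q - 1 - i))"

lemma usum_0 [simp]: "usum x y 0 = 0"
  by (simp add: usum_def)

lemma usum_Suc: "usum x y (Suc q) = y * usum x y q + x ^ q"
proof -
  have "(\<Sum>i<q. x ^ i * y ^ (q - i)) = y * (\<Sum>i<q. x ^ i * y ^ (q - 1 - i))"
    unfolding sum_distrib_left
  proof (rule sum.cong)
    fix i assume "i \<in> {..<q}"
    then have "q - i = Suc (q - 1 - i)" by auto
    then show "x ^ i * y ^ (q - i) = y * (x ^ i * y ^ (q - 1 - i))" by simp
  qed simp
  then show ?thesis by (simp add: usum_def lessThan_Suc)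
qed

lemma usum_1 [simp]: "usum x y (Suc 0) = 1"
  by (simp add: usum_Suc)

lemma usum_Suc': "usum x y (Suc q) = x * usum x y q + y ^ q"
proof (induction q)
  case (Suc q)
  have "usum x y (Suc (Suc q)) = y * usum x y (Suc q) + x ^ Suc q" by (rule usum_Suc)
  also have "\<dots> = y * (x * usum x y q + y ^ q) + x ^ Suc q" by (simp only: Suc)
  also have "\<dots> = x * (y * usum x y q + x ^ q) + y ^ Suc q" by (simp add: algebra_simps)
  finally show ?case by (simp only: usum_Suc[symmetric])
qed simp

lemma usum_rec: "usum x y (Suc (Suc q)) = (x + y) * usum x y (Suc q) - x * y * usum x y q"
  by (simp add: usum_Suc[of x y "Suc q"] usum_Suc algebra_simps)

text \<open>With S the backward shift, (1 - \<tau> e S)(1 - x S) \<Phi> = (1 + \<tau> x S)(1 + e S)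
  \<phi>. Both sides of the claim satisfy the same inhomogeneous recurrence, with characteristic
  roots \<open>x\<close> and \<open>\<tau> * e\<close>. Their product is \<open>\<tau> ^ 2\<close>,
  as in the recurrence of \<phi>, so the two recurrences differ only in the middle coefficient, and
  this difference is the factor on the left.\<close>

lemma kern_ice:
  fixes x e \<tau> C :: "'a::comm_ring_1"
  assumes "x * e = \<tau>" "\<phi> 0 = 0" "\<phi> (Suc 0) = 1"
    and rec: "\<And>q. \<phi> (Suc (Suc q)) = C * \<phi> (Suc q) - \<tau> ^ 2 * \<phi> q"
  defines "\<Phi> \<equiv> kern x 1 ((1 + \<tau>) * x) x (kern (\<tau> * e) 1 ((1 + \<tau>) * e) e \<phi>)"
  shows "(C - (x + \<tau> * e)) * \<Phi> q = (C + \<tau> * x + e) * \<phi> q - (1 + \<tau>) * (x + e) * usum x (\<tau> * e) q"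
proof -
  define \<psi> where "\<psi> = kern (\<tau> * e) 1 ((1 + \<tau>) * e) e \<phi>"
  have \<psi>0: "\<psi> 0 = 0" by (simp add: \<psi>_def assms)
  \<comment> \<open>The value \<open>\<phi> 0 = 0\<close> extends the recurrence of
    \<open>kern_Suc\<close> down to \<open>q = 0\<close>.\<close>
  have \<psi>S: "\<psi> (Suc q) = \<tau> * e * \<psi> q + \<phi> (Suc q) + e * \<phi> q" for q
    by (cases "q = 0") (auto simp: \<psi>_def kern_Suc kern_1 assms algebra_simps)
  have \<Phi>\<psi>: "\<Phi> = kern x 1 ((1 + \<tau>) * x) x \<psi>" by (simp only: \<Phi>_def \<psi>_def)
  have \<Phi>0: "\<Phi> 0 = 0" by (simp add: \<Phi>_def assms)
  have \<Phi>S: "\<Phi> (Suc q) = x * \<Phi> q + \<psi> (Suc q) + \<tau> * x * \<psi> q" for q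
    by (cases "q = 0") (auto simp: \<Phi>\<psi> kern_Suc kern_1 \<psi>0 algebra_simps)
  \<comment> \<open>After elimination of \<psi> the terms
    \<open>\<phi> (Suc (Suc q)) + \<tau> ^ 2 * \<phi> q\<close> combine to
    \<open>C * \<phi> (Suc q)\<close>, which leaves a single forcing term.\<close>
  have \<Phi>SS: "\<Phi> (Suc (Suc q)) = (x + \<tau> * e) * \<Phi> (Suc q) - \<tau> ^ 2 * \<Phi> q + (C + \<tau> * x + e) * \<phi> (Suc q)" for q
    unfolding \<Phi>S[of "Suc q"] \<Phi>S[of q] \<psi>S[of "Suc q"] \<psi>S[of q] rec assms(1)[symmetric]
    by (simp add: algebra_simps power2_eq_square)
  show ?thesis
  proof (induction q rule: induct_nat_012)
    case 0
    then show ?case by (simp add: \<Phi>0 assms)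
  next
    case 1
    then show ?case by (simp add: \<Phi>S \<Phi>0 \<psi>S \<psi>0 assms(2,3) algebra_simps)
  next
    case (ge2 q)
    have "(C - (x + \<tau> * e)) * \<Phi> (Suc (Suc q)) =
      (x + \<tau> * e) * ((C - (x + \<tau> * e)) * \<Phi> (Suc q)) - \<tau> ^ 2 * ((C - (x + \<tau> * e)) * \<Phi> q) +
      (C - (x + \<tau> * e)) * (C + \<tau> * x + e) * \<phi> (Suc q)"
      unfolding \<Phi>SS by (simp add: algebra_simps)
    also have "\<dots> = (C + \<tau> * x + e) * \<phi> (Suc (Suc q)) - (1 + \<tau>) * (x + e) * usum x (\<tau> * e) (Suc (Suc q))"
      unfolding ge2 unfolding rec usum_rec assms(1)[symmetric] by (simp add: algebra_simps power2_eq_square)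
    finally show ?case .
  qed
qed

text \<open>The indicator of \<open>0\<close> enters only through the boundary term and becomes a
  geometric sequence with ratio \<open>\<tau> * e\<close>, which the second kernel combines with
  powers of \<open>x\<close>. The factor \<open>x + e\<close> is the factor of \<open>D_sp\<close>
  that involves one variable only.\<close>

lemma kern_ice_unit:
  fixes x e \<tau> :: "'a::comm_ring_1"
  assumes "x * e = \<tau>"
  defines "\<Phi> \<equiv> kern x 1 ((1 + \<tau>) * x) x (kern (\<tau> * e) 1 ((1 + \<tau>) * e) e (\<lambda>q. if q = 0 then 1 else 0))"
  shows "\<Phi> (Suc q) = (x + e) * usum x (\<tau> * e) (Suc q)"
proof -
  define \<psi> where "\<psi> = kern (\<tau> * e) 1 ((1 + \<tau>) * e) e (\<lambda>q. if q = 0 then 1 else 0)"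
  have \<Phi>\<psi>: "\<Phi> = kern x 1 ((1 + \<tau>) * x) x \<psi>" by (simp only: \<Phi>_def \<psi>_def)
  have \<psi>: "\<psi> (Suc q) = e * (\<tau> * e) ^ q" for q
    by (simp add: \<psi>_def kern_def mult.commute)
  have \<psi>0: "\<psi> 0 = 1" by (simp add: \<psi>_def)
  show ?thesis
  proof (induction q)
    case 0
    then show ?case by (simp add: \<Phi>\<psi> kern_1 \<psi>0 \<psi>[of 0, simplified])
  next
    case (Suc q)
    have "\<Phi> (Suc (Suc q)) = x * \<Phi> (Suc q) + \<psi> (Suc (Suc q)) + \<tau> * x * \<psi> (Suc q)"
      by (simp add: \<Phi>\<psi> kern_Suc algebra_simps)
    also have "\<dots> = (x + e) * (x * usum x (\<tau> * e) (Suc q) + (\<tau> * e) ^ Suc q)"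
      unfolding Suc \<psi> assms(1)[symmetric] by (simp add: algebra_simps power2_eq_square)
    finally show ?case by (simp only: usum_Suc'[symmetric])
  qed
qed

text \<open>As in \<open>kern_ice\<close>, now with (1 - y S)(1 - x S) \<Phi> = S \<phi>, so the
  forcing term has coefficient \<open>1\<close>. The delay S comes from \<open>b = 0\<close> in the
  inner kernel.\<close>

lemma kern_tableau:
  fixes x y C :: "'a::comm_ring_1"
  assumes "\<phi> 0 = 0" "\<phi> (Suc 0) = 1"
    and rec: "\<And>q. \<phi> (Suc (Suc q)) = C * \<phi> (Suc q) - x * y * \<phi> q"
  defines "\<Phi> \<equiv> kern x 1 x 0 (kern y 0 1 1 \<phi>)"
  shows "(C - (x + y)) * \<Phi> q = \<phi> q - usum x y q"
proof -
  define \<psi> where "\<psi> = kern y 0 1 1 \<phi>"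
  have \<psi>0: "\<psi> 0 = 0" by (simp add: \<psi>_def assms)
  have \<psi>S: "\<psi> (Suc q) = y * \<psi> q + \<phi> q" for q
    by (cases "q = 0") (auto simp: \<psi>_def kern_Suc kern_1 assms algebra_simps)
  have \<Phi>\<psi>: "\<Phi> = kern x 1 x 0 \<psi>" by (simp only: \<Phi>_def \<psi>_def)
  have \<Phi>0: "\<Phi> 0 = 0" by (simp add: \<Phi>_def assms)
  have \<Phi>S: "\<Phi> (Suc q) = x * \<Phi> q + \<psi> (Suc q)" for q
    by (cases "q = 0") (auto simp: \<Phi>\<psi> kern_Suc kern_1 \<psi>0 algebra_simps)
  have \<Phi>SS: "\<Phi> (Suc (Suc q)) = (x + y) * \<Phi> (Suc q) - x * y * \<Phi> q + \<phi> (Suc q)" for q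
    unfolding \<Phi>S[of "Suc q"] \<Phi>S[of q] \<psi>S[of "Suc q"] \<psi>S[of q]
    by (simp add: algebra_simps)
  show ?thesis
  proof (induction q rule: induct_nat_012)
    case 0
    then show ?case by (simp add: \<Phi>0 assms)
  next
    case 1
    then show ?case by (simp add: \<Phi>S \<Phi>0 \<psi>S \<psi>0 assms(1,2) algebra_simps)
  next
    case (ge2 q)
    have "(C - (x + y)) * \<Phi> (Suc (Suc q)) =
      (x + y) * ((C - (x + y)) * \<Phi> (Suc q)) - x * y * ((C - (x + y)) * \<Phi> q) +
      (C - (x + y)) * \<phi> (Suc q)"
      unfolding \<Phi>SS by (simp add: algebra_simps)
    also have "\<dots> = \<phi> (Suc (Suc q)) - usum x y (Suc (Suc q))"
      unfolding ge2 unfolding rec usum_rec by (simp add: algebra_simps)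
    finally show ?case .
  qed
qed

lemma kern_tableau_unit:
  fixes x y :: "'a::comm_ring_1"
  defines "\<Phi> \<equiv> kern x 1 x 0 (kern y 0 1 1 (\<lambda>q. if q = 0 then 1 else 0))"
  shows "\<Phi> (Suc q) = usum x y (Suc q)"
proof -
  define \<psi> where "\<psi> = kern y 0 1 1 (\<lambda>q. if q = 0 then 1 else 0 :: 'a)"
  have \<Phi>\<psi>: "\<Phi> = kern x 1 x 0 \<psi>" by (simp only: \<Phi>_def \<psi>_def)
  have \<psi>: "\<psi> (Suc q) = y ^ q" for q
    by (simp add: \<psi>_def kern_def)
  show ?thesis
  proof (induction q)
    case 0
    then show ?case by (simp add: \<Phi>\<psi> kern_1 \<psi>[of 0, simplified])
  next
    case (Suc q)
    have "\<Phi> (Suc (Suc q)) = x * \<Phi> (Suc q) + \<psi> (Suc (Suc q))"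
      by (simp add: \<Phi>\<psi> kern_Suc algebra_simps)
    also have "\<dots> = x * usum x y (Suc q) + y ^ Suc q"
      unfolding Suc \<psi> ..
    finally show ?case by (simp only: usum_Suc'[symmetric])
  qed
qed

text \<open>For \<open>y j\<close> inverse to \<open>x j\<close> this is the numerator of the
  symplectic Weyl character formula, with the factors \<open>x j - y j\<close> divided out of the
  columns.\<close>

definition alternant :: "nat \<Rightarrow> (nat \<Rightarrow> 'a::comm_ring_1) \<Rightarrow> (nat \<Rightarrow> 'a) \<Rightarrow> (nat \<Rightarrow> nat) \<Rightarrow> 'a" where
  "alternant k x y f = seqdet k (\<lambda>j. usum (x j) (y j)) f"

lemma seqdet_cols_last:
  assumes "\<And>i j. i \<le> k \<Longrightarrow> j < k \<Longrightarrow> v j * \<Phi> j (f i) = \<alpha> j * \<psi> j (f i) + \<beta> j * \<psi> k (f i)"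
    and "\<And>i. i \<le> k \<Longrightarrow> \<Phi> k (f i) = \<gamma> * \<psi> k (f i)"
  shows "(\<Prod>j<k. v j) * seqdet (Suc k) \<Phi> f = (\<Prod>j<k. \<alpha> j) * \<gamma> * seqdet (Suc k) \<psi> f"
proof -
  have "(\<Prod>j<k. v j) * seqdet (Suc k) \<Phi> f = det (mat (Suc k) (Suc k)
      (\<lambda>(i, j). if j < k then v j * \<Phi> j (f i) + 0 * \<Phi> k (f i) else 1 * \<Phi> k (f i)))"
    \<comment> \<open>\<open>det_cols_last\<close> with \<open>\<beta> = 0\<close> and
      \<open>\<gamma> = 1\<close> moves the factors \<open>v j\<close> into the columns.\<close>
    unfolding seqdet_def by (subst det_cols_last) simp
  also have "\<dots> = det (mat (Suc k) (Suc k)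
      (\<lambda>(i, j). if j < k then \<alpha> j * \<psi> j (f i) + \<beta> j * \<psi> k (f i) else \<gamma> * \<psi> k (f i)))"
    by (intro arg_cong[of _ _ det] cong_mat refl) (auto simp: assms)
  also have "\<dots> = (\<Prod>j<k. \<alpha> j) * \<gamma> * seqdet (Suc k) \<psi> f"
    unfolding seqdet_def by (rule det_cols_last)
  finally show ?thesis .
qed

text \<open>By \<open>kern_ice\<close> every column \<open>j < k\<close> is a combination of the
  \<open>usum\<close> columns \<open>j\<close> and \<open>k\<close>, and by
  \<open>kern_ice_unit\<close> the appended column is a multiple of the \<open>usum\<close> column
  \<open>k\<close>. Column operations remove the admixture.\<close>

lemma alternant_ice:
  fixes x e :: "nat \<Rightarrow> 'a::comm_ring_1"
  assumes xe: "\<And>j. j \<le> k \<Longrightarrow> x j * e j = \<tau>"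
    and pos: "\<And>i. i \<le> k \<Longrightarrow> f i > 0"
  defines "y \<equiv> \<lambda>j. \<tau> * e j"
  shows "(\<Prod>j<k. (x j + y j) - (x k + y k)) *
      seqdet (Suc k) (\<lambda>j. kern (x k) 1 ((1 + \<tau>) * x k) (x k)
        (kern (\<tau> * e k) 1 ((1 + \<tau>) * e k) (e k) (extend_unit k (\<lambda>j. usum (x j) (y j)) j))) f =
    (\<Prod>j<k. (x j + y j) + \<tau> * x k + e k) * (x k + e k) * alternant (Suc k) x y f"
  unfolding alternant_def
proof (rule seqdet_cols_last[where \<beta> = "\<lambda>_. - ((1 + \<tau>) * (x k + e k))"])
  fix i j assume ij: "i \<le> k" "j < k"
  have "x j * y j = \<tau> ^ 2"
    using xe[of j] ij unfolding y_def by (metis less_imp_le mult.left_commute power2_eq_square)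
  then show "((x j + y j) - (x k + y k)) * kern (x k) 1 ((1 + \<tau>) * x k) (x k)
        (kern (\<tau> * e k) 1 ((1 + \<tau>) * e k) (e k) (extend_unit k (\<lambda>j. usum (x j) (y j)) j)) (f i) =
       ((x j + y j) + \<tau> * x k + e k) * usum (x j) (y j) (f i) +
       - ((1 + \<tau>) * (x k + e k)) * usum (x k) (y k) (f i)"
    using ij kern_ice[OF xe[of k], of "usum (x j) (y j)" "x j + y j" "f i"]
    by (simp add: extend_unit_def usum_rec y_def)
next
  fix i assume "i \<le> k"
  then obtain q where "f i = Suc q" using pos[of i] by (cases "f i") auto
  then show "kern (x k) 1 ((1 + \<tau>) * x k) (x k)
        (kern (\<tau> * e k) 1 ((1 + \<tau>) * e k) (e k) (extend_unit k (\<lambda>j. usum (x j) (y j)) k)) (f i) =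
       (x k + e k) * usum (x k) (y k) (f i)"
    using kern_ice_unit[OF xe[of k], of q] by (simp add: extend_unit_def y_def)
qed

lemma alternant_tableau:
  fixes x y :: "nat \<Rightarrow> 'a::comm_ring_1"
  assumes xy: "\<And>j. j \<le> k \<Longrightarrow> x j * y j = \<sigma>"
    and pos: "\<And>i. i \<le> k \<Longrightarrow> f i > 0"
  shows "(\<Prod>j<k. (x j + y j) - (x k + y k)) *
      seqdet (Suc k) (\<lambda>j. kern (x k) 1 (x k) 0 (kern (y k) 0 1 1
        (extend_unit k (\<lambda>j. usum (x j) (y j)) j))) f =
    alternant (Suc k) x y f"
proof -
  have "(\<Prod>j<k. (x j + y j) - (x k + y k)) *
      seqdet (Suc k) (\<lambda>j. kern (x k) 1 (x k) 0 (kern (y k) 0 1 1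
        (extend_unit k (\<lambda>j. usum (x j) (y j)) j))) f =
    (\<Prod>j<k. 1) * 1 * alternant (Suc k) x y f"
    unfolding alternant_def
  proof (rule seqdet_cols_last[where \<beta> = "\<lambda>_. - 1"])
    fix i j assume ij: "i \<le> k" "j < k"
    have "x j * y j = x k * y k"
      using xy ij by simp
    then show "((x j + y j) - (x k + y k)) * kern (x k) 1 (x k) 0 (kern (y k) 0 1 1
          (extend_unit k (\<lambda>j. usum (x j) (y j)) j)) (f i) =
         1 * usum (x j) (y j) (f i) + - 1 * usum (x k) (y k) (f i)"
      using ij kern_tableau[of "usum (x j) (y j)" "x j + y j" "x k" "y k" "f i"]
      by (simp add: extend_unit_def usum_rec)
  next
    fix i assume "i \<le> k"
    then obtain q where "f i = Suc q" using pos[of i] by (cases "f i") auto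
    then show "kern (x k) 1 (x k) 0 (kern (y k) 0 1 1
          (extend_unit k (\<lambda>j. usum (x j) (y j)) k)) (f i) = 1 * usum (x k) (y k) (f i)"
      using kern_tableau_unit[of "x k" "y k" q] by (simp add: extend_unit_def)
  qed
  then show ?thesis by simp
qed

section \<open>Decreasing enumerations and interlacing sets\<close>

text \<open>Partial row sums of a matrix are differences of these counts, while the determinants
  need the decreasing enumeration \<open>dseq\<close>.\<close>

definition ncard :: "nat set \<Rightarrow> nat \<Rightarrow> nat" where
  "ncard S p = card {s \<in> S. p \<le> s}"

text \<open>The elements of \<open>S\<close> in decreasing order, followed by zeros.\<close>

definition dseq :: "nat set \<Rightarrow> nat \<Rightarrow> nat" where
  "dseq S i = card {p. 1 \<le> p \<and> i < ncard S p}"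

lemma ncard_antimono: "finite S \<Longrightarrow> p \<le> q \<Longrightarrow> ncard S q \<le> ncard S p"
  unfolding ncard_def by (rule card_mono) auto

lemma ncard_rec: "finite S \<Longrightarrow> ncard S p = ncard S (Suc p) + (if p \<in> S then 1 else 0)"
proof -
  assume S: "finite S"
  have "{s \<in> S. p \<le> s} = (if p \<in> S then {p} else {}) \<union> {s \<in> S. Suc p \<le> s}"
    by (auto simp: Suc_le_eq le_less)
  then show ?thesis using S unfolding ncard_def by auto
qed

lemma ncard_1: "0 \<notin> S \<Longrightarrow> ncard S (Suc 0) = card S"
proof -
  assume "0 \<notin> S"
  then have "{s \<in> S. Suc 0 \<le> s} = S" by (auto simp: Suc_le_eq) (metis neq0_conv)
  then show ?thesis by (simp add: ncard_def)
qed

lemma ncard_outside: "S \<subseteq> {1..m} \<Longrightarrow> m < p \<Longrightarrow> ncard S p = 0"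
proof -
  assume "S \<subseteq> {1..m}" "m < p"
  then have "{s \<in> S. p \<le> s} = {}" by fastforce
  then show ?thesis unfolding ncard_def by (simp only: card.empty)
qed

text \<open>Such a \<open>P\<close> is the interval \<open>{1..card P}\<close>. This turns the
  cardinalities that define \<open>dseq\<close> and \<open>tab_chain\<close> into threshold
  conditions.\<close>

lemma mem_initial_segment:
  fixes P :: "nat set"
  assumes "finite P" "\<And>p q. p \<in> P \<Longrightarrow> q \<le> p \<Longrightarrow> 1 \<le> q \<Longrightarrow> q \<in> P" "1 \<le> p" "0 \<notin> P"
  shows "p \<le> card P \<longleftrightarrow> p \<in> P"
proof
  assume "p \<in> P"
  then have "{1..p} \<subseteq> P" using assms(2) by auto
  then have "card {1..p} \<le> card P" using assms(1) by (rule card_mono[rotated])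
  then show "p \<le> card P" by simp
next
  assume le: "p \<le> card P"
  show "p \<in> P"
  proof (rule ccontr)
    assume "p \<notin> P"
    then have "q < p" if "q \<in> P" for q
      using assms(2)[OF that, of p] assms(3) by (meson not_le)
    then have "P \<subseteq> {1..<p}" using assms(4) by (auto simp: Suc_le_eq) (metis neq0_conv)
    then have "card P \<le> card {1..<p}" by (rule card_mono[rotated]) simp
    then show False using le assms(3) by simp
  qed
qed

text \<open>\<open>dseq S\<close> and \<open>ncard S\<close> are conjugate as partitions: the
  \<open>p\<close> with more than \<open>i\<close> elements of \<open>S\<close> at or beyond them
  form an initial segment of length \<open>dseq S i\<close>.\<close>

lemma le_dseq_iff:
  assumes "finite S" "1 \<le> p"
  shows "p \<le> dseq S i \<longleftrightarrow> i < ncard S p"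
proof -
  let ?P = "{p. 1 \<le> p \<and> i < ncard S p}"
  have "?P \<subseteq> (\<Union>s\<in>S. {..s})"
  proof
    fix p assume "p \<in> ?P"
    then have "{s \<in> S. p \<le> s} \<noteq> {}" by (intro notI) (simp add: ncard_def)
    then show "p \<in> (\<Union>s\<in>S. {..s})" by auto
  qed
  then have "finite ?P" by (rule finite_subset) (use assms(1) in simp)
  moreover have "q \<in> ?P" if "p \<in> ?P" "q \<le> p" "1 \<le> q" for p q
    using that ncard_antimono[OF assms(1) that(2)] by auto
  ultimately have "p \<le> card ?P \<longleftrightarrow> p \<in> ?P"
    by (rule mem_initial_segment[OF _ _ assms(2)]) simp_all
  then show ?thesis using assms(2) by (simp add: dseq_def)
qed

lemma dseq_eq_iff:
  assumes "finite S" "1 \<le> q"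
  shows "dseq S i = q \<longleftrightarrow> q \<in> S \<and> i = ncard S (Suc q)"
proof -
  have "dseq S i = q \<longleftrightarrow> q \<le> dseq S i \<and> \<not> Suc q \<le> dseq S i" by auto
  also have "\<dots> \<longleftrightarrow> q \<in> S \<and> i = ncard S (Suc q)"
    unfolding le_dseq_iff[OF assms] le_dseq_iff[OF assms(1), of "Suc q", simplified]
    using ncard_rec[OF assms(1), of q] by auto
  finally show ?thesis .
qed

lemma dseq_pos_iff:
  assumes "finite S" "0 \<notin> S"
  shows "0 < dseq S i \<longleftrightarrow> i < card S"
  using le_dseq_iff[OF assms(1), of 1 i] ncard_1[OF assms(2)] by (auto simp: Suc_le_eq)

lemma dseq_Suc:
  assumes "finite S"
  shows "dseq S (Suc i) < dseq S i \<or> dseq S (Suc i) = 0"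
proof (cases "dseq S (Suc i) = 0")
  case False
  then have 1: "1 \<le> dseq S (Suc i)" by simp
  have "Suc i < ncard S (dseq S (Suc i))"
    using le_dseq_iff[OF assms 1, of "Suc i"] by simp
  then have "dseq S (Suc i) \<le> dseq S i"
    using le_dseq_iff[OF assms 1, of i] by simp
  moreover have "dseq S (Suc i) \<noteq> dseq S i"
    using dseq_eq_iff[OF assms 1, of "Suc i"] dseq_eq_iff[OF assms 1, of i] by auto
  ultimately show ?thesis by simp
qed simp

lemma dec_seq_dseq:
  assumes "finite S" "0 \<notin> S" "card S \<le> k"
  shows "dec_seq k (dseq S)"
  using assms dseq_Suc dseq_pos_iff[of S k] unfolding dec_seq_def by auto

lemma set_eq_dseq_image:
  assumes "finite S" "0 \<notin> S" "card S \<le> k"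
  shows "S = dseq S ` {..<k} - {0}"
proof (intro equalityI subsetI)
  fix q assume q: "q \<in> S"
  then have "1 \<le> q" using assms(2) by (cases q) auto
  then have *: "dseq S (ncard S (Suc q)) = q" using dseq_eq_iff[OF assms(1)] q by blast
  then have "ncard S (Suc q) < card S" using dseq_pos_iff[OF assms(1,2), of "ncard S (Suc q)"] \<open>1 \<le> q\<close> by simp
  then show "q \<in> dseq S ` {..<k} - {0}" using * assms(3) \<open>1 \<le> q\<close>
    by (intro DiffI image_eqI[of _ _ "ncard S (Suc q)"]) auto
next
  fix q assume "q \<in> dseq S ` {..<k} - {0}"
  then obtain i where "dseq S i = q" "1 \<le> q" by (auto simp: Suc_le_eq)
  then show "q \<in> S" using dseq_eq_iff[OF assms(1)] by blast
qed

text \<open>Both sequences have the same thresholds: for positive \<open>p\<close> the indices with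
  \<open>p \<le> f i\<close> form an initial segment on which \<open>f\<close> is injective.\<close>

lemma dseq_of_dec_seq:
  assumes f: "dec_seq k f" and i: "i < k"
  shows "dseq (f ` {..<k} - {0}) i = f i"
proof -
  let ?S = "f ` {..<k} - {0}"
  have step: "f (Suc i) < f i \<or> f (Suc i) = 0" if "i < k" for i
    using f that by (auto simp: dec_seq_def)
  have anti: "f j < f i \<or> f j = 0" if "i < j" "j < k" for i j
    using that
  proof (induction rule: strict_inc_induct)
    case (base i)
    then show ?case using step[of i] by auto
  next
    case (step i)
    then show ?case using \<open>\<And>i. i < k \<Longrightarrow> f (Suc i) < f i \<or> f (Suc i) = 0\<close>[of i] by auto
  qed
  have nc: "ncard ?S p = card {i. i < k \<and> p \<le> f i}" if "1 \<le> p" for p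
  proof -
    have "{s \<in> ?S. p \<le> s} = f ` {i. i < k \<and> p \<le> f i}" using that by auto
    moreover have "inj_on f {i. i < k \<and> p \<le> f i}"
      by (rule inj_onI) (metis (mono_tags, lifting) anti le_zero_eq less_irrefl mem_Collect_eq
        nat_neq_iff not_one_le_zero that)
    ultimately show ?thesis unfolding ncard_def by (simp add: card_image)
  qed
  have "p \<le> dseq ?S i \<longleftrightarrow> p \<le> f i" if "1 \<le> p" for p
  proof -
    \<comment> \<open>Indices start at \<open>0\<close> while \<open>mem_initial_segment\<close>
      concerns positive numbers, hence the shift by \<open>Suc\<close>.\<close>
    let ?P = "Suc ` {i. i < k \<and> p \<le> f i}"
    have "Suc i \<le> card ?P \<longleftrightarrow> Suc i \<in> ?P"
    proof (rule mem_initial_segment)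
      fix a b assume "a \<in> ?P" "b \<le> a" "1 \<le> b"
      then obtain a' b' where ab: "a = Suc a'" "b = Suc b'" "a' < k" "p \<le> f a'" "b' \<le> a'"
        by (cases b) auto
      then have "p \<le> f b'" using anti[of b' a'] that by (cases "b' = a'") auto
      then show "b \<in> ?P" using ab by auto
    qed auto
    then show ?thesis using that i
      by (simp add: le_dseq_iff nc card_image Suc_le_eq image_iff)
  qed
  then have "\<forall>p. 1 \<le> p \<longrightarrow> (p \<le> dseq ?S i \<longleftrightarrow> p \<le> f i)" by blast
  then show ?thesis
    by (metis le_antisym le_refl less_one not_le zero_le)
qed

text \<open>The row condition of a U-turn matrix: the sums of a row from column \<open>p\<close> to
  the right are \<open>0\<close> or \<open>1\<close>. By \<open>interlace_iff\<close> it is the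
  usual interlacing of enumerations.\<close>

definition interlace :: "nat \<Rightarrow> nat set \<Rightarrow> nat set \<Rightarrow> bool" where
  "interlace m S S' \<longleftrightarrow> (\<forall>p\<in>{1..m}. ncard S' p \<le> ncard S p \<and> ncard S p \<le> ncard S' p + 1)"

lemma interlaceD:
  assumes "S \<subseteq> {1..m}" "S' \<subseteq> {1..m}" "interlace m S S'" "1 \<le> p"
  shows "ncard S' p \<le> ncard S p" "ncard S p \<le> ncard S' p + 1"
proof -
  have "ncard S' p \<le> ncard S p \<and> ncard S p \<le> ncard S' p + 1"
    using assms ncard_outside[of S m p] ncard_outside[of S' m p]
    by (cases "p \<le> m") (auto simp: interlace_def)
  then show "ncard S' p \<le> ncard S p" "ncard S p \<le> ncard S' p + 1" by auto
qed

text \<open>By \<open>le_dseq_iff\<close> each inequality between counts becomes one between parts;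
  the permitted excess \<open>1\<close> of the counts is the index shift from \<open>i\<close> to
  \<open>Suc i\<close>.\<close>

lemma interlace_iff:
  assumes "S \<subseteq> {1..m}" "S' \<subseteq> {1..m}"
  shows "interlace m S S' \<longleftrightarrow> (\<forall>i. dseq S (Suc i) \<le> dseq S' i \<and> dseq S' i \<le> dseq S i)"
proof -
  have fin: "finite S" "finite S'" using assms by (auto intro: finite_subset)
  show ?thesis
  proof
    assume il: "interlace m S S'"
    show "\<forall>i. dseq S (Suc i) \<le> dseq S' i \<and> dseq S' i \<le> dseq S i"
    proof
      fix i
      have "dseq S (Suc i) \<le> dseq S' i"
      proof (cases "dseq S (Suc i) = 0")
        case False
        then have 1: "1 \<le> dseq S (Suc i)" by simp
        then have "Suc i < ncard S (dseq S (Suc i))"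
          using le_dseq_iff[OF fin(1) 1] by blast
        then show ?thesis
          using le_dseq_iff[OF fin(2) 1, of i] interlaceD(2)[OF assms il 1] by auto
      qed simp
      moreover have "dseq S' i \<le> dseq S i"
      proof (cases "dseq S' i = 0")
        case False
        then have 1: "1 \<le> dseq S' i" by simp
        then have "i < ncard S' (dseq S' i)"
          using le_dseq_iff[OF fin(2) 1] by blast
        then show ?thesis
          using le_dseq_iff[OF fin(1) 1, of i] interlaceD(1)[OF assms il 1] by auto
      qed simp
      ultimately show "dseq S (Suc i) \<le> dseq S' i \<and> dseq S' i \<le> dseq S i" ..
    qed
  next
    assume *: "\<forall>i. dseq S (Suc i) \<le> dseq S' i \<and> dseq S' i \<le> dseq S i"
    show "interlace m S S'"
      unfolding interlace_def
    proof
      fix p assume "p \<in> {1..m}"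
      then have p: "1 \<le> p" by simp
      have "ncard S' p \<le> ncard S p"
      proof (rule ccontr)
        assume "\<not> ?thesis"
        then have "p \<le> dseq S' (ncard S p)" "\<not> p \<le> dseq S (ncard S p)"
          using le_dseq_iff[OF fin(1) p] le_dseq_iff[OF fin(2) p] by auto
        then show False using * by (meson le_trans)
      qed
      moreover have "ncard S p \<le> ncard S' p + 1"
      proof (rule ccontr)
        assume "\<not> ?thesis"
        then have "p \<le> dseq S (Suc (ncard S' p))" "\<not> p \<le> dseq S' (ncard S' p)"
          using le_dseq_iff[OF fin(1) p] le_dseq_iff[OF fin(2) p] by auto
        then show False using * by (meson le_trans)
      qed
      ultimately show "ncard S' p \<le> ncard S p \<and> ncard S p \<le> ncard S' p + 1" ..
    qed
  qed
qed

lemma interlace_card_le: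
  assumes "S \<subseteq> {1..m}" "S' \<subseteq> {1..m}" "interlace m S S'"
  shows "card S' \<le> card S"
proof -
  have "ncard S' 1 \<le> ncard S 1" using interlaceD(1)[OF assms] by simp
  moreover have "0 \<notin> S" "0 \<notin> S'" using assms by auto
  ultimately show ?thesis by (simp add: ncard_1)
qed

text \<open>Restricted enumerations embed the interlacing sets into the product of intervals. A
  tuple outside the image has a repeated entry, so its determinant vanishes.\<close>

theorem interlacing_sum_sets:
  assumes S: "S \<subseteq> {1..m}" and k: "card S \<le> k"
  shows "(\<Sum>S' | S' \<subseteq> {1..m} \<and> interlace m S S'.
      (\<Prod>i<k. stepw a b c d (dseq S i) (dseq S (Suc i)) (dseq S' i)) * seqdet k \<psi> (dseq S')) =
    seqdet k (\<lambda>j. kern a b c d (\<psi> j)) (dseq S)" (is "(\<Sum>S'\<in>?B. _) = _")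
proof -
  let ?f = "dseq S"
  let ?P = "PiE {..<k} (\<lambda>i. {?f (Suc i)..?f i})"
  let ?F = "\<lambda>g. (\<Prod>i<k. stepw a b c d (?f i) (?f (Suc i)) (g i)) * seqdet k \<psi> g"
  let ?h = "\<lambda>S'. restrict (dseq S') {..<k}"
  have finS: "finite S" "0 \<notin> S" using S by (auto intro: finite_subset)
  have dec: "dec_seq k ?f" using dec_seq_dseq finS k by blast
  have B: "finite S'" "0 \<notin> S'" "card S' \<le> k" if "S' \<in> ?B" for S'
    using that interlace_card_le[OF S, of S'] k by (auto intro: finite_subset)
  have inj: "inj_on ?h ?B"
  proof (rule inj_onI)
    fix S1 S2 assume *: "S1 \<in> ?B" "S2 \<in> ?B" "?h S1 = ?h S2"
    then have "dseq S1 ` {..<k} = dseq S2 ` {..<k}"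
      by (metis image_restrict_eq)
    then show "S1 = S2"
      using set_eq_dseq_image[OF B[OF *(1)]] set_eq_dseq_image[OF B[OF *(2)]] by simp
  qed
  have sub: "?h ` ?B \<subseteq> ?P"
    using interlace_iff[OF S] by (auto intro!: restrict_PiE_iff[THEN iffD2])
  have zero: "?F g = 0" if g: "g \<in> ?P - ?h ` ?B" for g
  proof (rule ccontr)
    assume nz: "?F g \<noteq> 0"
    have inj: "i = i'" if "i < k" "i' < k" "g i = g i'" for i i'
      using seqdet_eq_0[of i k i' g \<psi>] nz that by fastforce
    have gi: "?f (Suc i) \<le> g i" "g i \<le> ?f i" if "i < k" for i
      using g that by (auto simp: PiE_iff)
    \<comment> \<open>A nonzero term has distinct entries, so by interlacing they decrease strictly;
      padded with zeros they enumerate a set.\<close>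
    define g' where "g' i = (if i < k then g i else 0)" for i
    have dec': "dec_seq k g'"
      unfolding dec_seq_def
    proof (intro conjI allI impI)
      fix i assume i: "i < k"
      show "g' (Suc i) < g' i \<or> g' (Suc i) = 0"
      proof (cases "Suc i < k")
        case True
        then have "g (Suc i) \<le> g i" using gi[of i] gi[of "Suc i"] by linarith
        moreover have "g (Suc i) \<noteq> g i" using inj[of "Suc i" i] True by auto
        ultimately show ?thesis using True by (simp add: g'_def)
      qed (simp add: g'_def)
    qed (simp add: g'_def)
    define S' where "S' = g' ` {..<k} - {0}"
    have d: "dseq S' i = g i" if "i < k" for i
      using dseq_of_dec_seq[OF dec' that] that by (simp add: S'_def g'_def)
    have fm: "?f i \<le> m" for i
    proof (cases "?f i = 0")
      case False
      then show ?thesis using dseq_eq_iff[OF finS(1), of "?f i" i] S by auto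
    qed simp
    have S'm: "S' \<subseteq> {1..m}"
      using gi(2) fm le_trans unfolding S'_def g'_def by (fastforce simp: Suc_le_eq)
    have fS': "finite S'" "0 \<notin> S'" using S'm by (auto intro: finite_subset)
    have "card (g' ` {..<k} - {0}) \<le> card (g' ` {..<k})" by (rule card_mono) auto
    also have "\<dots> \<le> k" using card_image_le[of "{..<k}" g'] by simp
    finally have cS': "card S' \<le> k" by (simp add: S'_def)
    have "?f (Suc i) \<le> dseq S' i \<and> dseq S' i \<le> ?f i" for i
    proof (cases "i < k")
      case True
      then show ?thesis using gi d by simp
    next
      case False
      then have "\<not> 0 < dseq S' i" "\<not> 0 < ?f i" "\<not> 0 < ?f (Suc i)"
        unfolding dseq_pos_iff[OF fS'] dseq_pos_iff[OF finS] using cS' k by auto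
      then show ?thesis by simp
    qed
    then have "S' \<in> ?B" using S'm interlace_iff[OF S S'm] by simp
    moreover have "g = ?h S'"
      using g d by (intro extensionalityI[of _ "{..<k}"]) (auto simp: PiE_iff)
    ultimately show False using g by blast
  qed
  have "seqdet k (\<lambda>j. kern a b c d (\<psi> j)) ?f = (\<Sum>g\<in>?P. ?F g)"
    by (rule interlacing_sum[OF dec, symmetric])
  also have "\<dots> = (\<Sum>g\<in>?h ` ?B. ?F g)"
    by (rule sum.mono_neutral_right) (use sub zero in \<open>auto intro!: finite_PiE\<close>)
  also have "\<dots> = (\<Sum>S'\<in>?B. ?F (?h S'))"
    using inj by (simp add: sum.reindex)
  also have "\<dots> = (\<Sum>S'\<in>?B. ?F (dseq S'))"
  proof (intro sum.cong refl)
    fix S'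
    have "seqdet k \<psi> (?h S') = seqdet k \<psi> (dseq S')" by (rule seqdet_cong) simp
    then show "?F (?h S') = ?F (dseq S')" by simp
  qed
  finally show ?thesis by simp
qed

section \<open>Transfer matrices of the U-turn rows\<close>

definition row_steps :: "nat \<Rightarrow> nat set \<Rightarrow> nat set \<Rightarrow> nat" where
  "row_steps m S S' = card {q \<in> {1..m}. ncard S' q < ncard S q}"

text \<open>\<open>S'\<close> describes the rows below and \<open>S\<close> includes the present
  row, so elements of \<open>S' - S\<close> are entries \<open>-1\<close>. The last exponent counts
  positive zeros whose nearest nonzero entry below is \<open>1\<close>, as \<open>ua_ssi\<close>
  does in odd rows.\<close>

definition row_plain :: "nat \<Rightarrow> 'a::comm_ring_1 \<Rightarrow> 'a \<Rightarrow> nat set \<Rightarrow> nat set \<Rightarrow> 'a" where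
  "row_plain m x \<tau> S S' = x ^ row_steps m S S' * (1 + \<tau>) ^ card (S' - S) *
     \<tau> ^ card {q \<in> S \<inter> S'. ncard S' (Suc q) < ncard S (Suc q)}"

text \<open>The last exponent counts positive zeros above a \<open>-1\<close> or above nothing, as
  \<open>ua_ssi\<close> does in even rows. The variable \<open>e\<close> will be t/x and so accounts
  for \<open>ua_bar\<close> as well.\<close>

definition row_bar :: "nat \<Rightarrow> 'a::comm_ring_1 \<Rightarrow> 'a \<Rightarrow> nat set \<Rightarrow> nat set \<Rightarrow> 'a" where
  "row_bar m e \<tau> S S' = e ^ row_steps m S S' * (1 + \<tau>) ^ card (S' - S) *
     \<tau> ^ card {q \<in> {1..m}. q \<notin> S \<and> q \<notin> S' \<and> ncard S' (Suc q) < ncard S (Suc q)}"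

lemma prod_if_one:
  "(\<Prod>i<k. if P i then c else 1) = (c::'a::comm_monoid_mult) ^ card {i. i < (k::nat) \<and> P i}"
proof -
  have "(\<Prod>i<k. if P i then c else 1) = (\<Prod>i\<in>{i \<in> {..<k}. P i}. c)"
    by (rule prod.inter_filter[symmetric]) simp
  then show ?thesis by simp
qed

text \<open>The columns with more elements of \<open>S\<close> than of \<open>S'\<close> at or
  beyond them are those in \<open>{dseq S' i<..dseq S i}\<close> for some \<open>i\<close>.
  Interlacing makes these intervals disjoint, so counting columns becomes summing over
  parts.\<close>

lemma
  assumes S: "S \<subseteq> {1..m}" and S': "S' \<subseteq> {1..m}" and il: "interlace m S S'" and k: "card S \<le> k"
  shows row_steps_eq: "row_steps m S S' = (\<Sum>i<k. dseq S i - dseq S' i)" (is ?A)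
    and row_gaps_eq: "card {q \<in> {1..m}. q \<notin> S \<and> q \<notin> S' \<and> ncard S' (Suc q) < ncard S (Suc q)} =
      (\<Sum>i<k. dseq S i - dseq S' i - 1)" (is ?B)
    and row_new_eq: "card (S' - S) =
      card {i. i < k \<and> 0 < dseq S' i \<and> dseq S' i \<noteq> dseq S i \<and> dseq S' i \<noteq> dseq S (Suc i)}" (is ?C)
    and row_shift_eq: "card {q \<in> S \<inter> S'. ncard S' (Suc q) < ncard S (Suc q)} =
      card {i. i < k \<and> 0 < dseq S' i \<and> dseq S' i \<noteq> dseq S i \<and> dseq S' i = dseq S (Suc i)}" (is ?D)
proof -
  let ?f = "dseq S" and ?g = "dseq S'"
  have fin: "finite S" "finite S'" "0 \<notin> S" "0 \<notin> S'" using S S' by (auto intro: finite_subset)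
  note f_le = le_dseq_iff[OF fin(1)] and g_le = le_dseq_iff[OF fin(2)]
  note il' = interlaceD[OF S S' il]
  have k_bound: "i < k" if "i < ncard S q" "1 \<le> q" for i q
    using that ncard_antimono[OF fin(1), of 1 q] ncard_1[OF fin(3)] k by simp
  have m_bound: "q \<le> m" if "i < ncard S q" for i q
    using that ncard_outside[OF S, of q] by (cases "q \<le> m") auto
  \<comment> \<open>The two counts differ by at most one, so the only possible index is
    \<open>ncard S' q\<close>.\<close>
  have uniq: "i = j" if "i < ncard S q" "\<not> i < ncard S' q" "j < ncard S q" "\<not> j < ncard S' q" "1 \<le> q" for i j q
    using that il'[OF that(5)] by linarith
  have f_mem: "?f i < q \<longleftrightarrow> \<not> i < ncard S q" and g_mem: "?g i < q \<longleftrightarrow> \<not> i < ncard S' q" if "1 \<le> q" for i q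
    using f_le[OF that, of i] g_le[OF that, of i] by auto
  have "{q \<in> {1..m}. ncard S' q < ncard S q} = (\<Union>i<k. {?g i<..?f i})"
  proof (intro equalityI subsetI)
    fix q assume "q \<in> {q \<in> {1..m}. ncard S' q < ncard S q}"
    then have "1 \<le> q" "ncard S' q < ncard S q" by auto
    then have "q \<in> {?g (ncard S' q)<..?f (ncard S' q)}" "ncard S' q < k"
      using f_le g_mem k_bound by auto
    then show "q \<in> (\<Union>i<k. {?g i<..?f i})" by blast
  next
    fix q assume "q \<in> (\<Union>i<k. {?g i<..?f i})"
    then obtain i where "?g i < q" "q \<le> ?f i" by auto
    moreover from this have "1 \<le> q" by simp
    ultimately show "q \<in> {q \<in> {1..m}. ncard S' q < ncard S q}"
      using f_le[of q i] g_mem[of q i] m_bound[of i q] by auto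
  qed
  moreover have disj: "{?g i<..?f i} \<inter> {?g j<..?f j} = {}" if "i \<noteq> j" for i j
  proof (rule ccontr)
    assume "\<not> ?thesis"
    then obtain q where "q \<in> {?g i<..?f i} \<inter> {?g j<..?f j}" by blast
    then have q: "?g i < q" "q \<le> ?f i" "?g j < q" "q \<le> ?f j" by auto
    then have "1 \<le> q" by simp
    with q f_le g_mem show False using uniq[of i q j] that by auto
  qed
  ultimately show ?A
    unfolding row_steps_def by (simp add: card_UN_disjoint)
  have "{q \<in> {1..m}. q \<notin> S \<and> q \<notin> S' \<and> ncard S' (Suc q) < ncard S (Suc q)} = (\<Union>i<k. {?g i<..<?f i})"
  proof (intro equalityI subsetI)
    fix q assume "q \<in> {q \<in> {1..m}. q \<notin> S \<and> q \<notin> S' \<and> ncard S' (Suc q) < ncard S (Suc q)}"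
    then have q: "1 \<le> q" "q \<notin> S" "q \<notin> S'" "ncard S' (Suc q) < ncard S (Suc q)" by auto
    then have "ncard S' q < ncard S (Suc q)" using ncard_rec[OF fin(2), of q] by simp
    then have "q \<in> {?g (ncard S' q)<..<?f (ncard S' q)}" "ncard S' q < k"
      using f_le[of "Suc q"] g_mem[OF q(1)] k_bound[of _ "Suc q"] by (auto simp: Suc_le_eq)
    then show "q \<in> (\<Union>i<k. {?g i<..<?f i})" by blast
  next
    fix q assume "q \<in> (\<Union>i<k. {?g i<..<?f i})"
    then obtain i where q: "?g i < q" "Suc q \<le> ?f i" by auto
    then have 1: "1 \<le> q" by simp
    then have "\<not> i < ncard S' q" "i < ncard S (Suc q)"
      using f_le[of "Suc q" i] g_mem[of q i] q by auto
    then show "q \<in> {q \<in> {1..m}. q \<notin> S \<and> q \<notin> S' \<and> ncard S' (Suc q) < ncard S (Suc q)}"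
      using ncard_rec[OF fin(1), of q] ncard_rec[OF fin(2), of q] il'[OF 1] il'[of "Suc q"] 1 m_bound[of i q]
      by (auto split: if_splits)
  qed
  moreover have "{?g i<..<?f i} \<inter> {?g j<..<?f j} = {}" if "i \<noteq> j" for i j
    using disj[OF that] by fastforce
  ultimately show ?B
    by (simp add: card_UN_disjoint)
  have inj: "inj_on ?g {i. 0 < ?g i}"
    by (rule inj_onI) (metis (mono_tags) One_nat_def Suc_leI dseq_eq_iff[OF fin(2)] mem_Collect_eq)
  have ik: "i < k" if "0 < ?g i" for i
  proof -
    have "i < ncard S' 1" using that g_le[of 1 i] by simp
    then show ?thesis using il'(1)[of 1] k_bound[of i 1] by simp
  qed
  have "S' - S = ?g ` {i. i < k \<and> 0 < ?g i \<and> ?g i \<noteq> ?f i \<and> ?g i \<noteq> ?f (Suc i)}"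
  proof (intro equalityI subsetI)
    fix q assume q: "q \<in> S' - S"
    then have 1: "1 \<le> q" using fin(4) by (cases q) auto
    then have g: "?g (ncard S' (Suc q)) = q" using dseq_eq_iff[OF fin(2)] q by blast
    moreover have "q \<noteq> ?f i" for i using dseq_eq_iff[OF fin(1) 1] q by blast
    ultimately show "q \<in> ?g ` {i. i < k \<and> 0 < ?g i \<and> ?g i \<noteq> ?f i \<and> ?g i \<noteq> ?f (Suc i)}"
      using ik 1 by (intro image_eqI[of _ _ "ncard S' (Suc q)"]) simp_all
  next
    fix q assume "q \<in> ?g ` {i. i < k \<and> 0 < ?g i \<and> ?g i \<noteq> ?f i \<and> ?g i \<noteq> ?f (Suc i)}"
    then obtain i where i: "?g i = q" "0 < q" "q \<noteq> ?f i" "q \<noteq> ?f (Suc i)" by auto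
    then have 1: "1 \<le> q" by simp
    have g: "q \<in> S'" "i = ncard S' (Suc q)" using dseq_eq_iff[OF fin(2) 1] i(1) by blast+
    have "q \<notin> S"
    proof
      assume "q \<in> S"
      then have "?f (ncard S (Suc q)) = q" using dseq_eq_iff[OF fin(1) 1] by blast
      \<comment> \<open>Interlacing leaves two possible positions of \<open>q\<close> in the
        enumeration of \<open>S\<close>; both are excluded.\<close>
      moreover have "ncard S (Suc q) = i \<or> ncard S (Suc q) = Suc i"
        using il'[of "Suc q"] g(2) by auto
      ultimately show False using i by auto
    qed
    with g show "q \<in> S' - S" by blast
  qed
  then show ?C
    by (simp only:) (rule card_image, rule inj_on_subset[OF inj], auto)
  have "{q \<in> S \<inter> S'. ncard S' (Suc q) < ncard S (Suc q)} =
      ?g ` {i. i < k \<and> 0 < ?g i \<and> ?g i \<noteq> ?f i \<and> ?g i = ?f (Suc i)}"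
  proof (intro equalityI subsetI)
    fix q assume q: "q \<in> {q \<in> S \<inter> S'. ncard S' (Suc q) < ncard S (Suc q)}"
    then have 1: "1 \<le> q" using fin(4) by (cases q) auto
    let ?i = "ncard S' (Suc q)"
    have g: "?g ?i = q" using dseq_eq_iff[OF fin(2) 1] q by blast
    have n: "ncard S (Suc q) = Suc ?i" using il'[of "Suc q"] q by auto
    then have "?f (Suc ?i) = q" using dseq_eq_iff[OF fin(1) 1] q by auto
    moreover have "?f ?i \<noteq> q" using dseq_eq_iff[OF fin(1) 1, of ?i] n by auto
    ultimately show "q \<in> ?g ` {i. i < k \<and> 0 < ?g i \<and> ?g i \<noteq> ?f i \<and> ?g i = ?f (Suc i)}"
      using ik g 1 by (intro image_eqI[of _ _ ?i]) (auto simp: Suc_le_eq)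
  next
    fix q assume "q \<in> ?g ` {i. i < k \<and> 0 < ?g i \<and> ?g i \<noteq> ?f i \<and> ?g i = ?f (Suc i)}"
    then obtain i where i: "?g i = q" "0 < q" "q \<noteq> ?f i" "q = ?f (Suc i)" by auto
    then have 1: "1 \<le> q" by simp
    show "q \<in> {q \<in> S \<inter> S'. ncard S' (Suc q) < ncard S (Suc q)}"
      using dseq_eq_iff[OF fin(2) 1, of i] dseq_eq_iff[OF fin(1) 1, of "Suc i"] i by auto
  qed
  then show ?D
    by (simp only:) (rule card_image, rule inj_on_subset[OF inj], auto)
qed

text \<open>Checked part by part. The free-fermion value \<open>c - a * b\<close> is
  \<open>\<tau> * x\<close>, which supplies the factor \<tau> of a part that moves onto the next
  part of \<open>S\<close>.\<close>

lemma row_plain_eq_prod: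
  fixes x \<tau> :: "'a::comm_ring_1"
  assumes S: "S \<subseteq> {1..m}" and S': "S' \<subseteq> {1..m}" and il: "interlace m S S'" and k: "card S \<le> k"
  shows "row_plain m x \<tau> S S' =
    (\<Prod>i<k. stepw x 1 ((1 + \<tau>) * x) x (dseq S i) (dseq S (Suc i)) (dseq S' i))"
proof -
  let ?f = "dseq S" and ?g = "dseq S'"
  have "stepw x 1 ((1 + \<tau>) * x) x (?f i) (?f (Suc i)) (?g i) = x ^ (?f i - ?g i) *
     (if 0 < ?g i \<and> ?g i \<noteq> ?f i \<and> ?g i \<noteq> ?f (Suc i) then 1 + \<tau> else 1) *
     (if 0 < ?g i \<and> ?g i \<noteq> ?f i \<and> ?g i = ?f (Suc i) then \<tau> else 1)" for i
  proof (cases "?g i = ?f i")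
    case False
    then have "?g i < ?f i" using il interlace_iff[OF S S'] le_neq_implies_less by blast
    then have "x ^ (?f i - ?g i) = x * x ^ (?f i - ?g i - 1)"
      by (metis Suc_diff_1 power_Suc zero_less_diff)
    then show ?thesis using False by (auto simp: stepw_def algebra_simps)
  qed (auto simp: stepw_def)
  then show ?thesis
    unfolding row_plain_def row_steps_eq[OF assms] row_new_eq[OF assms] row_shift_eq[OF assms]
    by (simp only: prod.distrib prod_if_one power_sum)
qed

text \<open>Every column strictly inside a step carries an extra \<tau>, hence the ratio
  \<open>\<tau> * e\<close>. The free-fermion value is \<open>e\<close>: a part that moves onto the
  next part of \<open>S\<close> gets no factor \<open>1 + \<tau>\<close>.\<close>

lemma row_bar_eq_prod:
  fixes e \<tau> :: "'a::comm_ring_1"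
  assumes S: "S \<subseteq> {1..m}" and S': "S' \<subseteq> {1..m}" and il: "interlace m S S'" and k: "card S \<le> k"
  shows "row_bar m e \<tau> S S' =
    (\<Prod>i<k. stepw (\<tau> * e) 1 ((1 + \<tau>) * e) e (dseq S i) (dseq S (Suc i)) (dseq S' i))"
proof -
  let ?f = "dseq S" and ?g = "dseq S'"
  have "stepw (\<tau> * e) 1 ((1 + \<tau>) * e) e (?f i) (?f (Suc i)) (?g i) = e ^ (?f i - ?g i) *
     (if 0 < ?g i \<and> ?g i \<noteq> ?f i \<and> ?g i \<noteq> ?f (Suc i) then 1 + \<tau> else 1) *
     \<tau> ^ (?f i - ?g i - 1)" for i
  proof (cases "?g i = ?f i")
    case False
    then have "?g i < ?f i" using il interlace_iff[OF S S'] le_neq_implies_less by blast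
    then have "e ^ (?f i - ?g i) = e * e ^ (?f i - ?g i - 1)"
      by (metis Suc_diff_1 power_Suc zero_less_diff)
    then show ?thesis using False by (auto simp: stepw_def power_mult_distrib algebra_simps)
  qed (auto simp: stepw_def)
  then show ?thesis
    unfolding row_bar_def row_steps_eq[OF assms] row_new_eq[OF assms] row_gaps_eq[OF assms]
    by (simp only: prod.distrib prod_if_one power_sum)
qed

section \<open>Sums over chains and the determinant formula for U-turn chains\<close>

primrec chain_sum :: "'s set \<Rightarrow> (nat \<Rightarrow> 's \<Rightarrow> 's \<Rightarrow> 'a::comm_ring_1) \<Rightarrow> 's \<Rightarrow> nat \<Rightarrow> 's \<Rightarrow> 'a" where
  "chain_sum M w z 0 S = (if S = z then 1 else 0)"
| "chain_sum M w z (Suc N) S = (\<Sum>S'\<in>M. w (Suc N) S S' * chain_sum M w z N S')"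

text \<open>Removing the top state peels off one transfer step; grouping the remaining chains by
  their new top state gives the recursion.\<close>

theorem chain_sum_eq:
  assumes "finite M" "S \<in> M"
  shows "(\<Sum>s | s \<in> {0..N} \<rightarrow>\<^sub>E M \<and> s 0 = z \<and> s N = S. \<Prod>j = 1..N. w j (s j) (s (j - 1))) =
    chain_sum M w z N S"
  using assms(2)
proof (induction N arbitrary: S)
  case 0
  have "{s. s \<in> {0..0::nat} \<rightarrow>\<^sub>E M \<and> s 0 = z \<and> s 0 = S} = (if S = z then {\<lambda>i\<in>{0}. S} else {})"
    using 0 by (auto simp: PiE_iff extensional_def restrict_def fun_eq_iff)
  then show ?case by simp
next
  case (Suc N)
  let ?C = "\<lambda>N S. {s. s \<in> {0..N} \<rightarrow>\<^sub>E M \<and> s 0 = z \<and> s N = S}"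
  let ?A = "{s. s \<in> {0..N} \<rightarrow>\<^sub>E M \<and> s 0 = z}"
  let ?t = "\<lambda>N s. \<Prod>j = 1..N. w j (s j) (s (j - 1))"
  have finA: "finite ?A"
    by (rule finite_subset[of _ "{0..N} \<rightarrow>\<^sub>E M"]) (auto intro!: finite_PiE assms)
  have "(\<Sum>s\<in>?C (Suc N) S. ?t (Suc N) s) = (\<Sum>s\<in>?A. w (Suc N) S (s N) * ?t N s)"
  proof (rule sum.reindex_bij_witness[of _ "\<lambda>s. s(Suc N := S)" "\<lambda>s. restrict s {0..N}"])
    fix s assume s: "s \<in> ?C (Suc N) S"
    show "(restrict s {0..N})(Suc N := S) = s"
      using s by (auto simp: fun_eq_iff PiE_iff extensional_def restrict_def)
    show "restrict s {0..N} \<in> ?A" using s by (auto simp: PiE_iff)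
    show "w (Suc N) S (restrict s {0..N} N) * ?t N (restrict s {0..N}) = ?t (Suc N) s"
    proof -
      have "?t N (restrict s {0..N}) = ?t N s" by (rule prod.cong) auto
      then show ?thesis using s by (simp add: mult.commute)
    qed
  next
    fix s assume s: "s \<in> ?A"
    show "restrict (s(Suc N := S)) {0..N} = s"
      using s by (auto simp: fun_eq_iff PiE_iff extensional_def restrict_def)
    show "s(Suc N := S) \<in> ?C (Suc N) S"
      using s Suc.prems by (auto simp: PiE_iff extensional_def)
  qed
  also have "\<dots> = (\<Sum>S'\<in>M. \<Sum>s\<in>{s \<in> ?A. s N = S'}. w (Suc N) S (s N) * ?t N s)"
    by (rule sum.group[symmetric]) (use finA assms in auto)
  also have "\<dots> = (\<Sum>S'\<in>M. w (Suc N) S S' * (\<Sum>s\<in>?C N S'. ?t N s))"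
  proof (rule sum.cong)
    fix S' assume "S' \<in> M"
    have "{s \<in> ?A. s N = S'} = ?C N S'" by auto
    then show "(\<Sum>s\<in>{s \<in> ?A. s N = S'}. w (Suc N) S (s N) * ?t N s) = w (Suc N) S S' * (\<Sum>s\<in>?C N S'. ?t N s)"
      by (simp add: sum_distrib_left)
  qed simp
  also have "\<dots> = chain_sum M w z (Suc N) S"
    using Suc.IH by (simp cong: sum.cong)
  finally show ?case .
qed

definition vprod :: "(nat \<Rightarrow> 'a::comm_ring_1) \<Rightarrow> nat \<Rightarrow> 'a" where
  "vprod c k = (\<Prod>i<k. \<Prod>j<i. c j - c i)"

text \<open>The product \<open>D_sp\<close> in the form in which the induction produces it, one
  variable at a time.\<close>

definition dprod :: "(nat \<Rightarrow> 'a::comm_ring_1) \<Rightarrow> (nat \<Rightarrow> 'a) \<Rightarrow> 'a \<Rightarrow> nat \<Rightarrow> 'a" where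
  "dprod x e \<tau> k = (\<Prod>i<k. (\<Prod>j<i. (x j + \<tau> * e j) + \<tau> * x i + e i) * (x i + e i))"

text \<open>Step \<open>j\<close> is the \<open>j\<close>-th row from the bottom; the letter \<open>k\<close> has \<open>j = 2 * k\<close> and the letter
  \<open>k\<close> with a bar has \<open>j = 2 * k - 1\<close>. The condition on \<open>card S\<close> is the U-turn condition.\<close>

definition ua_weight :: "nat \<Rightarrow> (nat \<Rightarrow> 'a::comm_ring_1) \<Rightarrow> (nat \<Rightarrow> 'a) \<Rightarrow> 'a \<Rightarrow> nat \<Rightarrow> nat set \<Rightarrow> nat set \<Rightarrow> 'a" where
  "ua_weight m x e \<tau> j S S' =
     (if interlace m S S' \<and> (even j \<longrightarrow> card S = j div 2)
      then (if even j then row_plain m (x (j div 2 - 1)) \<tau> S S' else row_bar m (e (j div 2)) \<tau> S S')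
      else 0)"

text \<open>The unit column enforces the U-turn condition: with fewer than \<open>k\<close> elements
  two rows belong to the part \<open>0\<close> and agree, and with \<open>k + 1\<close> elements the
  unit column is zero.\<close>

lemma seqdet_extend_unit:
  assumes S: "finite S" "0 \<notin> S" "card S \<le> Suc k"
  shows "seqdet (Suc k) (extend_unit k \<phi>) (dseq S) = (if card S = k then seqdet k \<phi> (dseq S) else 0)"
proof -
  note pos = dseq_pos_iff[OF S(1,2)]
  consider "card S < k" | "card S = k" | "card S = Suc k" using S(3) by linarith
  then show ?thesis
  proof cases
    case 1
    then have "dseq S (card S) = dseq S k" using pos[of "card S"] pos[of k] by simp
    then have "seqdet (Suc k) (extend_unit k \<phi>) (dseq S) = 0"
      by (intro seqdet_eq_0[of "card S" "Suc k" k]) (use 1 in auto)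
    then show ?thesis using 1 by simp
  next
    case 2
    have "seqdet (Suc k) (extend_unit k \<phi>) (dseq S) = seqdet k \<phi> (dseq S)"
      by (rule seqdet_last_unit) (use pos 2 in auto)
    then show ?thesis using 2 by simp
  next
    case 3
    have "0 < dseq S i" if "i \<le> k" for i using pos[of i] 3 that by simp
    then have "seqdet (Suc k) (extend_unit k \<phi>) (dseq S) = 0"
      by (intro seqdet_last_zero) (auto simp: extend_unit_def)
    then show ?thesis using 3 by simp
  qed
qed

text \<open>Induction over the pairs of rows of one variable. Two rows apply their kernels to the
  columns of the smaller determinant, extended by the unit column, and the new Vandermonde factors
  let \<open>alternant_ice\<close> evaluate the result.\<close>

theorem ua_chains_alternant:
  fixes x e :: "nat \<Rightarrow> 'a::comm_ring_1"
  assumes xe: "\<And>j. x j * e j = \<tau>" and "S \<subseteq> {1..m}"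
  shows "vprod (\<lambda>j. x j + \<tau> * e j) k * chain_sum (Pow {1..m}) (ua_weight m x e \<tau>) {} (2 * k) S =
    (if card S = k then dprod x e \<tau> k * alternant k x (\<lambda>j. \<tau> * e j) (dseq S) else 0)"
  using assms(2)
proof (induction k arbitrary: S)
  case 0
  then have "finite S" by (auto intro: finite_subset)
  then show ?case by (simp add: vprod_def dprod_def alternant_def seqdet_def)
next
  case (Suc k)
  let ?M = "Pow {1..m}"
  let ?w = "ua_weight m x e \<tau>"
  let ?c = "\<lambda>j. x j + \<tau> * e j"
  let ?\<phi> = "extend_unit k (\<lambda>j. usum (x j) (\<tau> * e j))"
  let ?K1 = "kern (x k) 1 ((1 + \<tau>) * x k) (x k)"
  let ?K2 = "kern (\<tau> * e k) 1 ((1 + \<tau>) * e k) (e k)"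
  have sum_il: "(\<Sum>S'\<in>?M. if interlace m S S' then h S' else 0) =
      (\<Sum>S' | S' \<subseteq> {1..m} \<and> interlace m S S'. h S')" for S and h :: "nat set \<Rightarrow> 'a"
    by (subst sum.inter_filter[symmetric]) (auto intro!: sum.cong)
  \<comment> \<open>After the row of the barred letter the cardinality is not prescribed; a
    determinant of size \<open>Suc k\<close> covers all cases.\<close>
  have inner: "vprod ?c k * chain_sum ?M ?w {} (Suc (2 * k)) S' = dprod x e \<tau> k * seqdet (Suc k) (\<lambda>j. ?K2 (?\<phi> j)) (dseq S')"
    if S': "S' \<subseteq> {1..m}" "card S' \<le> Suc k" for S'
  proof -
    have "vprod ?c k * chain_sum ?M ?w {} (Suc (2 * k)) S' =
        (\<Sum>S''\<in>?M. if interlace m S' S'' then row_bar m (e k) \<tau> S' S'' * (vprod ?c k * chain_sum ?M ?w {} (2 * k) S'') else 0)"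
      by (auto simp: sum_distrib_left ua_weight_def mult_ac intro!: sum.cong)
    also have "\<dots> = (\<Sum>S'' | S'' \<subseteq> {1..m} \<and> interlace m S' S''. dprod x e \<tau> k *
        ((\<Prod>i<Suc k. stepw (\<tau> * e k) 1 ((1 + \<tau>) * e k) (e k) (dseq S' i) (dseq S' (Suc i)) (dseq S'' i)) *
        seqdet (Suc k) ?\<phi> (dseq S'')))"
      unfolding sum_il
    proof (intro sum.cong refl)
      fix S'' assume *: "S'' \<in> {S''. S'' \<subseteq> {1..m} \<and> interlace m S' S''}"
      then have S'': "S'' \<subseteq> {1..m}" "interlace m S' S''" by auto
      have "card S'' \<le> Suc k" using interlace_card_le[OF S'(1) S''] S'(2) by simp
      moreover have "finite S''" "0 \<notin> S''" using S''(1) by (auto intro: finite_subset)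
      ultimately have "seqdet (Suc k) ?\<phi> (dseq S'') =
          (if card S'' = k then alternant k x (\<lambda>j. \<tau> * e j) (dseq S'') else 0)"
        by (simp add: seqdet_extend_unit alternant_def)
      \<comment> \<open>Both sides vanish unless \<open>card S'' = k\<close>, so the induction
        hypothesis has one form for all sets.\<close>
      then have "vprod ?c k * chain_sum ?M ?w {} (2 * k) S'' = dprod x e \<tau> k * seqdet (Suc k) ?\<phi> (dseq S'')"
        using Suc.IH[OF S''(1)] by simp
      then show "row_bar m (e k) \<tau> S' S'' * (vprod ?c k * chain_sum ?M ?w {} (2 * k) S'') =
        dprod x e \<tau> k * ((\<Prod>i<Suc k. stepw (\<tau> * e k) 1 ((1 + \<tau>) * e k) (e k)
          (dseq S' i) (dseq S' (Suc i)) (dseq S'' i)) * seqdet (Suc k) ?\<phi> (dseq S''))"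
        unfolding row_bar_eq_prod[OF S'(1) S'' S'(2)] by (simp only: mult_ac)
    qed
    also have "\<dots> = dprod x e \<tau> k * seqdet (Suc k) (\<lambda>j. ?K2 (?\<phi> j)) (dseq S')"
      unfolding sum_distrib_left[symmetric] interlacing_sum_sets[OF S'] ..
    finally show ?thesis .
  qed
  show ?case
  proof (cases "card S = Suc k")
    case False
    then show ?thesis by (simp add: ua_weight_def)
  next
    case card: True
    have "finite S" "0 \<notin> S" using Suc.prems by (auto intro: finite_subset)
    then have pos: "0 < dseq S i" if "i \<le> k" for i
      using dseq_pos_iff[of S i] card that by simp
    have "vprod ?c k * chain_sum ?M ?w {} (2 * Suc k) S =
        (\<Sum>S'\<in>?M. if interlace m S S' then row_plain m (x k) \<tau> S S' * (vprod ?c k * chain_sum ?M ?w {} (Suc (2 * k)) S') else 0)"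
    proof -
      have "2 * Suc k = Suc (Suc (2 * k))" by simp
      then have "vprod ?c k * chain_sum ?M ?w {} (2 * Suc k) S =
          (\<Sum>S'\<in>?M. vprod ?c k * (?w (Suc (Suc (2 * k))) S S' * chain_sum ?M ?w {} (Suc (2 * k)) S'))"
        by (simp only: chain_sum.simps(2)[of ?M ?w "{}" "Suc (2 * k)"] sum_distrib_left)
      moreover have "?w (Suc (Suc (2 * k))) S S' = (if interlace m S S' then row_plain m (x k) \<tau> S S' else 0)" for S'
        using card by (simp add: ua_weight_def)
      ultimately show ?thesis
        by (simp only: if_distrib if_distribR mult_zero_left mult_zero_right mult.left_commute cong: if_cong)
    qed
    also have "\<dots> = (\<Sum>S' | S' \<subseteq> {1..m} \<and> interlace m S S'. dprod x e \<tau> k *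
        ((\<Prod>i<Suc k. stepw (x k) 1 ((1 + \<tau>) * x k) (x k) (dseq S i) (dseq S (Suc i)) (dseq S' i)) *
        seqdet (Suc k) (\<lambda>j. ?K2 (?\<phi> j)) (dseq S')))"
      unfolding sum_il
    proof (intro sum.cong refl)
      fix S' assume *: "S' \<in> {S'. S' \<subseteq> {1..m} \<and> interlace m S S'}"
      then have S': "S' \<subseteq> {1..m}" "interlace m S S'" by auto
      have "card S' \<le> Suc k" using interlace_card_le[OF Suc.prems S'] card by simp
      note inner[OF S'(1) this]
      then show "row_plain m (x k) \<tau> S S' * (vprod ?c k * chain_sum ?M ?w {} (Suc (2 * k)) S') =
        dprod x e \<tau> k * ((\<Prod>i<Suc k. stepw (x k) 1 ((1 + \<tau>) * x k) (x k)
          (dseq S i) (dseq S (Suc i)) (dseq S' i)) * seqdet (Suc k) (\<lambda>j. ?K2 (?\<phi> j)) (dseq S'))"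
        using card unfolding row_plain_eq_prod[OF Suc.prems S' eq_refl[OF card]] by (simp only: mult_ac)
    qed
    also have "\<dots> = dprod x e \<tau> k * seqdet (Suc k) (\<lambda>j. ?K1 (?K2 (?\<phi> j))) (dseq S)"
      unfolding sum_distrib_left[symmetric] interlacing_sum_sets[OF Suc.prems eq_refl[OF card]] ..
    finally have "vprod ?c k * chain_sum ?M ?w {} (2 * Suc k) S =
        dprod x e \<tau> k * seqdet (Suc k) (\<lambda>j. ?K1 (?K2 (?\<phi> j))) (dseq S)" .
    then have "(\<Prod>j<k. ?c j - ?c k) * (vprod ?c k * chain_sum ?M ?w {} (2 * Suc k) S) =
        dprod x e \<tau> k * ((\<Prod>j<k. ?c j - ?c k) * seqdet (Suc k) (\<lambda>j. ?K1 (?K2 (?\<phi> j))) (dseq S))"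
      by (simp only: mult.left_commute)
    moreover have "vprod ?c (Suc k) = (\<Prod>j<k. ?c j - ?c k) * vprod ?c k"
      by (simp add: vprod_def)
    ultimately have "vprod ?c (Suc k) * chain_sum ?M ?w {} (2 * Suc k) S =
        dprod x e \<tau> k * ((\<Prod>j<k. ?c j - ?c k) * seqdet (Suc k) (\<lambda>j. ?K1 (?K2 (?\<phi> j))) (dseq S))"
      by (simp only: mult.assoc)
    also have "\<dots> = dprod x e \<tau> (Suc k) * alternant (Suc k) x (\<lambda>j. \<tau> * e j) (dseq S)"
    proof -
      have "dprod x e \<tau> (Suc k) = dprod x e \<tau> k * ((\<Prod>j<k. ?c j + \<tau> * x k + e k) * (x k + e k))"
        by (simp add: dprod_def)
      then show ?thesis
        using alternant_ice[of k x e \<tau> "dseq S", OF xe pos] by (simp only: mult.assoc)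
    qed
    finally show ?thesis using card by simp
  qed
qed

section \<open>U-turn matrices as chains of interlacing sets\<close>

lemma suffix_sum_nearest:
  fixes g :: "nat \<Rightarrow> int"
  assumes "i < r" "r \<le> N" "\<forall>s. i < s \<and> s < r \<longrightarrow> g s = 0"
  shows "(\<Sum>s = Suc i..N. g s) = g r + (\<Sum>s = Suc r..N. g s)"
proof -
  have split: "{Suc i..N} = {Suc i..<r} \<union> insert r {Suc r..N}" using assms by auto
  have "(\<Sum>s = Suc i..N. g s) = (\<Sum>s = Suc i..<r. g s) + (g r + (\<Sum>s = Suc r..N. g s))"
    unfolding split by (subst sum.union_disjoint) auto
  also have "(\<Sum>s = Suc i..<r. g s) = 0" using assms by (intro sum.neutral) auto
  finally show ?thesis by simp
qed

text \<open>As suffix sums are \<open>0\<close> or \<open>1\<close>, the one that starts after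
  \<open>i\<close> is \<open>1\<close> if the nearest nonzero entry is \<open>1\<close>, and
  \<open>0\<close> if that entry is \<open>-1\<close> or missing. The three cases are exhaustive, so
  the implications are equivalences.\<close>

lemma
  fixes g :: "nat \<Rightarrow> int"
  assumes suf: "\<And>j. i < j \<Longrightarrow> j \<le> Suc N \<Longrightarrow> (\<Sum>r = j..N. g r) \<in> {0, 1}" and "i \<le> N"
  shows nearest_one_iff: "(\<exists>r. i < r \<and> r \<le> N \<and> g r = 1 \<and> (\<forall>s. i < s \<and> s < r \<longrightarrow> g s = 0)) \<longleftrightarrow>
      (\<Sum>r = Suc i..N. g r) = 1" (is "?A \<longleftrightarrow> ?s = 1")
    and nearest_minus_one_iff: "(\<exists>r. i < r \<and> r \<le> N \<and> g r = -1 \<and> (\<forall>s. i < s \<and> s < r \<longrightarrow> g s = 0)) \<or>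
      (\<forall>s. i < s \<and> s \<le> N \<longrightarrow> g s = 0) \<longleftrightarrow> (\<Sum>r = Suc i..N. g r) = 0" (is "?B \<or> ?C \<longleftrightarrow> _")
proof -
  have s01: "?s \<in> {0, 1}" using suf[of "Suc i"] assms(2) by simp
  have A: "?s = 1" if ?A
  proof -
    from that obtain r where r: "i < r" "r \<le> N" "g r = 1" "\<forall>s. i < s \<and> s < r \<longrightarrow> g s = 0" by blast
    show ?thesis using suffix_sum_nearest[OF r(1,2,4)] suf[of "Suc r"] r s01 by auto
  qed
  have B: "?s = 0" if ?B
  proof -
    from that obtain r where r: "i < r" "r \<le> N" "g r = -1" "\<forall>s. i < s \<and> s < r \<longrightarrow> g s = 0" by blast
    show ?thesis using suffix_sum_nearest[OF r(1,2,4)] suf[of "Suc r"] r s01 by auto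
  qed
  have C: "?s = 0" if ?C
    using that by (intro sum.neutral) auto
  have D: "?A \<or> ?B \<or> ?C"
  proof (cases ?C)
    case False
    then have ex: "\<exists>r. i < r \<and> r \<le> N \<and> g r \<noteq> 0" by blast
    define r where "r = (LEAST r. i < r \<and> r \<le> N \<and> g r \<noteq> 0)"
    have r: "i < r \<and> r \<le> N \<and> g r \<noteq> 0" unfolding r_def by (rule LeastI_ex[OF ex])
    have min: "g s = 0" if "i < s" "s < r" for s
      using not_less_Least[of s "\<lambda>r. i < r \<and> r \<le> N \<and> g r \<noteq> 0"] that r unfolding r_def[symmetric] by auto
    have "?s = g r + (\<Sum>s = Suc r..N. g s)"
      using r min by (intro suffix_sum_nearest) auto
    then have "g r = 1 \<or> g r = -1"
      using suf[of "Suc r"] r s01 by auto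
    then show ?thesis using r min by blast
  qed simp
  have BC: "?s = 0" if "?B \<or> ?C" using that B C by (elim disjE)
  show "?A \<longleftrightarrow> ?s = 1"
  proof
    assume s: "?s = 1"
    from D show ?A
    proof
      assume "?B \<or> ?C"
      from BC[OF this] s show ?A by simp
    qed
  qed (rule A)
  show "?B \<or> ?C \<longleftrightarrow> ?s = 0"
  proof
    assume s: "?s = 0"
    from D show "?B \<or> ?C"
    proof
      assume ?A
      from A[OF this] s show "?B \<or> ?C" by simp
    qed
  qed (rule BC)
qed

lemma ncard_eq_sum:
  assumes "S \<subseteq> {1..m}"
  shows "int (ncard S p) = (\<Sum>q = p..m. of_bool (q \<in> S))"
proof -
  have "{s \<in> S. p \<le> s} = {q \<in> {p..m}. q \<in> S}" using assms by auto
  then show ?thesis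
    unfolding ncard_def of_bool_def by (simp add: sum.If_cases Int_def)
qed

definition ua_chain :: "nat \<Rightarrow> nat \<Rightarrow> (nat \<times> nat \<Rightarrow> int) \<Rightarrow> nat \<Rightarrow> nat set" where
  "ua_chain n m A = (\<lambda>j\<in>{0..2*n}. {q \<in> {1..m}. (\<Sum>i = Suc (2*n) - j..2*n. A (i, q)) = 1})"

text \<open>States are indexed from the bottom: row \<open>i\<close> is the difference between
  \<open>s (Suc (2*n) - i)\<close>, which includes it, and \<open>s (2*n - i)\<close>, which
  describes the rows below.\<close>

definition chain_ua :: "nat \<Rightarrow> nat \<Rightarrow> (nat \<Rightarrow> nat set) \<Rightarrow> nat \<times> nat \<Rightarrow> int" where
  "chain_ua n m s = (\<lambda>(i, q)\<in>{1..2*n} \<times> {1..m}.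
     of_bool (q \<in> s (Suc (2*n) - i)) - of_bool (q \<in> s (2*n - i)))"

definition ua_chains :: "nat \<Rightarrow> nat \<Rightarrow> nat set \<Rightarrow> (nat \<Rightarrow> nat set) set" where
  "ua_chains n m U = {s \<in> {0..2*n} \<rightarrow>\<^sub>E Pow {1..m}. s 0 = {} \<and> s (2*n) = U \<and>
     (\<forall>j\<in>{1..2*n}. interlace m (s j) (s (j - 1)) \<and> (even j \<longrightarrow> card (s j) = j div 2))}"

lemma chain_ua_apply:
  "i \<in> {1..2*n} \<Longrightarrow> q \<in> {1..m} \<Longrightarrow>
    chain_ua n m s (i, q) = of_bool (q \<in> s (Suc (2*n) - i)) - of_bool (q \<in> s (2*n - i))"
  by (simp add: chain_ua_def)

lemma chain_ua_row_sum:
  assumes "s \<in> {0..2*n} \<rightarrow>\<^sub>E Pow {1..m}" "i \<in> {1..2*n}" "1 \<le> p"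
  shows "(\<Sum>q = p..m. chain_ua n m s (i, q)) =
    int (ncard (s (Suc (2*n) - i)) p) - int (ncard (s (2*n - i)) p)"
proof -
  have "s (Suc (2*n) - i) \<subseteq> {1..m}" "s (2*n - i) \<subseteq> {1..m}"
    using assms(1,2) by (auto simp: PiE_iff)
  note this[THEN ncard_eq_sum, of p]
  moreover have "(\<Sum>q = p..m. chain_ua n m s (i, q)) =
      (\<Sum>q = p..m. of_bool (q \<in> s (Suc (2*n) - i)) - of_bool (q \<in> s (2*n - i)))"
    using assms(2,3) by (intro sum.cong refl chain_ua_apply) auto
  ultimately show ?thesis by (simp add: sum_subtractf)
qed

lemma chain_ua_col_sum:
  assumes "q \<in> {1..m}" "k \<le> 2*n"
  shows "(\<Sum>i = Suc (2*n) - k..2*n. chain_ua n m s (i, q)) = of_bool (q \<in> s k) - of_bool (q \<in> s 0)"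
  using assms(2)
proof (induction k)
  case (Suc k)
  have "{Suc (2*n) - Suc k..2*n} = insert (2*n - k) {Suc (2*n) - k..2*n}" using Suc.prems by auto
  moreover have "2*n - k \<notin> {Suc (2*n) - k..2*n}" using Suc.prems by auto
  moreover have "chain_ua n m s (2*n - k, q) = of_bool (q \<in> s (Suc k)) - of_bool (q \<in> s k)"
  proof -
    have "Suc (2*n) - (2*n - k) = Suc k" "2*n - (2*n - k) = k" using Suc.prems by auto
    then show ?thesis using chain_ua_apply[of "2*n - k" n q m s] Suc.prems assms(1) by simp
  qed
  ultimately show ?case using Suc by simp
qed simp

text \<open>Row conditions come from interlacing, column sums telescope to indicators, and the
  U-turn sums are differences of cardinalities.\<close>

lemma chain_ua_mem:
  assumes s: "s \<in> ua_chains n m U" and U: "U = mu ` {1..n}" and m: "m = mu 1"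
  shows "chain_ua n m s \<in> UA n mu"
proof -
  let ?A = "chain_ua n m s"
  have sP: "s \<in> {0..2*n} \<rightarrow>\<^sub>E Pow {1..m}" and s0: "s 0 = {}" and s2n: "s (2*n) = U"
    and il: "\<And>j. j \<in> {1..2*n} \<Longrightarrow> interlace m (s j) (s (j - 1))"
    and card: "\<And>j. j \<in> {1..2*n} \<Longrightarrow> even j \<Longrightarrow> card (s j) = j div 2"
    using s by (auto simp: ua_chains_def)
  have "?A \<in> {1..2*n} \<times> {1..m} \<rightarrow>\<^sub>E {-1, 0, 1}"
    by (auto simp: chain_ua_def PiE_iff of_bool_def)
  moreover have "(\<Sum>q = p..m. ?A (i, q)) \<in> {0, 1}" if "i \<in> {1..2*n}" "p \<in> {1..m}" for i p
  proof -
    have "Suc (2*n) - i \<in> {1..2*n}" "Suc (2*n) - i - 1 = 2*n - i" using that(1) by auto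
    then have "interlace m (s (Suc (2*n) - i)) (s (2*n - i))" using il by metis
    then have "ncard (s (2*n - i)) p \<le> ncard (s (Suc (2*n) - i)) p \<and>
        ncard (s (Suc (2*n) - i)) p \<le> ncard (s (2*n - i)) p + 1"
      using that(2) by (simp add: interlace_def)
    then show ?thesis
      using that(2) chain_ua_row_sum[OF sP that(1), of p] by auto
  qed
  moreover have "(\<Sum>i = j..2*n. ?A (i, q)) \<in> {0, 1}" if "j \<in> {1..2*n}" "q \<in> {1..m}" for j q
    using that chain_ua_col_sum[OF that(2), of "Suc (2*n) - j" n s] s0 by auto
  moreover have "(\<Sum>q = 1..m. ?A (2*i - 1, q) + ?A (2*i, q)) = 1" if i: "i \<in> {1..n}" for i
  proof -
    have card': "card (s (2 * k)) = k" if "k \<le> n" for k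
      using card[of "2 * k"] that s0 by (cases "k = 0") auto
    have nc: "ncard (s j) 1 = card (s j)" if "j \<le> 2*n" for j
    proof -
      have "0 \<notin> s j" using PiE_mem[OF sP, of j] that by auto
      then show ?thesis by (simp add: ncard_1)
    qed
    \<comment> \<open>Rows \<open>2*i - 1\<close> and \<open>2*i\<close> share the state
      \<open>s (Suc (2*n) - 2*i)\<close>, which cancels in their joint sum.\<close>
    have ix: "Suc (2*n) - (2*i - 1) = 2 * (n + 1 - i)" "2*n - (2*i - 1) = Suc (2*n) - 2*i" "2*n - 2*i = 2 * (n - i)"
      using i by auto
    have "(\<Sum>q = 1..m. ?A (2*i - 1, q) + ?A (2*i, q)) =
      int (ncard (s (2 * (n + 1 - i))) 1) - int (ncard (s (2 * (n - i))) 1)"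
    proof -
      have "2*i - 1 \<in> {1..2*n}" "2*i \<in> {1..2*n}" using i by auto
      note this[THEN chain_ua_row_sum[OF sP], of 1]
      then show ?thesis by (simp add: sum.distrib ix del: One_nat_def)
    qed
    also have "\<dots> = int (n + 1 - i) - int (n - i)"
    proof -
      have "n + 1 - i \<le> n" "n - i \<le> n" "2 * (n + 1 - i) \<le> 2*n" "2 * (n - i) \<le> 2*n" using i by auto
      then show ?thesis by (simp only: nc card')
    qed
    also have "\<dots> = 1" using i by auto
    finally show ?thesis .
  qed
  moreover have "(\<Sum>i = 1..2*n. ?A (i, q)) = (if q \<in> mu ` {1..n} then 1 else 0)" if "q \<in> {1..m}" for q
    using chain_ua_col_sum[OF that, of "2*n" n s] s0 s2n U by simp
  ultimately show ?thesis
    unfolding UA_def Let_def m[symmetric] by blast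
qed

lemma UA_D:
  assumes "A \<in> UA n mu" "m = mu 1"
  shows "A \<in> {1..2*n} \<times> {1..m} \<rightarrow>\<^sub>E {-1, 0, 1}"
    and "\<And>i p. i \<in> {1..2*n} \<Longrightarrow> p \<in> {1..m} \<Longrightarrow> (\<Sum>q = p..m. A (i, q)) \<in> {0, 1}"
    and "\<And>j q. j \<in> {1..2*n} \<Longrightarrow> q \<in> {1..m} \<Longrightarrow> (\<Sum>i = j..2*n. A (i, q)) \<in> {0, 1}"
    and "\<And>i. i \<in> {1..n} \<Longrightarrow> (\<Sum>q = 1..m. A (2*i-1, q) + A (2*i, q)) = 1"
    and "\<And>q. q \<in> {1..m} \<Longrightarrow> (\<Sum>i = 1..2*n. A (i, q)) = (if q \<in> mu ` {1..n} then 1 else 0)"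
  using assms unfolding UA_def Let_def by blast+

lemma ua_chain_in:
  "ua_chain n m A \<in> {0..2*n} \<rightarrow>\<^sub>E Pow {1..m}"
  by (auto simp: ua_chain_def)

lemma chain_ua_of_ua_chain:
  assumes A: "A \<in> UA n mu" and m: "m = mu 1"
  shows "chain_ua n m (ua_chain n m A) = A"
proof
  fix iq :: "nat \<times> nat"
  obtain i q where iq: "iq = (i, q)" by (cases iq)
  note D = UA_D[OF A m]
  show "chain_ua n m (ua_chain n m A) iq = A iq"
  proof (cases "i \<in> {1..2*n} \<and> q \<in> {1..m}")
    case True
    have suf: "(\<Sum>i = j..2*n. A (i, q)) \<in> {0, 1}" if "1 \<le> j" for j
      using D(3)[of j q] True that by (cases "j \<le> 2*n") auto
    \<comment> \<open>A sum that is \<open>0\<close> or \<open>1\<close> equals the indicator of its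
      being \<open>1\<close>, so differences of indicators recover the entries.\<close>
    have b: "of_bool ((\<Sum>i = j..2*n. A (i, q)) = 1) = (\<Sum>i = j..2*n. A (i, q))" if "1 \<le> j" for j
      using suf[OF that] by auto
    have ix: "Suc (2*n) - (Suc (2*n) - i) = i" "Suc (2*n) - (2*n - i) = Suc i"
      "Suc (2*n) - i \<le> 2*n" using True by auto
    have "chain_ua n m (ua_chain n m A) iq = (\<Sum>i = i..2*n. A (i, q)) - (\<Sum>i = Suc i..2*n. A (i, q))"
      unfolding iq using True b[of i] b[of "Suc i"] ix by (simp add: chain_ua_apply ua_chain_def)
    also have "{i..2*n} = insert i {Suc i..2*n}" using True by auto
    finally show ?thesis by (simp add: iq)
  next
    case False
    then have nin: "(i, q) \<notin> {1..2*n} \<times> {1..m}" by simp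
    then show ?thesis
      unfolding iq chain_ua_def by (simp only: restrict_apply if_False PiE_arb[OF D(1) nin])
  qed
qed

lemma ua_chain_mem:
  assumes A: "A \<in> UA n mu" and U: "U = mu ` {1..n}" "U \<subseteq> {1..m}" and m: "m = mu 1"
  shows "ua_chain n m A \<in> ua_chains n m U"
proof -
  let ?s = "ua_chain n m A"
  note D = UA_D[OF A m]
  have s0: "?s 0 = {}" by (simp add: ua_chain_def)
  have s2n: "?s (2*n) = U"
    using D(5) U by (auto simp: ua_chain_def split: if_splits)
  note sP = ua_chain_in[of n m A]
  \<comment> \<open>The row sum formula for chains applies to \<open>A\<close>, since
    \<open>A\<close> is rebuilt from its chain.\<close>
  note row = chain_ua_row_sum[OF sP, unfolded chain_ua_of_ua_chain[OF A m]]
  have il: "interlace m (?s j) (?s (j - 1))" if j: "j \<in> {1..2*n}" for j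
    unfolding interlace_def
  proof
    fix p assume p: "p \<in> {1..m}"
    define i where "i = Suc (2*n) - j"
    have i: "i \<in> {1..2*n}" "Suc (2*n) - i = j" "2*n - i = j - 1" using j by (auto simp: i_def)
    show "ncard (?s (j - 1)) p \<le> ncard (?s j) p \<and> ncard (?s j) p \<le> ncard (?s (j - 1)) p + 1"
      using row[OF i(1), of p] D(2)[OF i(1) p] p by (auto simp: i)
  qed
  have "card (?s (2 * k)) = k" if "k \<le> n" for k
    using that
  proof (induction k)
    case (Suc k)
    have nc: "ncard (?s j) 1 = card (?s j)" if "j \<le> 2*n" for j
    proof -
      have "0 \<notin> ?s j" using PiE_mem[OF sP, of j] that by auto
      then show ?thesis by (simp add: ncard_1)
    qed
    define i where "i = n - k"
    have i: "i \<in> {1..n}" using Suc.prems by (auto simp: i_def)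
    have ix: "Suc (2*n) - (2*i - 1) = 2 * Suc k" "2*n - (2*i - 1) = Suc (2*n) - 2*i" "2*n - 2*i = 2 * k"
      using Suc.prems by (auto simp: i_def)
    have "1 = (\<Sum>q = 1..m. A (2*i - 1, q)) + (\<Sum>q = 1..m. A (2*i, q))"
      using D(4)[OF i] by (simp add: sum.distrib)
    also have "\<dots> = int (ncard (?s (2 * Suc k)) 1) - int (ncard (?s (2 * k)) 1)"
    proof -
      have "2*i - 1 \<in> {1..2*n}" "2*i \<in> {1..2*n}" using i by auto
      note this[THEN row, of 1]
      then show ?thesis by (simp add: ix del: One_nat_def mult_Suc_right)
    qed
    also have "\<dots> = int (card (?s (2 * Suc k))) - int k"
      using Suc by (simp add: nc del: One_nat_def)
    finally show ?case by simp
  qed (simp add: s0)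
  then have "card (?s j) = j div 2" if "j \<in> {1..2*n}" "even j" for j
    using that by (auto elim!: evenE)
  with sP s0 s2n il show ?thesis by (simp add: ua_chains_def)
qed

lemma ua_chain_of_chain_ua:
  assumes "s \<in> ua_chains n m U"
  shows "ua_chain n m (chain_ua n m s) = s"
proof
  fix j
  have sP: "s \<in> {0..2*n} \<rightarrow>\<^sub>E Pow {1..m}" and s0: "s 0 = {}" using assms by (auto simp: ua_chains_def)
  show "ua_chain n m (chain_ua n m s) j = s j"
  proof (cases "j \<le> 2*n")
    case True
    then have sj: "s j \<subseteq> {1..m}" using sP by (auto simp: PiE_iff)
    have "ua_chain n m (chain_ua n m s) j = {q \<in> {1..m}. (\<Sum>i = Suc (2*n) - j..2*n. chain_ua n m s (i, q)) = 1}"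
      using True by (simp add: ua_chain_def)
    also have "\<dots> = {q \<in> {1..m}. q \<in> s j}"
      using chain_ua_col_sum[OF _ True] s0 by auto
    finally show ?thesis using sj by auto
  next
    case False
    then show ?thesis using sP by (simp add: ua_chain_def PiE_iff extensional_def)
  qed
qed

text \<open>Membership in \<open>s (j - 1)\<close> is the column sum below row \<open>i\<close>, and
  differences of \<open>ncard\<close> are row sums to the right. By \<open>nearest_one_iff\<close>
  and \<open>nearest_minus_one_iff\<close> these decide the nearest nonzero entries, hence the
  statistics of the row.\<close>

lemma
  assumes s: "s \<in> ua_chains n m U" and j: "j \<in> {1..2*n}"
  defines "A \<equiv> chain_ua n m s" and "i \<equiv> Suc (2*n) - j"
  shows row_count_chain: "row_count m A i = row_steps m (s j) (s (j - 1))"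
    and row_neg_chain: "card {q \<in> {1..m}. A (i, q) = -1} = card (s (j - 1) - s j)"
    and row_shift_chain: "card {q \<in> {1..m}. positive_zero m A i q \<and> next_below n A i q 1} =
       card {q \<in> s j \<inter> s (j - 1). ncard (s (j - 1)) (Suc q) < ncard (s j) (Suc q)}"
    and row_gaps_chain: "card {q \<in> {1..m}. positive_zero m A i q \<and>
         (next_below n A i q (-1) \<or> none_below n A i q)} =
       card {q \<in> {1..m}. q \<notin> s j \<and> q \<notin> s (j - 1) \<and> ncard (s (j - 1)) (Suc q) < ncard (s j) (Suc q)}"
proof -
  have sP: "s \<in> {0..2*n} \<rightarrow>\<^sub>E Pow {1..m}" and s0: "s 0 = {}"
    and il: "interlace m (s j) (s (j - 1))"
    using s j by (auto simp: ua_chains_def)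
  have i: "i \<in> {1..2*n}" "Suc (2*n) - i = j" "2*n - i = j - 1" "Suc i = Suc (2*n) - (j - 1)"
    using j by (auto simp: i_def)
  have S: "s j \<subseteq> {1..m}" "s (j - 1) \<subseteq> {1..m}" using sP j by (auto simp: PiE_iff)
  then have fin: "finite (s j)" "finite (s (j - 1))" by (auto intro: finite_subset)
  note il' = interlaceD[OF S il]
  have A: "A (i, q) = of_bool (q \<in> s j) - of_bool (q \<in> s (j - 1))" if "q \<in> {1..m}" for q
    using chain_ua_apply[OF i(1) that] by (simp add: A_def i)
  have row: "(\<Sum>q = p..m. A (i, q)) = int (ncard (s j) p) - int (ncard (s (j - 1)) p)" if "1 \<le> p" for p
    using chain_ua_row_sum[OF sP i(1) that] by (simp add: A_def i)
  have right: "next_right m A i q 1 \<longleftrightarrow> ncard (s (j - 1)) (Suc q) < ncard (s j) (Suc q)" if q: "q \<in> {1..m}" for q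
  proof -
    have "(\<Sum>r = p..m. A (i, r)) \<in> {0, 1}" if "q < p" for p
      using row[of p] il'[of p] that by auto
    then have "next_right m A i q 1 \<longleftrightarrow> (\<Sum>r = Suc q..m. A (i, r)) = 1"
      unfolding next_right_def using nearest_one_iff[of q m "\<lambda>r. A (i, r)"] q by auto
    then show ?thesis using row[of "Suc q"] il'[of "Suc q"] by auto
  qed
  have col: "(\<Sum>r = Suc i..2*n. A (r, q)) = of_bool (q \<in> s (j - 1))"
    and suf: "(\<And>p. i < p \<Longrightarrow> p \<le> Suc (2*n) \<Longrightarrow> (\<Sum>r = p..2*n. A (r, q)) \<in> {0, 1})" if q: "q \<in> {1..m}" for q
  proof -
    show "(\<Sum>r = Suc i..2*n. A (r, q)) = of_bool (q \<in> s (j - 1))"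
      using chain_ua_col_sum[OF q, of "j - 1" n s] j s0 unfolding A_def i(4) by auto
    fix p assume "i < p" "p \<le> Suc (2*n)"
    then have "Suc (2*n) - (Suc (2*n) - p) = p" "Suc (2*n) - p \<le> 2*n" by auto
    then show "(\<Sum>r = p..2*n. A (r, q)) \<in> {0, 1}"
      using chain_ua_col_sum[OF q, of "Suc (2*n) - p" n s] s0 by (auto simp: A_def)
  qed
  have below: "next_below n A i q 1 \<longleftrightarrow> q \<in> s (j - 1)"
    and below': "next_below n A i q (-1) \<or> none_below n A i q \<longleftrightarrow> q \<notin> s (j - 1)" if q: "q \<in> {1..m}" for q
  proof -
    have "i \<le> 2*n" using i by simp
    note near = nearest_one_iff[of i "2*n" "\<lambda>r. A (r, q)", OF suf[OF q] this]
      nearest_minus_one_iff[of i "2*n" "\<lambda>r. A (r, q)", OF suf[OF q] this]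
    show "next_below n A i q 1 \<longleftrightarrow> q \<in> s (j - 1)"
      unfolding next_below_def using near(1) col[OF q] by simp
    show "next_below n A i q (-1) \<or> none_below n A i q \<longleftrightarrow> q \<notin> s (j - 1)"
      unfolding next_below_def none_below_def using near(2) col[OF q] by simp
  qed
  \<comment> \<open>The row sum from \<open>q\<close> on is \<open>1\<close> exactly when the entry
    is \<open>1\<close>, or is \<open>0\<close> with sum \<open>1\<close> to its right; an entry
    \<open>-1\<close> brings the sum down to \<open>0\<close>.\<close>
  have "{q \<in> {1..m}. A (i, q) = 1 \<or> positive_zero m A i q} =
      {q \<in> {1..m}. ncard (s (j - 1)) q < ncard (s j) q}"
  proof (intro Collect_cong conj_cong refl)
    fix q assume q: "q \<in> {1..m}"
    show "A (i, q) = 1 \<or> positive_zero m A i q \<longleftrightarrow> ncard (s (j - 1)) q < ncard (s j) q"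
      unfolding positive_zero_def right[OF q] A[OF q] ncard_rec[OF fin(1), of q] ncard_rec[OF fin(2), of q]
      using il'[of "Suc q"] il'[of q] q
      by (auto simp: ncard_rec[OF fin(1), of q] ncard_rec[OF fin(2), of q] split: if_splits)
  qed
  then show "row_count m A i = row_steps m (s j) (s (j - 1))"
    by (simp add: row_count_def row_steps_def)
  have "{q \<in> {1..m}. A (i, q) = -1} = s (j - 1) - s j"
    using A S by (auto simp: of_bool_def split: if_splits)
  then show "card {q \<in> {1..m}. A (i, q) = -1} = card (s (j - 1) - s j)" by simp
  have "{q \<in> {1..m}. positive_zero m A i q \<and> next_below n A i q 1} =
       {q \<in> s j \<inter> s (j - 1). ncard (s (j - 1)) (Suc q) < ncard (s j) (Suc q)}"
    using S A right below by (auto simp: positive_zero_def of_bool_def split: if_splits)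
  then show "card {q \<in> {1..m}. positive_zero m A i q \<and> next_below n A i q 1} =
       card {q \<in> s j \<inter> s (j - 1). ncard (s (j - 1)) (Suc q) < ncard (s j) (Suc q)}" by simp
  have "{q \<in> {1..m}. positive_zero m A i q \<and> (next_below n A i q (-1) \<or> none_below n A i q)} =
       {q \<in> {1..m}. q \<notin> s j \<and> q \<notin> s (j - 1) \<and> ncard (s (j - 1)) (Suc q) < ncard (s j) (Suc q)}"
  proof (rule Collect_cong, rule conj_cong[OF refl])
    fix q assume q: "q \<in> {1..m}"
    show "positive_zero m A i q \<and> (next_below n A i q (-1) \<or> none_below n A i q) \<longleftrightarrow>
        q \<notin> s j \<and> q \<notin> s (j - 1) \<and> ncard (s (j - 1)) (Suc q) < ncard (s j) (Suc q)"
      unfolding positive_zero_def right[OF q] A[OF q] below'[OF q] by auto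
  qed
  then show "card {q \<in> {1..m}. positive_zero m A i q \<and> (next_below n A i q (-1) \<or> none_below n A i q)} =
       card {q \<in> {1..m}. q \<notin> s j \<and> q \<notin> s (j - 1) \<and> ncard (s (j - 1)) (Suc q) < ncard (s j) (Suc q)}"
    by simp
qed

lemma card_pairs:
  assumes "finite I" "finite J"
  shows "card {(i, q). i \<in> I \<and> q \<in> J \<and> P i q} = (\<Sum>i\<in>I. card {q \<in> J. P i q})"
proof -
  have "{(i, q). i \<in> I \<and> q \<in> J \<and> P i q} = (SIGMA i:I. {q \<in> J. P i q})" by auto
  then show ?thesis using assms by simp
qed

lemma prod_pairs:
  fixes f :: "nat \<Rightarrow> 'a::comm_monoid_mult"
  shows "(\<Prod>j = 1..2*n. f j) = (\<Prod>k = 1..n. f (2*k - 1) * f (2*k))"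
  by (induction n) (simp_all add: mult_ac)

section \<open>Laurent monomials and the weight of a U-turn matrix\<close>

lemma X_mult: "X i a * X i b = X i (a + b)"
  by (simp add: X_def mult_single single_add)

lemma X_0 [simp]: "X i 0 = 1"
  by (simp add: X_def)

lemma X_power: "X i a ^ k = X i (int k * a)"
  by (induction k) (simp_all add: X_mult algebra_simps)

lemma X_diff: "X i (int a - int b) = X i 1 ^ a * X i (-1) ^ b"
  by (simp add: X_power X_mult)

text \<open>Variables are counted from \<open>0\<close>, like the columns of the determinants.
  \<open>ev j\<close> is t/x, with one \<open>t\<close> for each unit of
  \<open>ua_bar\<close>.\<close>

abbreviation xv :: "nat \<Rightarrow> laurent" where "xv j \<equiv> X (Suc j) 1"
abbreviation ev :: "nat \<Rightarrow> laurent" where "ev j \<equiv> t * X (Suc j) (-1)"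

lemma xv_ev: "xv j * ev j = t"
  using X_mult[of "Suc j" 1 "-1"] by (simp add: mult.left_commute)

lemma ua_term_eq:
  assumes s: "s \<in> ua_chains n m U"
  defines "A \<equiv> chain_ua n m s"
  shows "t ^ (ua_ssi n m A + ua_bar n m A) * (1 + t) ^ ua_neg n m A * ua_wgt n m A =
    (\<Prod>j = 1..2*n. ua_weight m xv ev t j (s j) (s (j - 1)))"
proof -
  let ?ssi = "\<lambda>i. card {q \<in> {1..m}. positive_zero m A i q \<and> (odd i \<and> next_below n A i q 1 \<or>
      even i \<and> (next_below n A i q (-1) \<or> none_below n A i q))}"
  let ?neg = "\<lambda>i. card {q \<in> {1..m}. A (i, q) = -1}"
  let ?bar = "\<lambda>i. if even i then row_count m A i else 0"
  let ?z = "\<lambda>j. if even j then X (j div 2) 1 else X ((j + 1) div 2) (-1)"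
  let ?r = "\<lambda>j. Suc (2*n) - j"
  have bar: "ua_bar n m A = (\<Sum>i = 1..2*n. ?bar i)"
  proof -
    have "ua_bar n m A = card {(i, q). i \<in> {1..2*n} \<and> q \<in> {1..m} \<and> even i \<and> (A (i, q) = 1 \<or> positive_zero m A i q)}"
      unfolding ua_bar_def by (rule arg_cong[of _ _ card]) auto
    also have "\<dots> = (\<Sum>i = 1..2*n. ?bar i)"
      unfolding card_pairs[OF finite_atLeastAtMost finite_atLeastAtMost] by (intro sum.cong) (auto simp: row_count_def)
    finally show ?thesis .
  qed
  have "t ^ (ua_ssi n m A + ua_bar n m A) * (1 + t) ^ ua_neg n m A =
     (\<Prod>i = 1..2*n. t ^ ?ssi i * t ^ ?bar i * (1 + t) ^ ?neg i)"
    unfolding bar ua_ssi_def ua_neg_def card_pairs[OF finite_atLeastAtMost finite_atLeastAtMost]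
    by (simp only: power_add prod.distrib power_sum)
  also have "\<dots> = (\<Prod>j = 1..2*n. t ^ ?ssi (?r j) * t ^ ?bar (?r j) * (1 + t) ^ ?neg (?r j))"
    by (subst prod.atLeastAtMost_rev) (simp only: Suc_eq_plus1)
  finally have 1: "t ^ (ua_ssi n m A + ua_bar n m A) * (1 + t) ^ ua_neg n m A =
     (\<Prod>j = 1..2*n. t ^ ?ssi (?r j) * t ^ ?bar (?r j) * (1 + t) ^ ?neg (?r j))" .
  have 2: "ua_wgt n m A = (\<Prod>j = 1..2*n. ?z j ^ row_count m A (?r j))"
    unfolding prod_pairs ua_wgt_def
  proof (intro prod.cong refl)
    fix k assume "k \<in> {1..n}"
    then have "?r (2*k - 1) = 2*n + 2 - 2*k" "?r (2*k) = 2*n + 1 - 2*k" "odd (2*k - 1)" "(2*k - 1 + 1) div 2 = k"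
      by auto
    then show "X k (int (row_count m A (2*n + 1 - 2*k)) - int (row_count m A (2*n + 2 - 2*k))) =
       ?z (2*k - 1) ^ row_count m A (?r (2*k - 1)) * ?z (2*k) ^ row_count m A (?r (2*k))"
      by (simp add: X_diff mult.commute)
  qed
  show ?thesis
    unfolding 1 2 prod.distrib[symmetric]
  proof (intro prod.cong refl)
    fix j assume j: "j \<in> {1..2*n}"
    have good: "interlace m (s j) (s (j - 1))" "even j \<Longrightarrow> card (s j) = j div 2"
      using s j by (auto simp: ua_chains_def)
    \<comment> \<open>The number of rows is even, so reversal exchanges parities: odd rows are the
      even steps, which belong to unbarred letters.\<close>
    have par: "odd (?r j) \<longleftrightarrow> even j" using j by (auto simp: Suc_diff_le)
    note eqs = row_count_chain[OF s j, folded A_def] row_neg_chain[OF s j, folded A_def]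
      row_shift_chain[OF s j, folded A_def] row_gaps_chain[OF s j, folded A_def]
    show "t ^ ?ssi (?r j) * t ^ ?bar (?r j) * (1 + t) ^ ?neg (?r j) * ?z j ^ row_count m A (?r j) =
        ua_weight m xv ev t j (s j) (s (j - 1))"
    proof (cases "even j")
      case True
      then have "Suc (j div 2 - 1) = j div 2" using j by auto
      moreover have ssi: "?ssi (?r j) = card {q \<in> s j \<inter> s (j - 1). ncard (s (j - 1)) (Suc q) < ncard (s j) (Suc q)}"
        using True par eqs(3) by simp
      moreover have bar: "?bar (?r j) = 0" using True par by simp
      ultimately show ?thesis
        unfolding ssi bar eqs(1,2) using True good
        by (simp add: ua_weight_def row_plain_def mult.commute mult.left_commute)
    next
      case False
      then have "(j + 1) div 2 = Suc (j div 2)" by presburger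
      moreover have ssi: "?ssi (?r j) = card {q \<in> {1..m}. q \<notin> s j \<and> q \<notin> s (j - 1) \<and>
          ncard (s (j - 1)) (Suc q) < ncard (s j) (Suc q)}"
        using False par eqs(4) by simp
      moreover have bar: "?bar (?r j) = row_steps m (s j) (s (j - 1))" using False par eqs(1) by simp
      ultimately show ?thesis
        unfolding ssi bar eqs(1,2) using False good
        by (simp add: ua_weight_def row_bar_def power_mult_distrib mult.commute mult.left_commute)
    qed
  qed
qed

theorem ua_sum_eq_chain_sum:
  assumes U: "U = mu ` {1..n}" "U \<subseteq> {1..m}" and m: "m = mu 1"
  shows "(\<Sum>A \<in> UA n mu. t ^ (ua_ssi n m A + ua_bar n m A) * (1 + t) ^ ua_neg n m A * ua_wgt n m A) =
    chain_sum (Pow {1..m}) (ua_weight m xv ev t) {} (2*n) U"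
proof -
  let ?w = "\<lambda>s. \<Prod>j = 1..2*n. ua_weight m xv ev t j (s j) (s (j - 1))"
  have "(\<Sum>A \<in> UA n mu. t ^ (ua_ssi n m A + ua_bar n m A) * (1 + t) ^ ua_neg n m A * ua_wgt n m A) =
    (\<Sum>s\<in>ua_chains n m U. ?w s)"
  proof (rule sum.reindex_bij_witness[of _ "chain_ua n m" "ua_chain n m"])
    fix A assume A: "A \<in> UA n mu"
    show inv: "chain_ua n m (ua_chain n m A) = A" by (rule chain_ua_of_ua_chain[OF A m])
    show mem: "ua_chain n m A \<in> ua_chains n m U" by (rule ua_chain_mem[OF A U m])
    show "?w (ua_chain n m A) = t ^ (ua_ssi n m A + ua_bar n m A) * (1 + t) ^ ua_neg n m A * ua_wgt n m A"
      using ua_term_eq[OF mem] unfolding inv by simp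
  next
    fix s assume s: "s \<in> ua_chains n m U"
    show "ua_chain n m (chain_ua n m s) = s" by (rule ua_chain_of_chain_ua[OF s])
    show "chain_ua n m s \<in> UA n mu" by (rule chain_ua_mem[OF s U(1) m])
  qed
  \<comment> \<open>Chains that violate interlacing or the U-turn condition have a vanishing factor,
    so they may be added.\<close>
  also have "\<dots> = (\<Sum>s | s \<in> {0..2*n} \<rightarrow>\<^sub>E Pow {1..m} \<and> s 0 = {} \<and> s (2*n) = U. ?w s)"
  proof (rule sum.mono_neutral_left)
    show "finite {s. s \<in> {0..2*n} \<rightarrow>\<^sub>E Pow {1..m} \<and> s 0 = {} \<and> s (2*n) = U}"
      by (rule finite_subset[of _ "{0..2*n} \<rightarrow>\<^sub>E Pow {1..m}"]) (auto intro!: finite_PiE)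
    show "ua_chains n m U \<subseteq> {s. s \<in> {0..2*n} \<rightarrow>\<^sub>E Pow {1..m} \<and> s 0 = {} \<and> s (2*n) = U}"
      by (auto simp: ua_chains_def)
    show "\<forall>s\<in>{s. s \<in> {0..2*n} \<rightarrow>\<^sub>E Pow {1..m} \<and> s 0 = {} \<and> s (2*n) = U} - ua_chains n m U. ?w s = 0"
    proof
      fix s assume "s \<in> {s. s \<in> {0..2*n} \<rightarrow>\<^sub>E Pow {1..m} \<and> s 0 = {} \<and> s (2*n) = U} - ua_chains n m U"
      then obtain j where j: "j \<in> {1..2*n}" "\<not> (interlace m (s j) (s (j - 1)) \<and> (even j \<longrightarrow> card (s j) = j div 2))"
        unfolding ua_chains_def by blast
      have "ua_weight m xv ev t j (s j) (s (j - 1)) = 0"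
        unfolding ua_weight_def by (simp only: j(2) if_False)
      then show "?w s = 0" by (intro prod_zero) (use j in auto)
    qed
  qed
  also have "\<dots> = chain_sum (Pow {1..m}) (ua_weight m xv ev t) {} (2*n) U"
    by (rule chain_sum_eq) (use U in auto)
  finally show ?thesis .
qed

section \<open>Chains of horizontal strips\<close>

text \<open>Partitions are indexed from \<open>0\<close> here.\<close>

definition hstrip :: "(nat \<Rightarrow> nat) \<Rightarrow> (nat \<Rightarrow> nat) \<Rightarrow> bool" where
  "hstrip p p' \<longleftrightarrow> (\<forall>i. p (Suc i) \<le> p' i \<and> p' i \<le> p i)"

text \<open>The vanishing of the rows from \<open>(j + 1) div 2\<close> on is the first-column
  condition of the tableaux.\<close>

definition tab_weight :: "nat \<Rightarrow> (nat \<Rightarrow> 'a::comm_ring_1) \<Rightarrow> (nat \<Rightarrow> 'a) \<Rightarrow> nat \<Rightarrow> (nat \<Rightarrow> nat) \<Rightarrow> (nat \<Rightarrow> nat) \<Rightarrow> 'a" where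
  "tab_weight n x y j p p' =
     (if hstrip p p' \<and> (\<forall>i\<ge>(j + 1) div 2. p i = 0)
      then (if even j then x (j div 2 - 1) else y (j div 2)) ^ (\<Sum>i<n. p i - p' i) else 0)"

text \<open>The staircase makes the parts strictly decreasing, so that horizontal strips become
  interlacing sequences.\<close>

definition beta_seq :: "nat \<Rightarrow> (nat \<Rightarrow> nat) \<Rightarrow> nat \<Rightarrow> nat" where
  "beta_seq k p i = (if i < k then p i + (k - i) else 0)"

lemma dec_seq_beta:
  assumes "\<And>i. p (Suc i) \<le> p i"
  shows "dec_seq k (beta_seq k p)"
proof -
  have "p (Suc i) + (k - Suc i) < p i + (k - i)" if "i < k" for i
    using assms[of i] that by (intro add_le_less_mono) auto
  then show ?thesis by (simp add: dec_seq_def beta_seq_def)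
qed

lemma beta_seq_pos: "i < k \<Longrightarrow> 0 < beta_seq k p i"
  by (simp add: beta_seq_def)

lemma sum_lessThan_bound:
  fixes h :: "nat \<Rightarrow> nat"
  assumes "k \<le> n" "\<And>i. k \<le> i \<Longrightarrow> h i = 0"
  shows "(\<Sum>i<n. h i) = (\<Sum>i<k. h i)"
  by (rule sum.mono_neutral_right) (use assms in auto)

text \<open>A horizontal strip keeps each shifted part strictly above the next shifted part of the
  larger shape. The intervals contain that lower end too, but with \<open>c = a * b\<close> and
  \<open>d = 0\<close> the weight there is \<open>0\<close>.\<close>

lemma tableau_step_plain:
  fixes x :: "'a::comm_ring_1"
  assumes p: "\<And>i. p (Suc i) \<le> p i" "\<And>i. k \<le> i \<Longrightarrow> p i = 0" and k: "k \<le> n"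
  shows "(\<Sum>p' | hstrip p p'. x ^ (\<Sum>i<n. p i - p' i) * seqdet k \<psi> (beta_seq k p')) =
    seqdet k (\<lambda>j. kern x 1 x 0 (\<psi> j)) (beta_seq k p)"
proof -
  let ?f = "beta_seq k p"
  let ?P = "PiE {..<k} (\<lambda>i. {?f (Suc i)..?f i})"
  let ?F = "\<lambda>g. (\<Prod>i<k. stepw x 1 x 0 (?f i) (?f (Suc i)) (g i)) * seqdet k \<psi> g"
  have "(\<Sum>p' | hstrip p p'. x ^ (\<Sum>i<n. p i - p' i) * seqdet k \<psi> (beta_seq k p')) = (\<Sum>g\<in>?P. ?F g)"
  proof (rule sum.reindex_bij_witness_not_neutral[where S' = "{}" and
        T' = "{g \<in> ?P. \<exists>i<k. g i = ?f (Suc i)}" and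
        j = "\<lambda>p'. restrict (beta_seq k p') {..<k}" and
        i = "\<lambda>g i. if i < k then g i - (k - i) else 0"])
    show "finite {g \<in> ?P. \<exists>i<k. g i = ?f (Suc i)}"
      by (rule finite_subset[of _ ?P]) (auto intro!: finite_PiE)
  next
    fix p' assume p': "p' \<in> {p'. hstrip p p'} - {}"
    then have le: "p (Suc i) \<le> p' i" "p' i \<le> p i" for i by (auto simp: hstrip_def)
    have z: "p' i = 0" if "k \<le> i" for i using le(2)[of i] p(2)[OF that] by simp
    show "(\<lambda>i. if i < k then restrict (beta_seq k p') {..<k} i - (k - i) else 0) = p'"
      using z by (auto simp: beta_seq_def fun_eq_iff)
    show "restrict (beta_seq k p') {..<k} \<in> ?P - {g \<in> ?P. \<exists>i<k. g i = ?f (Suc i)}"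
    proof -
      have "?f (Suc i) \<le> beta_seq k p' i" "beta_seq k p' i \<noteq> ?f (Suc i)" "beta_seq k p' i \<le> ?f i" if "i < k" for i
        using le[of i] that by (auto simp: beta_seq_def)
      then show ?thesis
        by (auto intro!: restrict_PiE_iff[THEN iffD2])
    qed
  next
    fix g assume g: "g \<in> ?P - {g \<in> ?P. \<exists>i<k. g i = ?f (Suc i)}"
    then have g0: "g i \<in> {?f (Suc i)..?f i}" "g i \<noteq> ?f (Suc i)" if "i < k" for i
      using that PiE_mem[of g "{..<k}" "\<lambda>i. {?f (Suc i)..?f i}" i] by auto
    have g1: "?f (Suc i) < g i" "g i \<le> ?f i" if "i < k" for i
      using g0[OF that] by auto
    have g2: "p (Suc i) + (k - i) \<le> g i" "g i \<le> p i + (k - i)" if "i < k" for i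
      using g1[OF that] that p(2)[of "Suc i"] by (auto simp: beta_seq_def split: if_splits)
    show "restrict (beta_seq k (\<lambda>i. if i < k then g i - (k - i) else 0)) {..<k} = g"
    proof (rule extensionalityI[of _ "{..<k}"])
      fix i assume "i \<in> {..<k}"
      then show "restrict (beta_seq k (\<lambda>i. if i < k then g i - (k - i) else 0)) {..<k} i = g i"
        using g2(1)[of i] by (simp add: beta_seq_def)
    qed (use g in \<open>auto simp: PiE_iff\<close>)
    show "(\<lambda>i. if i < k then g i - (k - i) else 0) \<in> {p'. hstrip p p'} - {}"
      using g2 p(2) by (force simp: hstrip_def)
  next
    fix g assume "g \<in> {g \<in> ?P. \<exists>i<k. g i = ?f (Suc i)}"
    then obtain i where i: "i < k" "g i = ?f (Suc i)" by auto
    have "?f (Suc i) < ?f i"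
      using dec_seq_beta[of p, OF p(1), of k] i(1) beta_seq_pos[OF i(1)] by (auto simp: dec_seq_def)
    then have "stepw x 1 x 0 (?f i) (?f (Suc i)) (g i) = 0"
      using i by (simp add: stepw_def)
    then have "(\<Prod>i<k. stepw x 1 x 0 (?f i) (?f (Suc i)) (g i)) = 0"
      using i(1) by (intro prod_zero) auto
    then show "?F g = 0" by simp
  next
    fix p' assume p': "p' \<in> {p'. hstrip p p'}"
    then have le: "p (Suc i) \<le> p' i" "p' i \<le> p i" for i by (auto simp: hstrip_def)
    have "stepw x 1 x 0 (?f i) (?f (Suc i)) (beta_seq k p' i) = x ^ (p i - p' i)" if i: "i < k" for i
    proof (cases "p i = p' i")
      case True
      then show ?thesis using i by (simp add: stepw_def beta_seq_def)
    next
      case False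
      then have "p' i < p i" using le(2)[of i] by simp
      then have "p i + (k - i) - (p' i + (k - i)) = Suc (p i - p' i - 1)" "p i - p' i = Suc (p i - p' i - 1)" by auto
      moreover have "?f (Suc i) < p' i + (k - i)" using le(1)[of i] i by (auto simp: beta_seq_def)
      ultimately show ?thesis using i False by (auto simp: stepw_def beta_seq_def simp flip: power_Suc)
    qed
    then have "(\<Prod>i<k. stepw x 1 x 0 (?f i) (?f (Suc i)) (restrict (beta_seq k p') {..<k} i)) =
        x ^ (\<Sum>i<k. p i - p' i)"
      by (simp add: power_sum)
    moreover have "(\<Sum>i<n. p i - p' i) = (\<Sum>i<k. p i - p' i)"
      using k p(2) by (intro sum_lessThan_bound) auto
    moreover have "seqdet k \<psi> (restrict (beta_seq k p') {..<k}) = seqdet k \<psi> (beta_seq k p')"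
      by (rule seqdet_cong) simp
    ultimately show "?F (restrict (beta_seq k p') {..<k}) = x ^ (\<Sum>i<n. p i - p' i) * seqdet k \<psi> (beta_seq k p')"
      by simp
  qed simp_all
  then show ?thesis
    using interlacing_sum[OF dec_seq_beta[of p, OF p(1), of k], of x 1 x 0 \<psi>] by simp
qed

text \<open>The staircase shortens from \<open>k + 1\<close> to \<open>k\<close>, so every shifted
  part drops by at least one; hence \<open>b = 0\<close>, and the power of \<open>y\<close> is one
  less than the drop. The last part becomes \<open>0\<close> and is absorbed by the unit
  column.\<close>

lemma tableau_step_bar:
  fixes y :: "'a::comm_ring_1"
  assumes p: "\<And>i. p (Suc i) \<le> p i" "\<And>i. Suc k \<le> i \<Longrightarrow> p i = 0" and k: "Suc k \<le> n"
  shows "(\<Sum>p' | hstrip p p' \<and> (\<forall>i\<ge>k. p' i = 0). y ^ (\<Sum>i<n. p i - p' i) * seqdet k \<phi> (beta_seq k p')) =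
    seqdet (Suc k) (\<lambda>j. kern y 0 1 1 (extend_unit k \<phi> j)) (beta_seq (Suc k) p)"
proof -
  let ?f = "beta_seq (Suc k) p"
  let ?P = "PiE {..<Suc k} (\<lambda>i. {?f (Suc i)..?f i})"
  let ?F = "\<lambda>g. (\<Prod>i<Suc k. stepw y 0 1 1 (?f i) (?f (Suc i)) (g i)) * seqdet (Suc k) (extend_unit k \<phi>) g"
  let ?Q = "{p'. hstrip p p' \<and> (\<forall>i\<ge>k. p' i = 0)}"
  \<comment> \<open>These terms vanish: a part that stays in place has weight \<open>0\<close>, and
    if the last part stays positive then the unit column is zero.\<close>
  let ?bad = "{g \<in> ?P. (\<exists>i\<le>k. g i = ?f i) \<or> g k \<noteq> 0}"
  have "(\<Sum>p'\<in>?Q. y ^ (\<Sum>i<n. p i - p' i) * seqdet k \<phi> (beta_seq k p')) = (\<Sum>g\<in>?P. ?F g)"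
  proof (rule sum.reindex_bij_witness_not_neutral[where S' = "{}" and T' = ?bad and
        j = "\<lambda>p'. restrict (beta_seq k p') {..<Suc k}" and
        i = "\<lambda>g i. if i < k then g i - (k - i) else 0"])
    show "finite ?bad"
      by (rule finite_subset[of _ ?P]) (auto intro!: finite_PiE)
  next
    fix p' assume p': "p' \<in> ?Q - {}"
    then have le: "p (Suc i) \<le> p' i" "p' i \<le> p i" for i by (auto simp: hstrip_def)
    have z: "p' i = 0" if "k \<le> i" for i using p' that by simp
    show "(\<lambda>i. if i < k then restrict (beta_seq k p') {..<Suc k} i - (k - i) else 0) = p'"
      using z by (auto simp: beta_seq_def fun_eq_iff)
    have "?f (Suc i) \<le> beta_seq k p' i" "beta_seq k p' i \<le> ?f i" "beta_seq k p' i \<noteq> ?f i" if "i \<le> k" for i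
      using le[of i] that by (auto simp: beta_seq_def)
    moreover have "beta_seq k p' k = 0" by (simp add: beta_seq_def)
    ultimately show "restrict (beta_seq k p') {..<Suc k} \<in> ?P - ?bad"
      by (auto simp: less_Suc_eq_le intro!: restrict_PiE_iff[THEN iffD2])
  next
    fix g assume g: "g \<in> ?P - ?bad"
    then have g1: "?f (Suc i) \<le> g i" "g i \<le> ?f i" if "i \<le> k" for i
      using that by (auto simp: PiE_iff)
    have g0: "g k = 0" and gn: "g i \<noteq> ?f i" if "i \<le> k" for i
      using g that by auto
    have g2: "p (Suc i) + (k - i) \<le> g i" "g i \<le> p i + (k - i)" if "i < k" for i
      using g1[of i] gn[of i] that by (auto simp: beta_seq_def)
    show "restrict (beta_seq k (\<lambda>i. if i < k then g i - (k - i) else 0)) {..<Suc k} = g"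
    proof (rule extensionalityI[of _ "{..<Suc k}"])
      fix i assume "i \<in> {..<Suc k}"
      then show "restrict (beta_seq k (\<lambda>i. if i < k then g i - (k - i) else 0)) {..<Suc k} i = g i"
        using g2(1)[of i] g0 by (cases "i = k") (auto simp: beta_seq_def)
    qed (use g in \<open>auto simp: PiE_iff\<close>)
    show "(\<lambda>i. if i < k then g i - (k - i) else 0) \<in> ?Q - {}"
      using g2 p(2) by (force simp: hstrip_def)
  next
    fix g assume g: "g \<in> ?bad"
    show "?F g = 0"
    proof (cases "\<exists>i\<le>k. g i = ?f i")
      case True
      then obtain i where i: "i < Suc k" "g i = ?f i" by (auto simp: less_Suc_eq_le)
      then have "stepw y 0 1 1 (?f i) (?f (Suc i)) (g i) = 0"
        using beta_seq_pos[of i "Suc k" p] by (simp add: stepw_def)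
      then have "(\<Prod>i<Suc k. stepw y 0 1 1 (?f i) (?f (Suc i)) (g i)) = 0"
        using i(1) by (intro prod_zero) auto
      then show ?thesis by simp
    next
      case False
      then have gk: "g k \<noteq> 0" using g by auto
      have "g i \<noteq> 0" if "i \<le> k" for i
      proof (cases "i = k")
        case False
        then have "?f (Suc i) \<le> g i" "0 < ?f (Suc i)"
          using g that PiE_mem[of g "{..<Suc k}" "\<lambda>i. {?f (Suc i)..?f i}" i] beta_seq_pos[of "Suc i" "Suc k" p]
          by auto
        then show ?thesis by simp
      qed (use gk in simp)
      then have "seqdet (Suc k) (extend_unit k \<phi>) g = 0"
        by (intro seqdet_last_zero) (simp add: extend_unit_def)
      then show ?thesis by simp
    qed
  next
    fix p' assume p': "p' \<in> ?Q"
    then have le: "p (Suc i) \<le> p' i" "p' i \<le> p i" for i by (auto simp: hstrip_def)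
    have z: "p' i = 0" if "k \<le> i" for i using p' that by simp
    have "stepw y 0 1 1 (?f i) (?f (Suc i)) (beta_seq k p' i) = y ^ (p i - p' i)" if i: "i < Suc k" for i
    proof -
      have lt: "beta_seq k p' i < ?f i" and e: "?f i - beta_seq k p' i - 1 = p i - p' i"
        using le[of i] i z[of i] by (auto simp: beta_seq_def)
      have "stepw y 0 1 1 q l r = y ^ (q - r - 1)" if "r < q" for q l r
        using that by (auto simp: stepw_def)
      from this[OF lt] show ?thesis by (simp only: e)
    qed
    then have "(\<Prod>i<Suc k. stepw y 0 1 1 (?f i) (?f (Suc i)) (restrict (beta_seq k p') {..<Suc k} i)) =
        y ^ (\<Sum>i<Suc k. p i - p' i)"
      by (simp add: power_sum del: prod.lessThan_Suc sum.lessThan_Suc)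
    moreover have "(\<Sum>i<n. p i - p' i) = (\<Sum>i<Suc k. p i - p' i)"
      using k p(2) by (intro sum_lessThan_bound) auto
    moreover have "seqdet (Suc k) (extend_unit k \<phi>) (restrict (beta_seq k p') {..<Suc k}) =
        seqdet (Suc k) (extend_unit k \<phi>) (beta_seq k p')"
      by (rule seqdet_cong) simp
    moreover have "\<dots> = seqdet k \<phi> (beta_seq k p')"
      by (rule seqdet_last_unit) (auto simp: beta_seq_def)
    ultimately show "?F (restrict (beta_seq k p') {..<Suc k}) = y ^ (\<Sum>i<n. p i - p' i) * seqdet k \<phi> (beta_seq k p')"
      by simp
  qed simp_all
  then show ?thesis
    using interlacing_sum[OF dec_seq_beta[of p, OF p(1), of "Suc k"], of y 0 1 1 "extend_unit k \<phi>"] by simp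
qed

text \<open>The first-column condition confines the shape after \<open>2 * k\<close> steps to
  \<open>k\<close> rows.\<close>

lemma chain_sum_tab_weight_0:
  assumes "k \<le> i" "p i \<noteq> 0"
  shows "chain_sum M (tab_weight n x y) (\<lambda>_. 0) (2 * k) p = 0"
proof (cases k)
  case 0
  then show ?thesis using assms by auto
next
  case (Suc k')
  then have "tab_weight n x y (2 * k) p p' = 0" for p'
    using assms by (auto simp: tab_weight_def)
  then show ?thesis by (simp add: Suc)
qed

text \<open>The same induction as for the matrices. Closure of \<open>M\<close> under smaller shapes
  makes the sum over \<open>M\<close> reach every horizontal strip.\<close>

theorem tab_chains_alternant:
  fixes x y :: "nat \<Rightarrow> 'a::comm_ring_1"
  assumes xy: "\<And>j. x j * y j = \<sigma>" and M: "finite M" "\<And>p p'. p \<in> M \<Longrightarrow> (\<And>i. p' i \<le> p i) \<Longrightarrow> p' \<in> M"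
    and "k \<le> n" "p \<in> M" "\<And>i. p (Suc i) \<le> p i" "\<And>i. k \<le> i \<Longrightarrow> p i = 0"
  shows "vprod (\<lambda>j. x j + y j) k * chain_sum M (tab_weight n x y) (\<lambda>_. 0) (2 * k) p = alternant k x y (beta_seq k p)"
  using assms(4-)
proof (induction k arbitrary: p)
  case 0
  then have "p = (\<lambda>_. 0)" by auto
  then show ?case by (simp add: vprod_def alternant_def seqdet_def)
next
  case (Suc k)
  let ?w = "tab_weight n x y"
  let ?c = "\<lambda>j. x j + y j"
  let ?z = "\<lambda>_::nat. 0::nat"
  let ?\<phi> = "\<lambda>j. usum (x j) (y j)"
  have strip_antimono: "p' (Suc i) \<le> p' i" if "hstrip p p'" for p p' :: "nat \<Rightarrow> nat" and i
    using that unfolding hstrip_def by (meson le_trans)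
  have strip_M: "p' \<in> M" if "hstrip p p'" "p \<in> M" for p p'
    using that M(2) unfolding hstrip_def by blast
  have inner: "vprod ?c k * chain_sum M ?w ?z (Suc (2 * k)) p' =
      seqdet (Suc k) (\<lambda>j. kern (y k) 0 1 1 (extend_unit k ?\<phi> j)) (beta_seq (Suc k) p')"
    if p': "p' \<in> M" "\<And>i. p' (Suc i) \<le> p' i" "\<And>i. Suc k \<le> i \<Longrightarrow> p' i = 0" for p'
  proof -
    have "vprod ?c k * chain_sum M ?w ?z (Suc (2 * k)) p' =
        (\<Sum>p''\<in>M. ?w (Suc (2 * k)) p' p'' * (vprod ?c k * chain_sum M ?w ?z (2 * k) p''))"
      by (simp add: sum_distrib_left mult.left_commute)
    also have "\<dots> = (\<Sum>p'' | hstrip p' p'' \<and> (\<forall>i\<ge>k. p'' i = 0).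
        ?w (Suc (2 * k)) p' p'' * (vprod ?c k * chain_sum M ?w ?z (2 * k) p''))"
    proof (rule sum.mono_neutral_right[OF M(1)])
      show "{p''. hstrip p' p'' \<and> (\<forall>i\<ge>k. p'' i = 0)} \<subseteq> M" using strip_M p'(1) by blast
      show "\<forall>p''\<in>M - {p''. hstrip p' p'' \<and> (\<forall>i\<ge>k. p'' i = 0)}.
          ?w (Suc (2 * k)) p' p'' * (vprod ?c k * chain_sum M ?w ?z (2 * k) p'') = 0"
      proof
        fix p'' assume "p'' \<in> M - {p''. hstrip p' p'' \<and> (\<forall>i\<ge>k. p'' i = 0)}"
        then consider "\<not> hstrip p' p''" | i where "k \<le> i" "p'' i \<noteq> 0" by blast
        then show "?w (Suc (2 * k)) p' p'' * (vprod ?c k * chain_sum M ?w ?z (2 * k) p'') = 0"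
          by cases (simp_all add: tab_weight_def chain_sum_tab_weight_0)
      qed
    qed
    also have "\<dots> = (\<Sum>p'' | hstrip p' p'' \<and> (\<forall>i\<ge>k. p'' i = 0).
        y k ^ (\<Sum>i<n. p' i - p'' i) * seqdet k ?\<phi> (beta_seq k p''))"
    proof (intro sum.cong refl arg_cong2[where f = "(*)"])
      fix p'' assume p'': "p'' \<in> {p''. hstrip p' p'' \<and> (\<forall>i\<ge>k. p'' i = 0)}"
      then show "?w (Suc (2 * k)) p' p'' = y k ^ (\<Sum>i<n. p' i - p'' i)"
        using p'(3) by (simp add: tab_weight_def)
      show "vprod ?c k * chain_sum M ?w ?z (2 * k) p'' = seqdet k ?\<phi> (beta_seq k p'')"
        using Suc.IH[of p''] Suc.prems(1) p'' strip_M[of p' p''] strip_antimono[of p' p''] p'(1)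
        by (simp add: alternant_def)
    qed
    also have "\<dots> = seqdet (Suc k) (\<lambda>j. kern (y k) 0 1 1 (extend_unit k ?\<phi> j)) (beta_seq (Suc k) p')"
      by (rule tableau_step_bar[of p' k n, OF p'(2,3) Suc.prems(1)])
    finally show ?thesis .
  qed
  have two: "2 * Suc k = Suc (Suc (2 * k))" by simp
  have "vprod ?c k * chain_sum M ?w ?z (2 * Suc k) p =
      (\<Sum>p'\<in>M. ?w (Suc (Suc (2 * k))) p p' * (vprod ?c k * chain_sum M ?w ?z (Suc (2 * k)) p'))"
    unfolding two chain_sum.simps(2)[of M ?w ?z "Suc (2 * k)"] by (simp only: sum_distrib_left mult.left_commute)
  also have "\<dots> = (\<Sum>p' | hstrip p p'. ?w (Suc (Suc (2 * k))) p p' * (vprod ?c k * chain_sum M ?w ?z (Suc (2 * k)) p'))"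
  proof (rule sum.mono_neutral_right[OF M(1)])
    show "{p'. hstrip p p'} \<subseteq> M" using strip_M Suc.prems(2) by blast
    show "\<forall>p'\<in>M - {p'. hstrip p p'}. ?w (Suc (Suc (2 * k))) p p' * (vprod ?c k * chain_sum M ?w ?z (Suc (2 * k)) p') = 0"
      by (auto simp: tab_weight_def)
  qed
  also have "\<dots> = (\<Sum>p' | hstrip p p'. x k ^ (\<Sum>i<n. p i - p' i) *
      seqdet (Suc k) (\<lambda>j. kern (y k) 0 1 1 (extend_unit k ?\<phi> j)) (beta_seq (Suc k) p'))"
  proof (intro sum.cong refl arg_cong2[where f = "(*)"])
    fix p' assume p': "p' \<in> {p'. hstrip p p'}"
    then show "?w (Suc (Suc (2 * k))) p p' = x k ^ (\<Sum>i<n. p i - p' i)"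
      using Suc.prems(4) by (simp add: tab_weight_def)
    show "vprod ?c k * chain_sum M ?w ?z (Suc (2 * k)) p' =
        seqdet (Suc k) (\<lambda>j. kern (y k) 0 1 1 (extend_unit k ?\<phi> j)) (beta_seq (Suc k) p')"
    proof (rule inner)
      show "p' \<in> M" using p' strip_M Suc.prems(2) by blast
      show "p' (Suc i) \<le> p' i" for i using p' strip_antimono by blast
      show "p' i = 0" if "Suc k \<le> i" for i
      proof -
        have "p' i \<le> p i" using p' by (simp add: hstrip_def)
        then show ?thesis using Suc.prems(4)[OF that] by simp
      qed
    qed
  qed
  also have "\<dots> = seqdet (Suc k) (\<lambda>j. kern (x k) 1 (x k) 0 (kern (y k) 0 1 1 (extend_unit k ?\<phi> j))) (beta_seq (Suc k) p)"
    by (rule tableau_step_plain[of p "Suc k" n, OF Suc.prems(3,4,1)])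
  finally have "(\<Prod>j<k. ?c j - ?c k) * (vprod ?c k * chain_sum M ?w ?z (2 * Suc k) p) =
      (\<Prod>j<k. ?c j - ?c k) * seqdet (Suc k) (\<lambda>j. kern (x k) 1 (x k) 0 (kern (y k) 0 1 1 (extend_unit k ?\<phi> j))) (beta_seq (Suc k) p)"
    by simp
  also have "\<dots> = alternant (Suc k) x y (beta_seq (Suc k) p)"
    by (rule alternant_tableau) (use xy beta_seq_pos in auto)
  finally have "(\<Prod>j<k. ?c j - ?c k) * (vprod ?c k * chain_sum M ?w ?z (2 * Suc k) p) = alternant (Suc k) x y (beta_seq (Suc k) p)" .
  moreover have "vprod ?c (Suc k) = (\<Prod>j<k. ?c j - ?c k) * vprod ?c k"
    by (simp add: vprod_def)
  ultimately show ?case by (simp only: mult.assoc)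
qed

section \<open>Symplectic tableaux as chains of partitions\<close>

text \<open>Step \<open>j\<close> adds the letter of rank \<open>Suc j\<close>, because the smallest
  letter \<open>Bar 1\<close> has rank \<open>2\<close>.\<close>

definition letter_of :: "nat \<Rightarrow> letter" where
  "letter_of j = (if even j then Plain (j div 2) else Bar ((j + 1) div 2))"

lemma letter_rank_letter_of [simp]: "letter_rank (letter_of j) = Suc j"
  by (auto simp: letter_of_def elim: oddE)

lemma letter_of_in_letters: "1 \<le> j \<Longrightarrow> j \<le> 2*n \<Longrightarrow> letter_of j \<in> letters n"
  by (auto simp: letter_of_def letters_def elim!: evenE oddE)

lemma letter_of_letter_rank: "a \<in> letters n \<Longrightarrow> letter_of (letter_rank a - 1) = a \<and> 2 \<le> letter_rank a \<and> letter_rank a \<le> Suc (2*n)"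
  by (auto simp: letters_def letter_of_def)

definition tab_chain :: "nat \<Rightarrow> (nat \<Rightarrow> nat) \<Rightarrow> (nat \<times> nat \<Rightarrow> letter) \<Rightarrow> nat \<Rightarrow> nat \<Rightarrow> nat" where
  "tab_chain n lam T = (\<lambda>j\<in>{0..2*n}. \<lambda>i. card {c. (Suc i, c) \<in> diagram n lam \<and> letter_rank (T (Suc i, c)) \<le> Suc j})"

definition chain_tab :: "nat \<Rightarrow> (nat \<Rightarrow> nat) \<Rightarrow> (nat \<Rightarrow> nat \<Rightarrow> nat) \<Rightarrow> nat \<times> nat \<Rightarrow> letter" where
  "chain_tab n lam s = (\<lambda>(i, c)\<in>diagram n lam. letter_of (LEAST j. c \<le> s j (i - 1)))"

definition subshapes :: "(nat \<Rightarrow> nat) \<Rightarrow> (nat \<Rightarrow> nat) set" where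
  "subshapes lam = {p. \<forall>i. p i \<le> lam (Suc i)}"

definition tab_chains :: "nat \<Rightarrow> (nat \<Rightarrow> nat) \<Rightarrow> (nat \<Rightarrow> nat \<Rightarrow> nat) set" where
  "tab_chains n lam = {s \<in> {0..2*n} \<rightarrow>\<^sub>E subshapes lam. s 0 = (\<lambda>_. 0) \<and> s (2*n) = (\<lambda>i. lam (Suc i)) \<and>
     (\<forall>j\<in>{1..2*n}. hstrip (s j) (s (j - 1)) \<and> (\<forall>i\<ge>(j + 1) div 2. s j i = 0))}"

lemma partition_at_most_zero: "partition_at_most n lam \<Longrightarrow> n \<le> i \<Longrightarrow> lam (Suc i) = 0"
  by (simp add: partition_at_most_def)

lemma finite_subshapes:
  assumes "partition_at_most n lam"
  shows "finite (subshapes lam)"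
proof (rule finite_subset)
  show "subshapes lam \<subseteq> (\<lambda>g i. if i < n then g i else 0) ` PiE {..<n} (\<lambda>i. {..lam (Suc i)})"
  proof
    fix p assume p: "p \<in> subshapes lam"
    have "p = (\<lambda>i. if i < n then restrict p {..<n} i else 0)"
    proof
      fix i
      show "p i = (if i < n then restrict p {..<n} i else 0)"
        using p partition_at_most_zero[OF assms, of i] by (cases "i < n") (auto simp: subshapes_def dest: spec[of _ i])
    qed
    moreover have "restrict p {..<n} \<in> PiE {..<n} (\<lambda>i. {..lam (Suc i)})"
      using p by (auto simp: subshapes_def)
    ultimately show "p \<in> (\<lambda>g i. if i < n then g i else 0) ` PiE {..<n} (\<lambda>i. {..lam (Suc i)})"
      by blast
  qed
qed (auto intro!: finite_imageI finite_PiE)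

lemma diagram_Suc: "(Suc i, c) \<in> diagram n lam \<longleftrightarrow> i < n \<and> 1 \<le> c \<and> c \<le> lam (Suc i)"
  by (auto simp: diagram_def)

lemma diagram_cases:
  assumes "x \<in> diagram n lam"
  obtains i c where "x = (Suc i, c)"
proof -
  have "x = (Suc (fst x - 1), snd x)" using assms by (auto simp: diagram_def)
  then show ?thesis by (rule that)
qed

text \<open>Rows increase weakly, so the cells with entries up to a given letter form an initial
  segment of their row.\<close>

lemma le_tab_chain_iff:
  assumes T: "T \<in> sp_tableaux n lam" and "j \<le> 2*n" "(Suc i, c) \<in> diagram n lam"
  shows "c \<le> tab_chain n lam T j i \<longleftrightarrow> letter_rank (T (Suc i, c)) \<le> Suc j"
proof -
  let ?P = "{c. (Suc i, c) \<in> diagram n lam \<and> letter_rank (T (Suc i, c)) \<le> Suc j}"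
  have fin: "finite ?P"
    by (rule finite_subset[of _ "{..lam (Suc i)}"]) (auto simp: diagram_Suc)
  have down: "q \<in> ?P" if "p \<in> ?P" "q \<le> p" "1 \<le> q" for p q
  proof (cases "q = p")
    case False
    have d: "(Suc i, q) \<in> diagram n lam" "(Suc i, p) \<in> diagram n lam" "q < p"
      using that False by (auto simp: diagram_Suc)
    then have "T (Suc i, q) \<le> T (Suc i, p)" using T unfolding sp_tableaux_def by blast
    then show ?thesis using that d by (auto simp: less_eq_letter_def)
  qed (use that in simp)
  have "c \<le> card ?P \<longleftrightarrow> c \<in> ?P"
    by (rule mem_initial_segment[OF fin down]) (use assms(3) in \<open>auto simp: diagram_Suc\<close>)
  then show ?thesis using assms by (simp add: tab_chain_def)
qed

lemma tab_chain_le: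
  assumes "j \<le> 2*n"
  shows "tab_chain n lam T j i \<le> lam (Suc i)" and "n \<le> i \<Longrightarrow> tab_chain n lam T j i = 0"
proof -
  have "card {c. (Suc i, c) \<in> diagram n lam \<and> letter_rank (T (Suc i, c)) \<le> Suc j} \<le> card {1..lam (Suc i)}"
    by (rule card_mono) (auto simp: diagram_Suc)
  then show "tab_chain n lam T j i \<le> lam (Suc i)" using assms by (simp add: tab_chain_def)
  show "n \<le> i \<Longrightarrow> tab_chain n lam T j i = 0" using assms by (simp add: tab_chain_def diagram_Suc)
qed

lemma tab_chain_cell:
  assumes "j \<le> 2*n" "1 \<le> c" "c \<le> tab_chain n lam T j i"
  shows "(Suc i, c) \<in> diagram n lam"
proof -
  have "i < n" using tab_chain_le(2)[OF assms(1), of i lam T] assms(2,3) by (cases "i < n") auto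
  then show ?thesis
    using tab_chain_le(1)[OF assms(1), of lam T i] assms(2,3) by (simp add: diagram_Suc)
qed

lemma tab_chain_mem:
  assumes T: "T \<in> sp_tableaux n lam" and lam: "partition_at_most n lam"
  shows "tab_chain n lam T \<in> tab_chains n lam"
proof -
  let ?s = "tab_chain n lam T"
  have letters: "T (i, c) \<in> letters n" if "(i, c) \<in> diagram n lam" for i c
    using T that by (auto simp: sp_tableaux_def PiE_iff)
  have s0: "?s 0 i = 0" for i
  proof (rule ccontr)
    assume "?s 0 i \<noteq> 0"
    then have c: "1 \<le> ?s 0 i" by simp
    note d = tab_chain_cell[OF le0 c order_refl]
    have "letter_rank (T (Suc i, ?s 0 i)) \<le> Suc 0"
      using le_tab_chain_iff[OF T le0 d] by blast
    then show False using letter_of_letter_rank[OF letters[OF d]] by simp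
  qed
  have s2n: "?s (2*n) i = lam (Suc i)" for i
  proof (cases "lam (Suc i) = 0")
    case True
    then show ?thesis using tab_chain_le(1)[OF order_refl, of n lam T i] by simp
  next
    case False
    then have "i < n" using partition_at_most_zero[OF lam, of i] by (cases "i < n") auto
    then have d: "(Suc i, lam (Suc i)) \<in> diagram n lam" using False by (simp add: diagram_Suc)
    then have "lam (Suc i) \<le> ?s (2*n) i"
      using le_tab_chain_iff[OF T _ d, of "2*n"] letter_of_letter_rank[OF letters[OF d]] by simp
    then show ?thesis using tab_chain_le(1)[OF order_refl, of n lam T i] by simp
  qed
  have strip: "?s j (Suc i) \<le> ?s (j - 1) i" "?s (j - 1) i \<le> ?s j i" if j: "j \<in> {1..2*n}" for i j
  proof -
    have j': "j \<le> 2*n" "j - 1 \<le> 2*n" "Suc (j - 1) = j" using j by auto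
    show "?s (j - 1) i \<le> ?s j i"
    proof (cases "?s (j - 1) i = 0")
      case False
      then have c: "1 \<le> ?s (j - 1) i" by simp
      note d = tab_chain_cell[OF j'(2) c order_refl]
      show ?thesis using le_tab_chain_iff[OF T j'(2) d] le_tab_chain_iff[OF T j'(1) d] by simp
    qed simp
    show "?s j (Suc i) \<le> ?s (j - 1) i"
    proof (cases "?s j (Suc i) = 0")
      case False
      define c where "c = ?s j (Suc i)"
      have c: "1 \<le> c" "c \<le> ?s j (Suc i)" using False by (auto simp: c_def)
      note d = tab_chain_cell[OF j'(1) c]
      have "lam (Suc (Suc i)) \<le> lam (Suc i)" using lam by (simp add: partition_at_most_def)
      then have d': "(Suc i, c) \<in> diagram n lam" using d by (auto simp: diagram_Suc)
      \<comment> \<open>Column strictness gives the strip condition: a cell filled by step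
        \<open>j\<close> has the cell above it filled by step \<open>j - 1\<close>.\<close>
      then have "T (Suc i, c) < T (Suc (Suc i), c)"
        using T d unfolding sp_tableaux_def by blast
      moreover have "letter_rank (T (Suc (Suc i), c)) \<le> Suc j"
        using le_tab_chain_iff[OF T j'(1) d] c by simp
      ultimately have "c \<le> ?s (j - 1) i"
        using le_tab_chain_iff[OF T j'(2) d'] j'(3) by (simp add: less_letter_def)
      then show ?thesis by (simp add: c_def)
    qed simp
  qed
  have rows: "?s j i = 0" if j: "j \<in> {1..2*n}" and i: "(j + 1) div 2 \<le> i" for i j
  proof (rule ccontr)
    assume "?s j i \<noteq> 0"
    then have c: "1 \<le> ?s j i" by simp
    have j': "j \<le> 2*n" using j by simp
    have d: "(Suc i, 1) \<in> diagram n lam" using tab_chain_cell[OF j' order_refl c] .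
    \<comment> \<open>\<open>Bar (Suc i)\<close> has rank \<open>2*i + 2\<close>, so this row is
      empty before step \<open>2*i + 1\<close>.\<close>
    then have "Bar (Suc i) \<le> T (Suc i, 1)" using T unfolding sp_tableaux_def by blast
    moreover have "letter_rank (T (Suc i, 1)) \<le> Suc j"
      using le_tab_chain_iff[OF T j' d] c by simp
    ultimately show False using i by (simp add: less_eq_letter_def)
  qed
  have "?s \<in> {0..2*n} \<rightarrow>\<^sub>E subshapes lam"
  proof (rule PiE_I)
    fix j assume "j \<in> {0..2*n}"
    then show "?s j \<in> subshapes lam" using tab_chain_le(1)[where j = j and n = n and lam = lam and T = T] by (simp add: subshapes_def)
  qed (simp add: tab_chain_def)
  then show ?thesis
    using s0 s2n strip rows by (auto simp: tab_chains_def hstrip_def fun_eq_iff)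
qed

context
  fixes n :: nat and lam :: "nat \<Rightarrow> nat" and s :: "nat \<Rightarrow> nat \<Rightarrow> nat"
  assumes s: "s \<in> tab_chains n lam" and lam: "partition_at_most n lam"
begin

lemma tab_chains_mono:
  assumes "j \<le> j'" "j' \<le> 2*n"
  shows "s j i \<le> s j' i"
  using assms
proof (induction rule: dec_induct)
  case (step k)
  then have "Suc k \<in> {1..2*n}" by simp
  moreover have "\<forall>j\<in>{1..2*n}. hstrip (s j) (s (j - 1))" using s by (auto simp: tab_chains_def)
  ultimately have "hstrip (s (Suc k)) (s k)" by (metis diff_Suc_1)
  then show ?case using step by (simp add: hstrip_def) (meson le_trans)
qed simp

text \<open>The shapes grow with \<open>j\<close>, so a cell is present from its first step on; that
  step is not \<open>0\<close> because the chain starts with the empty shape.\<close>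

lemma tab_chains_level:
  assumes d: "(Suc i, c) \<in> diagram n lam"
  defines "l \<equiv> (LEAST j. c \<le> s j i)"
  shows "j \<le> 2*n \<Longrightarrow> l \<le> j \<longleftrightarrow> c \<le> s j i" and "l \<in> {1..2*n}" and "c \<le> s l i"
    and "chain_tab n lam s (Suc i, c) = letter_of l"
proof -
  have "s (2*n) i = lam (Suc i)" "s 0 i = 0" using s by (auto simp: tab_chains_def)
  then have c2n: "c \<le> s (2*n) i" and c0: "\<not> c \<le> s 0 i" using d by (auto simp: diagram_Suc)
  show l: "c \<le> s l i" unfolding l_def using c2n by (rule LeastI)
  have l2n: "l \<le> 2*n" unfolding l_def using c2n by (rule Least_le)
  have "l \<noteq> 0" using l c0 by metis
  then show "l \<in> {1..2*n}" using l2n by auto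
  show "l \<le> j \<longleftrightarrow> c \<le> s j i" if "j \<le> 2*n"
  proof
    assume "l \<le> j"
    then show "c \<le> s j i" using l tab_chains_mono[of l j i] that by simp
  qed (unfold l_def, rule Least_le)
  show "chain_tab n lam s (Suc i, c) = letter_of l"
    using d by (simp add: chain_tab_def l_def)
qed

lemma chain_tab_rank:
  assumes d: "(Suc i, c) \<in> diagram n lam" and "j \<le> 2*n"
  shows "letter_rank (chain_tab n lam s (Suc i, c)) \<le> Suc j \<longleftrightarrow> c \<le> s j i"
  unfolding tab_chains_level(4)[OF d] using tab_chains_level(1)[OF assms] by simp

lemma chain_tab_mem: "chain_tab n lam s \<in> sp_tableaux n lam"
proof -
  let ?T = "chain_tab n lam s"
  have strip: "hstrip (s j) (s (j - 1))" and rows: "\<And>i. (j + 1) div 2 \<le> i \<Longrightarrow> s j i = 0" if "j \<in> {1..2*n}" for j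
    using s that by (auto simp: tab_chains_def)
  have "?T \<in> diagram n lam \<rightarrow>\<^sub>E letters n"
  proof (rule PiE_I)
    fix x assume x: "x \<in> diagram n lam"
    then obtain i c where ic: "x = (Suc i, c)" by (auto elim: diagram_cases)
    show "?T x \<in> letters n"
      using tab_chains_level(2,4)[of i c] x letter_of_in_letters unfolding ic by simp
  qed (simp add: chain_tab_def)
  moreover have "?T (i, c) \<le> ?T (i, c')"
    if "(i, c) \<in> diagram n lam" "(i, c') \<in> diagram n lam" "c < c'" for i c c'
  proof -
    have "1 \<le> i" using that(1) by (simp add: diagram_def)
    then obtain i' where i: "i = Suc i'" by (cases i) auto
    note d = that(1,2)[unfolded i]
    have "(LEAST j. c \<le> s j i') \<le> (LEAST j. c' \<le> s j i')"
      using tab_chains_level(3)[OF d(2)] that(3) by (intro Least_le) simp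
    then show ?thesis unfolding i tab_chains_level(4)[OF d(1)] tab_chains_level(4)[OF d(2)] by (simp add: less_eq_letter_def)
  qed
  moreover have "?T (i, c) < ?T (i', c)"
    if "(i, c) \<in> diagram n lam" "(i', c) \<in> diagram n lam" "i < i'" for i i' c
  proof -
    have "1 \<le> i" using that(1) by (simp add: diagram_def)
    then obtain a b where ab: "i = Suc a" "i' = Suc b" "a < b"
      using \<open>i < i'\<close> by (cases i; cases i') auto
    note d = that(1)[unfolded ab] that(2)[unfolded ab]
    let ?l = "LEAST j. c \<le> s j b"
    have l: "?l \<in> {1..2*n}" by (rule tab_chains_level(2)[OF d(2)])
    then have h: "s ?l (Suc i) \<le> s (?l - 1) i" "s (?l - 1) i \<le> s ?l i" for i
      using strip[OF l] by (auto simp: hstrip_def)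
    have "s ?l b \<le> s ?l (Suc a)"
    proof (rule lift_Suc_antimono_le[of "s ?l"])
      show "s ?l (Suc i) \<le> s ?l i" for i using h[of i] by linarith
      show "Suc a \<le> b" using ab(3) by simp
    qed
    \<comment> \<open>By the strip condition a cell of row \<open>b\<close> present at step
      \<open>?l\<close> forces the cell of row \<open>a\<close> in the same column to be present one
      step earlier.\<close>
    then have "c \<le> s (?l - 1) a"
      using tab_chains_level(3)[OF d(2)] h(1)[of a] by linarith
    then have "(LEAST j. c \<le> s j a) \<le> ?l - 1" by (rule Least_le)
    then have "(LEAST j. c \<le> s j a) < ?l" using l by (cases ?l) auto
    then show ?thesis
      unfolding ab tab_chains_level(4)[OF d(1)] tab_chains_level(4)[OF d(2)]
      by (simp add: less_letter_def)
  qed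
  moreover have "Bar i \<le> ?T (i, 1)" if "(i, 1) \<in> diagram n lam" for i
  proof -
    have "1 \<le> i" using that by (simp add: diagram_def)
    then obtain i' where i: "i = Suc i'" by (cases i) auto
    note d = that[unfolded i]
    let ?l = "LEAST j. 1 \<le> s j i'"
    have "s ?l i' \<noteq> 0" using tab_chains_level(3)[OF d] by linarith
    then have "i' < (?l + 1) div 2" using rows[OF tab_chains_level(2)[OF d], of i'] by (meson not_le)
    then show ?thesis unfolding i tab_chains_level(4)[OF d] by (simp add: less_eq_letter_def)
  qed
  ultimately show ?thesis unfolding sp_tableaux_def by blast
qed

lemma tab_chain_of_chain_tab: "tab_chain n lam (chain_tab n lam s) = s"
proof (rule extensionalityI[of _ "{0..2*n}"])
  show "tab_chain n lam (chain_tab n lam s) \<in> extensional {0..2*n}" by (simp add: tab_chain_def)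
  show "s \<in> extensional {0..2*n}" using s by (auto simp: tab_chains_def PiE_iff)
  fix j assume j: "j \<in> {0..2*n}"
  show "tab_chain n lam (chain_tab n lam s) j = s j"
  proof
    fix i
    have le: "s j i \<le> lam (Suc i)"
      using s PiE_mem[of s "{0..2*n}" "\<lambda>_. subshapes lam" j] j by (auto simp: tab_chains_def subshapes_def)
    have "{c. (Suc i, c) \<in> diagram n lam \<and> letter_rank (chain_tab n lam s (Suc i, c)) \<le> Suc j} =
        {c. (Suc i, c) \<in> diagram n lam \<and> c \<le> s j i}"
      using chain_tab_rank j by auto
    also have "\<dots> = {1..s j i}"
      using le partition_at_most_zero[OF lam, of i] by (cases "i < n") (auto simp: diagram_Suc)
    finally show "tab_chain n lam (chain_tab n lam s) j i = s j i"
      using j by (simp add: tab_chain_def)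
  qed
qed

lemma tab_count_chain:
  assumes j: "j \<in> {1..2*n}"
  shows "tab_count n lam (chain_tab n lam s) (letter_of j) = (\<Sum>i<n. s j i - s (j - 1) i)"
proof -
  let ?T = "chain_tab n lam s"
  have j': "j \<le> 2*n" "j - 1 \<le> 2*n" "Suc (j - 1) = j" using j by auto
  have le: "s j i \<le> lam (Suc i)" for i
    using s PiE_mem[of s "{0..2*n}" "\<lambda>_. subshapes lam" j] j by (auto simp: tab_chains_def subshapes_def)
  have eq: "?T (Suc i, c) = letter_of j \<longleftrightarrow> s (j - 1) i < c \<and> c \<le> s j i" if d: "(Suc i, c) \<in> diagram n lam" for i c
  proof -
    have "?T (Suc i, c) = letter_of j \<longleftrightarrow> letter_rank (?T (Suc i, c)) = Suc j"
      by (simp add: letter_rank_inject[symmetric])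
    also have "\<dots> \<longleftrightarrow> letter_rank (?T (Suc i, c)) \<le> Suc j \<and> \<not> letter_rank (?T (Suc i, c)) \<le> Suc (j - 1)"
      unfolding j'(3) by auto
    also have "\<dots> \<longleftrightarrow> s (j - 1) i < c \<and> c \<le> s j i"
      unfolding chain_tab_rank[OF d j'(1)] chain_tab_rank[OF d j'(2)] by auto
    finally show ?thesis .
  qed
  have "{c \<in> diagram n lam. ?T c = letter_of j} =
      (\<lambda>(i, c). (Suc i, c)) ` (SIGMA i:{..<n}. {s (j - 1) i<..s j i})"
  proof (intro equalityI subsetI)
    fix x assume x: "x \<in> {c \<in> diagram n lam. ?T c = letter_of j}"
    then obtain i c where ic: "x = (Suc i, c)" by (auto elim: diagram_cases)
    then show "x \<in> (\<lambda>(i, c). (Suc i, c)) ` (SIGMA i:{..<n}. {s (j - 1) i<..s j i})"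
      using x eq[of i c] by (auto simp: diagram_Suc)
  next
    fix x assume "x \<in> (\<lambda>(i, c). (Suc i, c)) ` (SIGMA i:{..<n}. {s (j - 1) i<..s j i})"
    then obtain i c where ic: "x = (Suc i, c)" "i < n" "s (j - 1) i < c" "c \<le> s j i" by auto
    then have "(Suc i, c) \<in> diagram n lam" using le[of i] by (simp add: diagram_Suc)
    then show "x \<in> {c \<in> diagram n lam. ?T c = letter_of j}" using eq ic by simp
  qed
  moreover have "inj_on (\<lambda>(i, c). (Suc i, c)) (SIGMA i:{..<n}. {s (j - 1) i<..s j i})"
    by (auto simp: inj_on_def)
  ultimately show ?thesis
    unfolding tab_count_def by (simp add: card_image)
qed

abbreviation yv :: "nat \<Rightarrow> laurent" where "yv j \<equiv> t * ev j"

lemma tab_term_eq: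
  defines "T \<equiv> chain_tab n lam s"
  shows "t ^ (2 * tab_bar n lam T) * tab_wgt n lam T = (\<Prod>j = 1..2*n. tab_weight n xv yv j (s j) (s (j - 1)))"
proof -
  let ?N = "\<lambda>j. tab_count n lam T (letter_of j)"
  let ?z = "\<lambda>j. if even j then xv (j div 2 - 1) else yv (j div 2)"
  have w: "tab_weight n xv yv j (s j) (s (j - 1)) = ?z j ^ ?N j" if j: "j \<in> {1..2*n}" for j
    using s j tab_count_chain[OF j] by (auto simp: tab_weight_def tab_chains_def T_def)
  have "t ^ (2 * tab_bar n lam T) * tab_wgt n lam T =
     (\<Prod>k = 1..n. (t ^ 2) ^ tab_count n lam T (Bar k) *
       X k (int (tab_count n lam T (Plain k)) - int (tab_count n lam T (Bar k))))"
    by (simp add: tab_bar_def tab_wgt_def power_mult prod.distrib power_sum)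
  also have "\<dots> = (\<Prod>k = 1..n. ?z (2*k - 1) ^ ?N (2*k - 1) * ?z (2*k) ^ ?N (2*k))"
  proof (intro prod.cong refl)
    fix k assume k: "k \<in> {1..n}"
    then have "odd (2*k - 1)" "(2*k - 1) div 2 = k - 1" "(2*k - 1 + 1) div 2 = k" "Suc (k - 1) = k" by auto
    then show "(t ^ 2) ^ tab_count n lam T (Bar k) *
        X k (int (tab_count n lam T (Plain k)) - int (tab_count n lam T (Bar k))) =
        ?z (2*k - 1) ^ ?N (2*k - 1) * ?z (2*k) ^ ?N (2*k)"
      by (simp add: X_diff letter_of_def power_mult_distrib power2_eq_square mult_ac)
  qed
  also have "\<dots> = (\<Prod>j = 1..2*n. ?z j ^ ?N j)"
    by (rule prod_pairs[symmetric])
  also have "\<dots> = (\<Prod>j = 1..2*n. tab_weight n xv yv j (s j) (s (j - 1)))"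
    by (intro prod.cong refl w[symmetric])
  finally show ?thesis .
qed

end

lemma chain_tab_of_tab_chain:
  assumes T: "T \<in> sp_tableaux n lam"
  shows "chain_tab n lam (tab_chain n lam T) = T"
proof (rule extensionalityI[of _ "diagram n lam"])
  show "chain_tab n lam (tab_chain n lam T) \<in> extensional (diagram n lam)" by (simp add: chain_tab_def)
  show "T \<in> extensional (diagram n lam)" using T by (auto simp: sp_tableaux_def PiE_iff)
  fix x assume x: "x \<in> diagram n lam"
  then obtain i c where ic: "x = (Suc i, c)" by (auto elim: diagram_cases)
  note d = x[unfolded ic]
  have "T (Suc i, c) \<in> letters n" using T d by (auto simp: sp_tableaux_def PiE_iff)
  note L = letter_of_letter_rank[OF this]
  have "(LEAST j. c \<le> tab_chain n lam T j i) = letter_rank (T (Suc i, c)) - 1"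
  proof (rule Least_equality)
    have "letter_rank (T (Suc i, c)) - 1 \<le> 2*n" using L by linarith
    then show "c \<le> tab_chain n lam T (letter_rank (T (Suc i, c)) - 1) i"
      using le_tab_chain_iff[OF T _ d, of "letter_rank (T (Suc i, c)) - 1"] L by simp
    fix j assume j: "c \<le> tab_chain n lam T j i"
    show "letter_rank (T (Suc i, c)) - 1 \<le> j"
    proof (cases "j \<le> 2*n")
      case True
      then show ?thesis using le_tab_chain_iff[OF T True d] j by simp
    \<comment> \<open>Beyond \<open>2*n\<close> the chain is undefined, but the rank is at most
      \<open>Suc (2*n)\<close>.\<close>
    qed (use L in linarith)
  qed
  then show "chain_tab n lam (tab_chain n lam T) x = T x"
    using d L unfolding ic by (simp add: chain_tab_def)
qed

theorem sp_char_eq_chain_sum: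
  assumes lam: "partition_at_most n lam"
  shows "sp_char n lam = chain_sum (subshapes lam) (tab_weight n xv yv) (\<lambda>_. 0) (2*n) (\<lambda>i. lam (Suc i))"
proof -
  let ?w = "\<lambda>s. \<Prod>j = 1..2*n. tab_weight n xv yv j (s j) (s (j - 1))"
  let ?C = "{s. s \<in> {0..2*n} \<rightarrow>\<^sub>E subshapes lam \<and> s 0 = (\<lambda>_. 0) \<and> s (2*n) = (\<lambda>i. lam (Suc i))}"
  note fin = finite_subshapes[OF lam]
  have "sp_char n lam = (\<Sum>s\<in>tab_chains n lam. ?w s)"
    unfolding sp_char_def
  proof (rule sum.reindex_bij_witness[of _ "chain_tab n lam" "tab_chain n lam"])
    fix T assume T: "T \<in> sp_tableaux n lam"
    show inv: "chain_tab n lam (tab_chain n lam T) = T" by (rule chain_tab_of_tab_chain[OF T])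
    show mem: "tab_chain n lam T \<in> tab_chains n lam" by (rule tab_chain_mem[OF T lam])
    show "?w (tab_chain n lam T) = t ^ (2 * tab_bar n lam T) * tab_wgt n lam T"
      using tab_term_eq[OF mem lam] unfolding inv by simp
  next
    fix s assume s: "s \<in> tab_chains n lam"
    show "tab_chain n lam (chain_tab n lam s) = s" by (rule tab_chain_of_chain_tab[OF s lam])
    show "chain_tab n lam s \<in> sp_tableaux n lam" by (rule chain_tab_mem[OF s lam])
  qed
  also have "\<dots> = (\<Sum>s\<in>?C. ?w s)"
  proof (rule sum.mono_neutral_left)
    show "finite ?C"
      by (rule finite_subset[of _ "{0..2*n} \<rightarrow>\<^sub>E subshapes lam"]) (auto intro!: finite_PiE fin)
    show "tab_chains n lam \<subseteq> ?C"
      by (auto simp: tab_chains_def)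
    show "\<forall>s\<in>?C - tab_chains n lam. ?w s = 0"
    proof
      fix s assume "s \<in> ?C - tab_chains n lam"
      then obtain j where j: "j \<in> {1..2*n}" "\<not> (hstrip (s j) (s (j - 1)) \<and> (\<forall>i\<ge>(j + 1) div 2. s j i = 0))"
        unfolding tab_chains_def by blast
      have "tab_weight n xv yv j (s j) (s (j - 1)) = 0"
        unfolding tab_weight_def by (simp only: j(2) if_False)
      then show "?w s = 0" by (intro prod_zero) (use j in auto)
    qed
  qed
  also have "\<dots> = chain_sum (subshapes lam) (tab_weight n xv yv) (\<lambda>_. 0) (2*n) (\<lambda>i. lam (Suc i))"
    by (rule chain_sum_eq) (use fin in \<open>auto simp: subshapes_def\<close>)
  finally show ?thesis .
qed

section \<open>The deformed denominator formula\<close>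

text \<open>The exponent of every old variable grows by one; the extra power is multiplied into the
  two new factors that couple this variable with the new one.\<close>

lemma D_sp_Suc:
  "D_sp (Suc n) = D_sp n * ((\<Prod>j<n. (xv j + t * ev j) + t * xv n + ev n) * (xv n + ev n))"
proof -
  let ?B = "\<lambda>i j. (1 + t * X i (- 1) * X j 1) * (1 + t * X i (- 1) * X j (- 1))"
  have last: "(\<Prod>i = 1..Suc n. h i) = (\<Prod>i = 1..n. h i) * h (Suc n)" for h :: "nat \<Rightarrow> laurent"
    by simp
  have "X i (int (Suc n) - int i + 1) = X i (int n - int i + 1) * X i 1" for i
    by (simp add: X_mult)
  then have "(\<Prod>i = 1..Suc n. X i (int (Suc n) - int i + 1)) =
      (\<Prod>i = 1..n. X i (int n - int i + 1)) * (\<Prod>i = 1..n. X i 1) * X (Suc n) 1"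
    unfolding last by (simp only: prod.distrib) simp
  moreover have "(\<Prod>i = 1..Suc n. \<Prod>j = i+1..Suc n. ?B i j) =
      (\<Prod>i = 1..n. \<Prod>j = i+1..n. ?B i j) * (\<Prod>i = 1..n. ?B i (Suc n))"
  proof -
    have "(\<Prod>i = 1..n. \<Prod>j = i+1..Suc n. ?B i j) = (\<Prod>i = 1..n. (\<Prod>j = i+1..n. ?B i j) * ?B i (Suc n))"
      by (intro prod.cong refl prod.nat_ivl_Suc') simp
    then show ?thesis unfolding last by (simp only: prod.distrib) simp
  qed
  moreover note last[of "\<lambda>i. 1 + t * X i (- 2)"]
  ultimately have "D_sp (Suc n) = D_sp n * ((\<Prod>i = 1..n. X i 1 * ?B i (Suc n)) * (X (Suc n) 1 * (1 + t * X (Suc n) (- 2))))"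
    unfolding D_sp_def prod.distrib by (simp only: mult_ac)
  also have "X (Suc n) 1 * (1 + t * X (Suc n) (- 2)) = xv n + ev n"
    by (simp add: distrib_left mult.left_commute X_mult)
  also have "(\<Prod>i = 1..n. X i 1 * ?B i (Suc n)) = (\<Prod>j<n. xv j * ?B (Suc j) (Suc n))"
    by (simp add: prod.atLeast1_atMost_eq)
  also have "\<dots> = (\<Prod>j<n. (xv j + t * ev j) + t * xv n + ev n)"
  proof (intro prod.cong refl)
    fix j
    define a b z w where "a = X (Suc j) 1" and "b = X (Suc j) (-1)" and "z = X (Suc n) 1" and "w = X (Suc n) (-1)"
    have ab: "a * b = 1" "z * w = 1" by (simp_all add: a_def b_def z_def w_def X_mult)
    have "a * ((1 + t * b * z) * (1 + t * b * w)) =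
        a + t * (a * b) * z + t * (a * b) * w + t * (t * ((a * b) * (z * w) * b))"
      by (simp add: algebra_simps)
    also have "\<dots> = (a + t * (t * b)) + t * z + t * w" by (simp add: ab)
    finally show "xv j * ?B (Suc j) (Suc n) = (xv j + t * ev j) + t * xv n + ev n"
      by (simp only: a_def b_def z_def w_def)
  qed
  finally show ?thesis .
qed

lemma D_sp_eq_dprod: "D_sp n = dprod xv ev t n"
proof (induction n)
  case (Suc n)
  then show ?case unfolding D_sp_Suc by (simp add: dprod_def)
qed (simp add: D_sp_def dprod_def)

section \<open>Cancellation of the Vandermonde product\<close>

lemma single_eq_iff:
  "Poly_Mapping.single i (a::int) = Poly_Mapping.single j b \<longleftrightarrow> (i = j \<and> a = b) \<or> (a = 0 \<and> b = 0)"
proof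
  assume *: "Poly_Mapping.single i a = Poly_Mapping.single j b"
  have "Poly_Mapping.lookup (Poly_Mapping.single i a) i = Poly_Mapping.lookup (Poly_Mapping.single j b) i"
    "Poly_Mapping.lookup (Poly_Mapping.single i a) j = Poly_Mapping.lookup (Poly_Mapping.single j b) j" by (simp_all only: *)
  then show "(i = j \<and> a = b) \<or> (a = 0 \<and> b = 0)" by (auto simp: Poly_Mapping.lookup_single when_def split: if_splits)
qed auto

lemma vprod_nonzero: "vprod (\<lambda>j. xv j + yv j) n \<noteq> 0"
proof -
  have y: "yv j = Poly_Mapping.single (Poly_Mapping.single (Suc j) (-1)) (monom 1 2)" for j
    by (simp add: X_def t_def mult_single mult_monom numeral_2_eq_2)
  have "(xv j + yv j) - (xv i + yv i) \<noteq> 0" if "j < i" for i j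
  proof
    assume "(xv j + yv j) - (xv i + yv i) = 0"
    \<comment> \<open>The monomial of \<open>xv j\<close> occurs in no other term of the factor, and
      its coefficient there is \<open>1\<close>.\<close>
    then have "Poly_Mapping.lookup ((xv j + yv j) - (xv i + yv i)) (Poly_Mapping.single (Suc j) 1) = 0" by simp
    then show False
      using that unfolding y by (simp add: X_def Poly_Mapping.lookup_add Poly_Mapping.lookup_minus Poly_Mapping.lookup_single when_def single_eq_iff)
  qed
  then show ?thesis by (simp add: vprod_def)
qed

theorem theorem6p3:
  fixes n m :: nat and lam mu :: "nat \<Rightarrow> nat"
  assumes "n \<ge> 1"
    and "partition_at_most n lam"
    and "mu = add_delta n lam"
    and "m = lam 1 + n"
  shows "D_sp n * sp_char n lam =
    (\<Sum>A \<in> UA n mu. t ^ (ua_ssi n m A + ua_bar n m A) * (1 + t) ^ ua_neg n m A * ua_wgt n m A)"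
    (is "_ = ?R")
proof -
  let ?p = "\<lambda>i. lam (Suc i)"
  let ?f = "beta_seq n ?p"
  define U where "U = mu ` {1..n}"
  have dec: "?p (Suc i) \<le> ?p i" and zero: "n \<le> i \<Longrightarrow> ?p i = 0" for i
    using assms(2) by (auto simp: partition_at_most_def)
  have m: "m = mu 1" using assms by (simp add: add_delta_def)
  have f: "mu (Suc i) = ?f i" if "i < n" for i
    using that by (simp add: assms(3) add_delta_def beta_seq_def)
  have U_eq: "U = ?f ` {..<n}"
  proof -
    have "{1..n} = Suc ` {..<n}" by (simp add: image_Suc_lessThan)
    then show ?thesis unfolding U_def using f by (auto simp: image_image)
  qed
  have p0: "?p i \<le> ?p 0" for i
    by (rule lift_Suc_antimono_le[of ?p]) (use dec in auto)
  have U: "U \<subseteq> {1..m}"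
  proof
    fix q assume "q \<in> U"
    then obtain i where i: "i < n" "q = ?f i" unfolding U_eq by auto
    then show "q \<in> {1..m}" using p0[of i] assms(4) by (auto simp: beta_seq_def)
  qed
  then have U': "finite U" "0 \<notin> U" by (auto intro: finite_subset)
  have "U = ?f ` {..<n} - {0}" using U'(2) unfolding U_eq by auto
  then have dseq: "dseq U i = ?f i" if "i < n" for i
    using dseq_of_dec_seq[OF dec_seq_beta[of ?p, OF dec] that] by simp
  have "card U \<le> n" unfolding U_eq using card_image_le[of "{..<n}" ?f] by simp
  \<comment> \<open>The smallest part is still positive, so the enumeration of \<open>U\<close> has
    at least \<open>n\<close> nonzero terms.\<close>
  moreover have "n - 1 < card U"
    using dseq_pos_iff[OF U', of "n - 1"] dseq[of "n - 1"] beta_seq_pos[of "n - 1" n ?p] assms(1) by simp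
  ultimately have card: "card U = n" by simp
  have xy: "xv j * yv j = t * t" for j
    using xv_ev[of j] by (simp only: mult.left_commute)
  have alt: "alternant n xv yv (dseq U) = alternant n xv yv ?f"
    unfolding alternant_def by (rule seqdet_cong) (simp add: dseq)
  have R: "vprod (\<lambda>j. xv j + yv j) n * ?R = D_sp n * alternant n xv yv ?f"
    using ua_chains_alternant[of xv ev t U m n, OF xv_ev U] card
    unfolding ua_sum_eq_chain_sum[OF U_def U m] by (simp only: simp_thms if_True D_sp_eq_dprod alt)
  have L: "vprod (\<lambda>j. xv j + yv j) n * sp_char n lam = alternant n xv yv ?f"
    unfolding sp_char_eq_chain_sum[OF assms(2)]
  proof (rule tab_chains_alternant[OF xy finite_subshapes[OF assms(2)]])
    show "p' \<in> subshapes lam" if "p \<in> subshapes lam" "\<And>i. p' i \<le> p i" for p p'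
      using that unfolding subshapes_def by (blast intro: le_trans)
  qed (use dec zero in \<open>auto simp: subshapes_def\<close>)
  \<comment> \<open>Multiplied by the Vandermonde product, both sides equal \<open>D_sp n\<close>
    times the same alternant.\<close>
  have "vprod (\<lambda>j. xv j + yv j) n * (D_sp n * sp_char n lam) = vprod (\<lambda>j. xv j + yv j) n * ?R"
    unfolding R by (simp only: mult.left_commute L)
  then show ?thesis
    using vprod_nonzero by (simp only: mult_cancel_left) blast
qed

end
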